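(* (i) Let $k_{||},k_{\perp}\in(0,1)$ be constants with $k_{||}^2+k_{\perp}^2=1$, and let $M^6$ be a $6$-dimensional manifold endowed with an $SU(2)$ structure $(J,g,\alpha,\omega,\Omega)$ such that the associated $2$-forms $Re(\Omega)_{||}$, $Re(\Omega)_{\perp}$, $Im(\Omega)$ (together with $\alpha$) satisfy the SUSY equations IIB. Then $M^6$ admits two half-flat $SU(2)$ structures $(\hat J_1,\hat g_1,\hat\alpha_1,\hat\omega,\hat\Omega)$ and $(\hat J_2,\hat g_2,\hat\alpha_2,\hat\omega,\hat\Omega)$ such that $d(\hat\alpha_1)=0$ and $\hat\alpha_2=k_{||}\,Im(\hat\alpha_1)-i\,\frac{Re(\hat\alpha_1)}{k_{||}}$, namely those given by $$\hat\alpha_1=k_{||}Re(\alpha)+i\,Im(\alpha),\quad \hat\alpha_2=k_{||}Im(\alpha)-i\,Re(\alpha),\quad \hat\omega=\frac1{k_\perp}Re(\Omega)_{||},\quad \hat\Omega=\frac1{k_{||}}Re(\Omega)_\perp+i\,Im(\Omega).$$ (ii) Conversely, let $M^6$ be a $6$-dimensional manifold endowed with a half-flat $SU(2)$ structure $(\hat J_1,\hat g_1,\hat\alpha_1,\hat\omega,\hat\Omega)$ satisfying $d(\hat\alpha_1)=0$. If $k_{||}\in(0,1)$ is such that the $SU(2)$ structure $(\hat J_2,\hat g_2,\hat\alpha_2=k_{||}\,Im(\hat\alpha_1)-i\,\frac{Re(\hat\alpha_1)}{k_{||}},\hat\omega,\hat\Omega)$ is half-flat, then the forms $(Re(\Omega)_{||},Re(\Omega)_\perp,Im(\Omega),\alpha)$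 defined by $$\frac1{k_\perp}Re(\Omega)_{||}=\hat\omega,\qquad \frac1{k_{||}}Re(\Omega)_\perp+i\,Im(\Omega)=\hat\Omega,\qquad k_{||}Re(\alpha)+i\,Im(\alpha)=\hat\alpha_1,$$ where $k_\perp=\sqrt{1-k_{||}^2}$, are a solution of the SUSY equations IIB.
   Context: An $SU(3)$ structure $(F,\Psi)$ on a $6$-manifold consists of an almost Hermitian structure $(J,g)$ with fundamental $2$-form $F(X,Y)=g(JX,Y)$ and a $(3,0)$-form $\Psi$ with $F\wedge\Psi=0$ and $\frac43F^3=i\,\Psi\wedge\overline\Psi\neq0$. An $SU(2)$ structure $(J,g,\alpha,\omega,\Omega)$ on a $6$-manifold $M^6$ consists of an almost Hermitian structure $(J,g)$, a $(1,0)$-form $\alpha$ with $\|\alpha\|^2=i_{\overline\alpha}\alpha=2$, a real $2$-form $\omega$ and a $(2,0)$-form $\Omega$ with $\omega^2=\frac12\Omega\wedge\overline\Omega\neq0$, $\omega\wedge\Omega=0$, $\Omega\wedge\Omega=0$, $i_\alpha\Omega=0$, $i_\alpha\omega=0$, where $i_\alpha$ denotes contraction by the vector field dual to $\alpha$; its associated $SU(3)$ structure is $F=\omega+\frac i2\alpha\wedge\overline\alpha$ (the fundamental form of $(J,g)$) and $\Psi=\alpha\wedge\Omega$. The pair $(J,g)$ is determined by $(\alpha,\omega,\Omega)$; in particular $\hat J_j,\hat g_j$ are the almost complex structure and metric determined by $(\hat\alpha_j,\hat\omega,\hat\Omega)$. An $SU(3)$ structure is half-flat if $d(F\wedge F)=0$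 and $d(Re(\Psi))=0$. An $SU(2)$ structure is called half-flat if its associated $SU(3)$ structure is. Type IIB projection forms: given an $SU(2)$ structure and constants $k_{||},k_\perp$ as in the claim, let $\phi\in(0,\frac\pi2)$ be defined by $k_{||}=\cos\phi$, $k_\perp=\sin\phi$, and put $$Re(\Omega)_{||}=\tfrac12\big((1-\cos2\phi)Re(\Omega)+\sin(2\phi)\,\omega\big),\quad Re(\Omega)_\perp=\tfrac12\big((1+\cos2\phi)Re(\Omega)-\sin(2\phi)\,\omega\big).$$ SUSY equations IIB: the forms $(\alpha,Re(\Omega)_{||},Re(\Omega)_\perp,Im(\Omega))$ arising in this way from an $SU(2)$ structure are a solution if, for the $3$-form $H$ determined by the third equation, $$d(Re(\alpha))=0,\qquad d(Im(\alpha))=0,\qquad k_{||}H=k_\perp d(Im(\Omega)),$$ $$Re(\alpha)\wedge H=-\frac{k_\perp}{k_{||}}Im(\alpha)\wedge d(Re(\Omega)_\perp),\qquad Im(\alpha)\wedge H=\frac{k_\perp}{k_{||}}Re(\alpha)\wedge d(Re(\Omega)_\perp),$$ $$Re(\alpha)\wedge Im(\alpha)\wedge d(Re(\Omega)_{||})=-H\wedge Im(\Omega).$$ *)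

theory Defs
  imports "HOL-Analysis.Analysis" "HOL-Library.Function_Algebras"
begin

section \<open>Smooth 6-manifolds\<close>

text \<open>\<open>C\<^sup>k\<close> and \<open>C\<^sup>\<infinity>\<close> maps; only meaningful for open \<open>S\<close>.\<close>

primrec Ck_on :: "nat \<Rightarrow> ('a::real_normed_vector \<Rightarrow> 'b::real_normed_vector) \<Rightarrow> 'a set \<Rightarrow> bool" where
  "Ck_on 0 f S \<longleftrightarrow> continuous_on S f"
| "Ck_on (Suc k) f S \<longleftrightarrow>
     (\<forall>x\<in>S. f differentiable (at x)) \<and> (\<forall>v. Ck_on k (\<lambda>x. frechet_derivative f (at x) v) S)"

definition smooth_on :: "('a::real_normed_vector \<Rightarrow> 'b::real_normed_vector) \<Rightarrow> 'a set \<Rightarrow> bool" where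
  "smooth_on f S \<longleftrightarrow> (\<forall>k. Ck_on k f S)"

text \<open>A chart \<open>(U, \<phi>)\<close> is a coordinate domain with its coordinate map.  An atlas need not be maximal.\<close>

type_synonym 'm chart = "'m set \<times> ('m \<Rightarrow> real^6)"

definition cimage :: "'m chart \<Rightarrow> (real^6) set" where
  "cimage c = snd c ` fst c"

definition transition :: "'m chart \<Rightarrow> 'm chart \<Rightarrow> real^6 \<Rightarrow> real^6" where
  "transition c c' = snd c' \<circ> inv_into (fst c) (snd c)"

definition overlap :: "'m chart \<Rightarrow> 'm chart \<Rightarrow> (real^6) set" where
  "overlap c c' = snd c ` (fst c \<inter> fst c')"

definition smooth_manifold6 :: "'m topology \<Rightarrow> 'm chart set \<Rightarrow> bool" where
  "smooth_manifold6 X A \<longleftrightarrow>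
     Hausdorff_space X \<and>
     (\<exists>\<B>. countable \<B> \<and> (\<forall>V\<in>\<B>. openin X V) \<and>
        (\<forall>U p. openin X U \<and> p \<in> U \<longrightarrow> (\<exists>V\<in>\<B>. p \<in> V \<and> V \<subseteq> U))) \<and>
     (\<Union>c\<in>A. fst c) = topspace X \<and>
     (\<forall>c\<in>A. openin X (fst c) \<and> open (cimage c) \<and>
        homeomorphic_map (subtopology X (fst c)) (top_of_set (cimage c)) (snd c)) \<and>
     (\<forall>c\<in>A. \<forall>c'\<in>A. smooth_on (transition c c') (overlap c c'))"


section \<open>Complex-valued differential forms\<close>

text \<open>
  A tensor field on a manifold is given by its local expressions in the charts of the atlas, related
  on overlaps by the derivatives of the transition maps.  The value of a local expression outside
  the image of its chart carries no meaning, so equality of forms is \<open>form_eq\<close> below.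

  A local form at a point is a function on argument lists that is zero on lists of the
  wrong length.  Since the degree is recorded this way, the exterior operations are defined
  without explicit reference to degrees.
\<close>

type_synonym 'm dform = "'m chart \<Rightarrow> real^6 \<Rightarrow> (real^6) list \<Rightarrow> complex"

definition alternating_form :: "nat \<Rightarrow> ((real^6) list \<Rightarrow> complex) \<Rightarrow> bool" where
  "alternating_form k a \<longleftrightarrow>
     (\<forall>vs. length vs \<noteq> k \<longrightarrow> a vs = 0) \<and>
     (\<forall>us ws. length us + length ws + 1 = k \<longrightarrow> linear (\<lambda>v. a (us @ v # ws))) \<and>
     (\<forall>vs. \<not> distinct vs \<longrightarrow> a vs = 0)"

definition diff_form :: "'m chart set \<Rightarrow> nat \<Rightarrow> 'm dform \<Rightarrow> bool" where
  "diff_form A k a \<longleftrightarrow>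
     (\<forall>c\<in>A. \<forall>x\<in>cimage c. alternating_form k (a c x)) \<and>
     (\<forall>c\<in>A. \<forall>vs. smooth_on (\<lambda>x. a c x vs) (cimage c)) \<and>
     (\<forall>c\<in>A. \<forall>c'\<in>A. \<forall>x\<in>overlap c c'. \<forall>vs.
        a c x vs = a c' (transition c c' x) (map (frechet_derivative (transition c c') (at x)) vs))"

definition form_eq :: "'m chart set \<Rightarrow> 'm dform \<Rightarrow> 'm dform \<Rightarrow> bool" where
  "form_eq A a b \<longleftrightarrow> (\<forall>c\<in>A. \<forall>x\<in>cimage c. a c x = b c x)"

definition nowhere_zero :: "'m chart set \<Rightarrow> 'm dform \<Rightarrow> bool" where
  "nowhere_zero A a \<longleftrightarrow> (\<forall>c\<in>A. \<forall>x\<in>cimage c. a c x \<noteq> 0)"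

definition real_form :: "'m chart set \<Rightarrow> 'm dform \<Rightarrow> bool" where
  "real_form A a \<longleftrightarrow> (\<forall>c\<in>A. \<forall>x\<in>cimage c. \<forall>vs. a c x vs \<in> \<real>)"

definition fscale :: "complex \<Rightarrow> 'm dform \<Rightarrow> 'm dform" (infixr "*\<^sub>F" 75) where
  "z *\<^sub>F a = (\<lambda>c x vs. z * a c x vs)"

definition fcnj :: "'m dform \<Rightarrow> 'm dform" where
  "fcnj a = (\<lambda>c x vs. cnj (a c x vs))"

definition fRe :: "'m dform \<Rightarrow> 'm dform" where
  "fRe a = (\<lambda>c x vs. complex_of_real (Re (a c x vs)))"

definition fIm :: "'m dform \<Rightarrow> 'm dform" where
  "fIm a = (\<lambda>c x vs. complex_of_real (Im (a c x vs)))"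

text \<open>
  The wedge product as a sum over shuffles: \<open>S\<close> is the set of positions of the arguments passed to
  the first factor, and the sign is that of the corresponding shuffle.  For 1-forms this gives
  \<open>(a \<and> b)(v, w) = a(v) b(w) - a(w) b(v)\<close>.
\<close>

definition fwedge :: "'m dform \<Rightarrow> 'm dform \<Rightarrow> 'm dform" (infixr "\<and>\<^sub>F" 70) where
  "a \<and>\<^sub>F b = (\<lambda>c x vs. \<Sum>S\<in>Pow {..<length vs}.
     (- 1) ^ card {(i, j). i < j \<and> i \<in> {..<length vs} - S \<and> j \<in> S}
       * a c x (nths vs S) * b c x (nths vs ({..<length vs} - S)))"

text \<open>
  In a chart, \<open>(da)(v\<^sub>0, \<dots>, v\<^sub>k)\<close> is the alternating sum of the derivatives, in direction
  \<open>v\<^sub>i\<close>, of \<open>a\<close> evaluated at the remaining (constant) vectors.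
\<close>

definition ext_d :: "'m dform \<Rightarrow> 'm dform" where
  "ext_d a = (\<lambda>c x vs. \<Sum>i<length vs.
     (- 1) ^ i * frechet_derivative (\<lambda>y. a c y (take i vs @ drop (Suc i) vs)) (at x) (vs ! i))"


section \<open>Almost Hermitian structures\<close>

type_synonym 'm endo = "'m chart \<Rightarrow> real^6 \<Rightarrow> real^6 \<Rightarrow> real^6"
type_synonym 'm metric_field = "'m chart \<Rightarrow> real^6 \<Rightarrow> real^6 \<Rightarrow> real^6 \<Rightarrow> real"

definition almost_complex_structure :: "'m chart set \<Rightarrow> 'm endo \<Rightarrow> bool" where
  "almost_complex_structure A J \<longleftrightarrow>
     (\<forall>c\<in>A. \<forall>x\<in>cimage c. linear (J c x) \<and> (\<forall>v. J c x (J c x v) = - v)) \<and>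
     (\<forall>c\<in>A. \<forall>v. smooth_on (\<lambda>x. J c x v) (cimage c)) \<and>
     (\<forall>c\<in>A. \<forall>c'\<in>A. \<forall>x\<in>overlap c c'. \<forall>v.
        frechet_derivative (transition c c') (at x) (J c x v) =
        J c' (transition c c' x) (frechet_derivative (transition c c') (at x) v))"

definition riemannian_metric :: "'m chart set \<Rightarrow> 'm metric_field \<Rightarrow> bool" where
  "riemannian_metric A g \<longleftrightarrow>
     (\<forall>c\<in>A. \<forall>x\<in>cimage c. (\<forall>w. linear (\<lambda>v. g c x v w)) \<and>
        (\<forall>v w. g c x v w = g c x w v) \<and> (\<forall>v. v \<noteq> 0 \<longrightarrow> g c x v v > 0)) \<and>
     (\<forall>c\<in>A. \<forall>v w. smooth_on (\<lambda>x. g c x v w) (cimage c)) \<and>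
     (\<forall>c\<in>A. \<forall>c'\<in>A. \<forall>x\<in>overlap c c'. \<forall>v w.
        g c x v w = g c' (transition c c' x)
          (frechet_derivative (transition c c') (at x) v)
          (frechet_derivative (transition c c') (at x) w))"

definition almost_hermitian :: "'m chart set \<Rightarrow> 'm endo \<Rightarrow> 'm metric_field \<Rightarrow> bool" where
  "almost_hermitian A J g \<longleftrightarrow>
     almost_complex_structure A J \<and> riemannian_metric A g \<and>
     (\<forall>c\<in>A. \<forall>x\<in>cimage c. \<forall>v w. g c x (J c x v) (J c x w) = g c x v w)"

definition fundamental_form :: "'m endo \<Rightarrow> 'm metric_field \<Rightarrow> 'm dform" where
  "fundamental_form J g = (\<lambda>c x vs.
     if length vs = 2 then complex_of_real (g c x (J c x (vs ! 0)) (vs ! 1)) else 0)"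

text \<open>
  A \<open>p\<close>-form has type \<open>(p,0)\<close> iff it vanishes when an argument is of type \<open>(0,1)\<close>, i.e. of the form
  \<open>v + i J v\<close>; for a 1-form this says \<open>a(J v) = i a(v)\<close>.
\<close>

definition form_type :: "'m chart set \<Rightarrow> 'm endo \<Rightarrow> nat \<Rightarrow> 'm dform \<Rightarrow> bool" where
  "form_type A J p a \<longleftrightarrow> diff_form A p a \<and>
     (\<forall>c\<in>A. \<forall>x\<in>cimage c. \<forall>v vs. a c x (v # vs) + \<i> * a c x (J c x v # vs) = 0)"

text \<open>
  The vector \<open>g\<close>-dual to a linear functional, and the contraction \<open>i\<^sub>a b\<close> of \<open>b\<close> with the complex
  vector field dual to the complex 1-form \<open>a\<close>.  The duality is extended complex-linearly:
  if \<open>g(X,\<cdot>) = Re a\<close> and \<open>g(Y,\<cdot>) = Im a\<close>, then the field dual to \<open>a\<close> is \<open>X + iY\<close>.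
\<close>

definition sharp :: "(real^6 \<Rightarrow> real^6 \<Rightarrow> real) \<Rightarrow> (real^6 \<Rightarrow> real) \<Rightarrow> real^6" where
  "sharp G l = (THE X. \<forall>v. G X v = l v)"

definition contract :: "'m metric_field \<Rightarrow> 'm dform \<Rightarrow> 'm dform \<Rightarrow> 'm dform" where
  "contract g a b = (\<lambda>c x vs.
     b c x (sharp (g c x) (\<lambda>v. Re (a c x [v])) # vs)
     + \<i> * b c x (sharp (g c x) (\<lambda>v. Im (a c x [v])) # vs))"


section \<open>SU(3) and SU(2) structures\<close>

definition su3_structure ::
  "'m chart set \<Rightarrow> 'm endo \<Rightarrow> 'm metric_field \<Rightarrow> 'm dform \<Rightarrow> 'm dform \<Rightarrow> bool" where
  "su3_structure A J g F \<Psi> \<longleftrightarrow>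
     almost_hermitian A J g \<and>
     form_eq A F (fundamental_form J g) \<and>
     form_type A J 3 \<Psi> \<and>
     form_eq A (F \<and>\<^sub>F \<Psi>) 0 \<and>
     form_eq A ((4/3) *\<^sub>F (F \<and>\<^sub>F F \<and>\<^sub>F F)) (\<i> *\<^sub>F (\<Psi> \<and>\<^sub>F fcnj \<Psi>)) \<and>
     nowhere_zero A (\<Psi> \<and>\<^sub>F fcnj \<Psi>)"

definition half_flat_su3 ::
  "'m chart set \<Rightarrow> 'm endo \<Rightarrow> 'm metric_field \<Rightarrow> 'm dform \<Rightarrow> 'm dform \<Rightarrow> bool" where
  "half_flat_su3 A J g F \<Psi> \<longleftrightarrow>
     su3_structure A J g F \<Psi> \<and>
     form_eq A (ext_d (F \<and>\<^sub>F F)) 0 \<and>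
     form_eq A (ext_d (fRe \<Psi>)) 0"

definition assoc_F :: "'m dform \<Rightarrow> 'm dform \<Rightarrow> 'm dform" where
  "assoc_F \<alpha> \<omega> = \<omega> + (\<i>/2) *\<^sub>F (\<alpha> \<and>\<^sub>F fcnj \<alpha>)"

definition assoc_Psi :: "'m dform \<Rightarrow> 'm dform \<Rightarrow> 'm dform" where
  "assoc_Psi \<alpha> \<Omega> = \<alpha> \<and>\<^sub>F \<Omega>"

text \<open>
  The last condition says that \<open>\<omega> + (i/2) \<alpha> \<and> cnj \<alpha>\<close> is the fundamental form of \<open>(J, g)\<close>; it is what
  ties \<open>\<omega>\<close> to \<open>(J, g)\<close>, and makes \<open>(J, g)\<close> determined by \<open>(\<alpha>, \<omega>, \<Omega>)\<close>.
\<close>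

definition su2_structure ::
  "'m chart set \<Rightarrow> 'm endo \<Rightarrow> 'm metric_field \<Rightarrow> 'm dform \<Rightarrow> 'm dform \<Rightarrow> 'm dform \<Rightarrow> bool" where
  "su2_structure A J g \<alpha> \<omega> \<Omega> \<longleftrightarrow>
     almost_hermitian A J g \<and>
     form_type A J 1 \<alpha> \<and>
     (\<forall>c\<in>A. \<forall>x\<in>cimage c. contract g (fcnj \<alpha>) \<alpha> c x [] = 2) \<and>
     diff_form A 2 \<omega> \<and> real_form A \<omega> \<and>
     form_type A J 2 \<Omega> \<and>
     form_eq A (\<omega> \<and>\<^sub>F \<omega>) ((1/2) *\<^sub>F (\<Omega> \<and>\<^sub>F fcnj \<Omega>)) \<and>
     nowhere_zero A (\<omega> \<and>\<^sub>F \<omega>) \<and>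
     form_eq A (\<omega> \<and>\<^sub>F \<Omega>) 0 \<and>
     form_eq A (\<Omega> \<and>\<^sub>F \<Omega>) 0 \<and>
     form_eq A (contract g \<alpha> \<Omega>) 0 \<and>
     form_eq A (contract g \<alpha> \<omega>) 0 \<and>
     form_eq A (fundamental_form J g) (assoc_F \<alpha> \<omega>)"

definition half_flat_su2 ::
  "'m chart set \<Rightarrow> 'm endo \<Rightarrow> 'm metric_field \<Rightarrow> 'm dform \<Rightarrow> 'm dform \<Rightarrow> 'm dform \<Rightarrow> bool" where
  "half_flat_su2 A J g \<alpha> \<omega> \<Omega> \<longleftrightarrow>
     su2_structure A J g \<alpha> \<omega> \<Omega> \<and> half_flat_su3 A J g (assoc_F \<alpha> \<omega>) (assoc_Psi \<alpha> \<Omega>)"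


section \<open>Type IIB projection forms and SUSY equations\<close>

definition proj_angle :: "real \<Rightarrow> real \<Rightarrow> real" where
  "proj_angle k_par k_perp = (THE \<phi>. 0 < \<phi> \<and> \<phi> < pi / 2 \<and> k_par = cos \<phi> \<and> k_perp = sin \<phi>)"

definition ReOmega_par :: "real \<Rightarrow> real \<Rightarrow> 'm dform \<Rightarrow> 'm dform \<Rightarrow> 'm dform" where
  "ReOmega_par k_par k_perp \<omega> \<Omega> =
     (let \<phi> = proj_angle k_par k_perp in
      (1/2) *\<^sub>F (complex_of_real (1 - cos (2 * \<phi>)) *\<^sub>F fRe \<Omega>
              + complex_of_real (sin (2 * \<phi>)) *\<^sub>F \<omega>))"

definition ReOmega_perp :: "real \<Rightarrow> real \<Rightarrow> 'm dform \<Rightarrow> 'm dform \<Rightarrow> 'm dform" where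
  "ReOmega_perp k_par k_perp \<omega> \<Omega> =
     (let \<phi> = proj_angle k_par k_perp in
      (1/2) *\<^sub>F (complex_of_real (1 + cos (2 * \<phi>)) *\<^sub>F fRe \<Omega>
              - complex_of_real (sin (2 * \<phi>)) *\<^sub>F \<omega>))"

text \<open>
  The third equation forces \<open>H = (k_perp / k_par) d I\<close> on the manifold, where \<open>I\<close> is
  the form \<open>Im \<Omega>\<close>; in particular \<open>H\<close> is unique and is a 3-form.
\<close>

definition susy_IIB_equations ::
  "'m chart set \<Rightarrow> real \<Rightarrow> real \<Rightarrow> 'm dform \<Rightarrow> 'm dform \<Rightarrow> 'm dform \<Rightarrow> 'm dform \<Rightarrow> bool" where
  "susy_IIB_equations A k_par k_perp \<alpha> R_par R_perp I \<longleftrightarrow>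
     (\<exists>H.
       form_eq A (ext_d (fRe \<alpha>)) 0 \<and>
       form_eq A (ext_d (fIm \<alpha>)) 0 \<and>
       form_eq A (complex_of_real k_par *\<^sub>F H) (complex_of_real k_perp *\<^sub>F ext_d I) \<and>
       form_eq A (fRe \<alpha> \<and>\<^sub>F H)
         (complex_of_real (- (k_perp / k_par)) *\<^sub>F (fIm \<alpha> \<and>\<^sub>F ext_d R_perp)) \<and>
       form_eq A (fIm \<alpha> \<and>\<^sub>F H)
         (complex_of_real (k_perp / k_par) *\<^sub>F (fRe \<alpha> \<and>\<^sub>F ext_d R_perp)) \<and>
       form_eq A (fRe \<alpha> \<and>\<^sub>F fIm \<alpha> \<and>\<^sub>F ext_d R_par) (- (H \<and>\<^sub>F I)))"

definition susy_IIB_solution ::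
  "'m chart set \<Rightarrow> real \<Rightarrow> real \<Rightarrow> 'm dform \<Rightarrow> 'm dform \<Rightarrow> 'm dform \<Rightarrow> 'm dform \<Rightarrow> bool" where
  "susy_IIB_solution A k_par k_perp \<alpha> R_par R_perp I \<longleftrightarrow>
     (\<exists>J g \<omega> \<Omega>. su2_structure A J g \<alpha> \<omega> \<Omega> \<and>
        form_eq A R_par (ReOmega_par k_par k_perp \<omega> \<Omega>) \<and>
        form_eq A R_perp (ReOmega_perp k_par k_perp \<omega> \<Omega>) \<and>
        form_eq A I (fIm \<Omega>)) \<and>
     susy_IIB_equations A k_par k_perp \<alpha> R_par R_perp I"

definition hat_alpha2 :: "real \<Rightarrow> 'm dform \<Rightarrow> 'm dform" where
  "hat_alpha2 k \<beta> = complex_of_real k *\<^sub>F fIm \<beta> - (\<i> / complex_of_real k) *\<^sub>F fRe \<beta>"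

end

theory Submission
  imports Defs
begin

text \<open>
  Write \<open>\<alpha> = a + i b\<close> and \<open>\<Omega> = R + i I\<close>, and let \<open>k\<close>, \<open>s\<close> be the two constants, \<open>k\<^sup>2 + s\<^sup>2 = 1\<close>.  In terms of
  the angle that they define, the projections are \<open>s (k \<omega> + s R)\<close> and \<open>k (k R - s \<omega>)\<close>.  So the hatted forms are
  \<open>k \<omega> + s R\<close> and \<open>(k R - s \<omega>) + i I\<close>: the pair \<open>(\<omega>, R)\<close> is rotated and \<open>I\<close> is kept, while \<open>\<alpha>\<close>
  is replaced by \<open>k a + i b\<close> or by \<open>k b - i a\<close>.

  On the level of algebra this changes nothing essential.  On the 4-plane annihilated by \<open>\<alpha>\<close> the forms \<open>\<omega>\<close>, \<open>R\<close>, \<open>I\<close> are the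
  Kaehler forms of a quaternionic triple, so a rotation of the triple is again such a triple; and rescaling \<open>a\<close> only
  changes the metric and the complex structure of the complementary 2-plane.  This gives the lemma
  \<open>su2_structure_squash_rotate\<close>, which produces the almost Hermitian pair by raising the index of \<open>R\<close>.  What needs proof is that the endomorphism
  obtained in this way is a complex structure on the 4-plane (\<open>norm_K_horizontal\<close>, \<open>KK\<close>), that it depends
  smoothly on the point (\<open>smooth_on_sharp\<close>), and that it does not depend on the chart (\<open>sharp_natural\<close>).
  The 1-form \<open>k b - i a\<close> comes from \<open>- i \<alpha>\<close> in the same way as \<open>k a + i b\<close> comes from \<open>\<alpha>\<close>.  The inverse of the
  construction is again a rotation and a rescaling, and gives the converse.

  For the derivatives, both hatted structures have the fundamental form \<open>F = w + k a \<and> b\<close>, where \<open>w = k \<omega> + s R\<close>, and with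
  \<open>r = k R - s \<omega>\<close> the real parts of their 3-forms are \<open>k a \<and> r - b \<and> I\<close> and \<open>k b \<and> r + a \<and> I\<close>.  If \<open>a\<close> and \<open>b\<close>
  are closed, the Leibniz rule (\<open>extd_shuffle_prod\<close>) and \<open>w\<^sup>2 = I\<^sup>2\<close> turn the vanishing of \<open>d(F\<^sup>2)\<close> and of the
  derivatives of these 3-forms into
  \<open>k a \<and> b \<and> dw = - dI \<and> I\<close>, \<open>b \<and> dI = k a \<and> dr\<close> and \<open>a \<and> dI = - k b \<and> dr\<close>.
  As \<open>H = (s/k) dI\<close>, these are the remaining SUSY equations (\<open>susy_IIB_equations_iff\<close>).
\<close>

section \<open>The wedge product at a point\<close>

text \<open>
  The wedge product at a single point of a chart.  Separating it from the charts makes its algebra a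
  statement about functions on lists.
\<close>

definition shuffle_prod ::
  "('v list \<Rightarrow> complex) \<Rightarrow> ('v list \<Rightarrow> complex) \<Rightarrow> 'v list \<Rightarrow> complex" (infixr "\<odot>" 70) where
  "a \<odot> b = (\<lambda>vs. \<Sum>S\<in>Pow {..<length vs}.
     (- 1) ^ card {(i, j). i < j \<and> i \<in> {..<length vs} - S \<and> j \<in> S}
       * a (nths vs S) * b (nths vs ({..<length vs} - S)))"

lemma fwedge_at: "(a \<and>\<^sub>F b) c x = a c x \<odot> b c x"
  by (simp add: fwedge_def shuffle_prod_def)

text \<open>
  Contraction with a vector and the grading involution: the former is an antiderivation of the product,
  and the latter produces its signs without mention of degrees.
\<close>

definition iprod :: "'v \<Rightarrow> ('v list \<Rightarrow> complex) \<Rightarrow> 'v list \<Rightarrow> complex" where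
  "iprod v a = (\<lambda>vs. a (v # vs))"

definition grade_inv :: "('v list \<Rightarrow> complex) \<Rightarrow> 'v list \<Rightarrow> complex" where
  "grade_inv a = (\<lambda>vs. (- 1) ^ length vs * a vs)"

lemma Pow_lessThan_Suc:
  "Pow {..<Suc n} = (`) Suc ` Pow {..<n} \<union> (\<lambda>T. insert 0 (Suc ` T)) ` Pow {..<n}"
proof -
  have "Pow (Suc ` {..<n}) = (`) Suc ` Pow {..<n}"
    by (rule image_Pow_surj[symmetric]) simp
  then show ?thesis
    by (simp add: lessThan_Suc_eq_insert_0 Pow_insert image_image)
qed

lemma shuffle_prod_Nil [simp]: "(a \<odot> b) [] = a [] * b []"
  by (simp add: shuffle_prod_def)

text \<open>
  The first argument goes to the left factor or to the right one.  In the second case it is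
  passed over by all arguments of the left factor, which is the sign recorded by the grading involution.
  This recursion replaces all further counting of inversions: associativity, graded commutativity
  and the Leibniz rule become inductions over the argument list.
\<close>

lemma shuffle_prod_Cons:
  "(a \<odot> b) (v # vs) = (iprod v a \<odot> b) vs + (grade_inv a \<odot> iprod v b) vs"
proof -
  let ?n = "length vs"
  let ?inv = "\<lambda>n S. {(i, j). i < j \<and> i \<in> {..<n} - S \<and> j \<in> S}"
  let ?t = "\<lambda>S. (- 1) ^ card (?inv (Suc ?n) S) * a (nths (v # vs) S) *
      b (nths (v # vs) ({..<Suc ?n} - S))"
  have inj: "inj_on ((`) Suc) (Pow {..<?n})"
    by (intro inj_onI) (metis inj_image_eq_iff inj_Suc)
  have inj0: "inj_on (\<lambda>T. insert 0 (Suc ` T)) (Pow {..<?n})"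
  proof (intro inj_onI)
    fix S T assume "insert 0 (Suc ` S) = insert 0 (Suc ` T)"
    then have "Suc ` S = Suc ` T" by (metis Zero_not_Suc imageE insert_ident)
    then show "S = T" by (metis inj_image_eq_iff inj_Suc)
  qed
  have inj_SS: "inj (map_prod Suc Suc)" by (intro prod.inj_map) simp_all
  \<comment> \<open>The position \<open>0\<close> is skipped by \<open>Suc ` T\<close>, so it precedes all \<open>card T\<close> selected positions.\<close>
  have without: "?t (Suc ` T) = (- 1) ^ card (?inv ?n T) * grade_inv a (nths vs T) *
      iprod v b (nths vs ({..<?n} - T))" if "T \<in> Pow {..<?n}" for T
  proof -
    have T: "T \<subseteq> {..<?n}" "finite T" using that finite_subset by auto
    have "?inv (Suc ?n) (Suc ` T) = ({0} \<times> Suc ` T) \<union> map_prod Suc Suc ` ?inv ?n T"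
      (is "?l = ?r")
    proof (intro set_eqI iffI)
      fix p assume "p \<in> ?l"
      then obtain i j where p: "p = (i, Suc j)" "i < Suc j" "i < Suc ?n" "i \<notin> Suc ` T" "j \<in> T" by auto
      show "p \<in> ?r" using p by (cases i) (auto simp: image_iff)
    qed auto
    moreover have "finite (?inv ?n T)"
      by (rule finite_subset[of _ "{..<?n} \<times> T"]) (use T in auto)
    moreover have "({0} \<times> Suc ` T) \<inter> map_prod Suc Suc ` ?inv ?n T = {}" by auto
    ultimately have c: "card (?inv (Suc ?n) (Suc ` T)) = card T + card (?inv ?n T)"
      using T by (simp add: card_Un_disjoint card_image inj_on_subset[OF inj_SS])
    have "length (nths vs T) = card T"
      unfolding length_nths by (rule arg_cong[where f=card]) (use T in auto)
    moreover have "nths (v # vs) (Suc ` T) = nths vs T"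
      by (simp add: nths_Cons image_iff)
    moreover have "{j. Suc j \<in> {..<Suc ?n} - Suc ` T} = {..<?n} - T" by auto
    then have "nths (v # vs) ({..<Suc ?n} - Suc ` T) = v # nths vs ({..<?n} - T)"
      by (simp add: nths_Cons image_iff)
    ultimately show ?thesis
      unfolding c by (simp add: grade_inv_def iprod_def power_add)
  qed
  have with0: "?t (insert 0 (Suc ` T)) = (- 1) ^ card (?inv ?n T) * iprod v a (nths vs T) *
      b (nths vs ({..<?n} - T))" if "T \<in> Pow {..<?n}" for T
  proof -
    have "?inv (Suc ?n) (insert 0 (Suc ` T)) = map_prod Suc Suc ` ?inv ?n T" (is "?l = ?r")
    proof (intro set_eqI iffI)
      fix p assume "p \<in> ?l"
      then obtain i j where p: "p = (Suc i, Suc j)" "i < j" "i < ?n" "i \<notin> T" "j \<in> T"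
        by (auto simp: less_Suc_eq_0_disj)
      then show "p \<in> ?r" by auto
    qed auto
    then have c: "card (?inv (Suc ?n) (insert 0 (Suc ` T))) = card (?inv ?n T)"
      by (simp add: card_image inj_on_subset[OF inj_SS])
    have "nths (v # vs) (insert 0 (Suc ` T)) = v # nths vs T"
      by (simp add: nths_Cons image_iff)
    moreover have "{j. Suc j \<in> {..<Suc ?n} - insert 0 (Suc ` T)} = {..<?n} - T" by auto
    then have "nths (v # vs) ({..<Suc ?n} - insert 0 (Suc ` T)) = nths vs ({..<?n} - T)"
      by (simp add: nths_Cons image_iff)
    ultimately show ?thesis unfolding c by (simp add: iprod_def)
  qed
  have "(a \<odot> b) (v # vs) = sum ?t (Pow {..<Suc ?n})"
    by (simp add: shuffle_prod_def)
  also have "\<dots> = sum ?t ((`) Suc ` Pow {..<?n}) + sum ?t ((\<lambda>T. insert 0 (Suc ` T)) ` Pow {..<?n})"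
    unfolding Pow_lessThan_Suc by (rule sum.union_disjoint) auto
  also have "\<dots> = (grade_inv a \<odot> iprod v b) vs + (iprod v a \<odot> b) vs"
    unfolding sum.reindex[OF inj] sum.reindex[OF inj0] shuffle_prod_def comp_def
    by (intro arg_cong2[where f="(+)"] sum.cong refl without with0)
  finally show ?thesis by simp
qed

lemma iprod_shuffle_prod:
  "iprod v (a \<odot> b) = iprod v a \<odot> b + grade_inv a \<odot> iprod v b"
  by (simp add: fun_eq_iff iprod_def[of v "a \<odot> b"] shuffle_prod_Cons)

definition scale_form :: "complex \<Rightarrow> ('v list \<Rightarrow> complex) \<Rightarrow> 'v list \<Rightarrow> complex" (infixr "\<cdot>" 75) where
  "z \<cdot> a = (\<lambda>vs. z * a vs)"

lemma fscale_at: "(z *\<^sub>F a) c x = z \<cdot> a c x"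
  by (simp add: fscale_def scale_form_def)

lemma shuffle_prod_add_left: "(a + b) \<odot> e = a \<odot> e + b \<odot> e"
  by (simp add: shuffle_prod_def fun_eq_iff algebra_simps sum.distrib)

lemma shuffle_prod_add_right: "e \<odot> (a + b) = e \<odot> a + e \<odot> b"
  by (simp add: shuffle_prod_def fun_eq_iff algebra_simps sum.distrib)

lemma shuffle_prod_diff_left: "(a - b) \<odot> e = a \<odot> e - b \<odot> e"
  by (simp add: shuffle_prod_def fun_eq_iff algebra_simps sum_subtractf)

lemma shuffle_prod_diff_right: "e \<odot> (a - b) = e \<odot> a - e \<odot> b"
  by (simp add: shuffle_prod_def fun_eq_iff algebra_simps sum_subtractf)

lemma shuffle_prod_scale_left: "(z \<cdot> a) \<odot> b = z \<cdot> (a \<odot> b)"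
  by (simp add: shuffle_prod_def fun_eq_iff scale_form_def sum_distrib_left mult_ac)

lemma shuffle_prod_scale_right: "a \<odot> (z \<cdot> b) = z \<cdot> (a \<odot> b)"
  by (simp add: shuffle_prod_def fun_eq_iff scale_form_def sum_distrib_left mult_ac)

lemma shuffle_prod_zero_left [simp]: "0 \<odot> a = 0"
  by (simp add: shuffle_prod_def fun_eq_iff)

lemma shuffle_prod_zero_right [simp]: "a \<odot> 0 = 0"
  by (simp add: shuffle_prod_def fun_eq_iff)

lemma shuffle_prod_uminus_left: "(- a) \<odot> b = - (a \<odot> b)"
  by (simp add: shuffle_prod_def fun_eq_iff sum_negf)

lemma shuffle_prod_uminus_right: "a \<odot> (- b) = - (a \<odot> b)"
  by (simp add: shuffle_prod_def fun_eq_iff sum_negf)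

lemma cnj_shuffle_prod: "cnj ((a \<odot> b) vs) = ((cnj \<circ> a) \<odot> (cnj \<circ> b)) vs"
  by (simp add: shuffle_prod_def)

lemma shuffle_prod_map: "(a \<odot> b) (map f vs) = ((\<lambda>us. a (map f us)) \<odot> (\<lambda>us. b (map f us))) vs"
  by (simp add: shuffle_prod_def nths_map)

lemma grade_inv_grade_inv [simp]: "grade_inv (grade_inv a) = a"
  by (simp add: grade_inv_def fun_eq_iff flip: power_mult_distrib mult.assoc)

lemma iprod_grade_inv: "iprod v (grade_inv a) = - grade_inv (iprod v a)"
  by (simp add: grade_inv_def iprod_def fun_eq_iff)

lemma grade_inv_iprod: "grade_inv (iprod v a) = - iprod v (grade_inv a)"
  by (simp add: grade_inv_def iprod_def fun_eq_iff)

lemma iprod_add: "iprod v (a + b) = iprod v a + iprod v b"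
  by (simp add: iprod_def fun_eq_iff)

lemma iprod_uminus: "iprod v (- a) = - iprod v a"
  by (simp add: iprod_def fun_eq_iff)

lemma grade_inv_shuffle_prod: "grade_inv (a \<odot> b) = grade_inv a \<odot> grade_inv b"
proof
  show "grade_inv (a \<odot> b) vs = (grade_inv a \<odot> grade_inv b) vs" for vs
  proof (induction vs arbitrary: a b)
    case Nil then show ?case by (simp add: grade_inv_def)
  next
    case (Cons v vs)
    show ?case
      using Cons[of "iprod v a" b] Cons[of "grade_inv a" "iprod v b"]
      by (simp add: shuffle_prod_Cons grade_inv_def[of "a \<odot> b"] iprod_grade_inv shuffle_prod_uminus_left
        shuffle_prod_uminus_right)
        (simp add: grade_inv_def[of "_ \<odot> _"] algebra_simps)
  qed
qed

lemma shuffle_prod_assoc: "(a \<odot> b) \<odot> e = a \<odot> (b \<odot> e)"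
proof
  show "((a \<odot> b) \<odot> e) vs = (a \<odot> (b \<odot> e)) vs" for vs
    by (induction vs arbitrary: a b e)
      (simp_all add: shuffle_prod_Cons iprod_shuffle_prod grade_inv_shuffle_prod
        shuffle_prod_add_left shuffle_prod_add_right)
qed

text \<open>
  The two parities are treated together because contraction exchanges them.
\<close>

lemma shuffle_prod_commute_graded:
  "grade_inv a = a \<Longrightarrow> (a \<odot> b) vs = (b \<odot> a) vs"
  "grade_inv a = - a \<Longrightarrow> (a \<odot> b) vs = (grade_inv b \<odot> a) vs"
proof (induction vs arbitrary: a b)
  case (Cons v vs)
  {
    case 1
    then have "grade_inv (iprod v a) = - iprod v a" by (simp add: grade_inv_iprod)
    then show ?case using 1 Cons(1)[of a "iprod v b"] Cons(2)[of "iprod v a" b]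
      by (simp add: shuffle_prod_Cons)
  next
    case 2
    have "grade_inv (iprod v a) = iprod v a" by (simp only: grade_inv_iprod 2 iprod_uminus minus_minus)
    then have "(a \<odot> b) (v # vs) = (b \<odot> iprod v a) vs + (- (a \<odot> iprod v b)) vs"
      using Cons(1)[of "iprod v a" b] by (simp only: shuffle_prod_Cons 2 shuffle_prod_uminus_left)
    also have "\<dots> = (b \<odot> iprod v a) vs - (grade_inv (iprod v b) \<odot> a) vs"
      using Cons(2)[OF 2, of "iprod v b"] by simp
    also have "\<dots> = (grade_inv b \<odot> a) (v # vs)"
      by (simp only: shuffle_prod_Cons iprod_grade_inv shuffle_prod_uminus_left grade_inv_grade_inv)
        simp
    finally show ?case .
  }
qed (simp_all add: grade_inv_def)

lemma even_commute: "grade_inv a = a \<Longrightarrow> a \<odot> b = b \<odot> a"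
  using shuffle_prod_commute_graded(1) by (intro ext)

lemma odd_commute: "grade_inv a = - a \<Longrightarrow> a \<odot> b = grade_inv b \<odot> a"
  using shuffle_prod_commute_graded(2) by (intro ext)

definition homogeneous :: "nat \<Rightarrow> ('v list \<Rightarrow> complex) \<Rightarrow> bool" where
  "homogeneous k a \<longleftrightarrow> (\<forall>vs. length vs \<noteq> k \<longrightarrow> a vs = 0)"

lemma homogeneous_grade_inv: "homogeneous k a \<Longrightarrow> grade_inv a = (- 1) ^ k \<cdot> a"
  by (auto simp: homogeneous_def grade_inv_def scale_form_def fun_eq_iff)

section \<open>The exterior derivative and the Leibniz rule\<close>

text \<open>
  The exterior derivative of a form on a single chart, as a field of functions on argument lists.
\<close>

definition extd :: "(real^6 \<Rightarrow> (real^6) list \<Rightarrow> complex) \<Rightarrow> real^6 \<Rightarrow> (real^6) list \<Rightarrow> complex" where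
  "extd f x = (\<lambda>vs. \<Sum>i<length vs.
     (- 1) ^ i * frechet_derivative (\<lambda>y. f y (take i vs @ drop (Suc i) vs)) (at x) (vs ! i))"

lemma ext_d_at: "ext_d a c x = extd (a c) x"
  by (simp add: ext_d_def extd_def)

definition dir_deriv ::
  "real^6 \<Rightarrow> (real^6 \<Rightarrow> (real^6) list \<Rightarrow> complex) \<Rightarrow> real^6 \<Rightarrow> (real^6) list \<Rightarrow> complex" where
  "dir_deriv v f x = (\<lambda>vs. frechet_derivative (\<lambda>y. f y vs) (at x) v)"

definition coeffs_diff :: "(real^6 \<Rightarrow> (real^6) list \<Rightarrow> complex) \<Rightarrow> real^6 \<Rightarrow> bool" where
  "coeffs_diff f x \<longleftrightarrow> (\<forall>vs. (\<lambda>y. f y vs) differentiable (at x))"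

lemma frechet_derivative_mult_complex:
  fixes f g :: "'a::real_normed_vector \<Rightarrow> complex"
  assumes "f differentiable (at x)" "g differentiable (at x)"
  shows "frechet_derivative (\<lambda>y. f y * g y) (at x) v =
    frechet_derivative f (at x) v * g x + f x * frechet_derivative g (at x) v"
proof -
  have "((\<lambda>y. f y * g y) has_derivative
      (\<lambda>v. f x * frechet_derivative g (at x) v + frechet_derivative f (at x) v * g x)) (at x)"
    using assms[unfolded frechet_derivative_works] by (rule has_derivative_mult)
  from frechet_derivative_at[OF this, symmetric] show ?thesis by (simp only: add.commute)
qed

lemma frechet_derivative_add_at:
  assumes "f differentiable (at x)" "g differentiable (at x)"
  shows "frechet_derivative (\<lambda>y. f y + g y) (at x) v =
    frechet_derivative f (at x) v + frechet_derivative g (at x) v"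
proof -
  have "((\<lambda>y. f y + g y) has_derivative
      (\<lambda>v. frechet_derivative f (at x) v + frechet_derivative g (at x) v)) (at x)"
    using assms[unfolded frechet_derivative_works] by (rule has_derivative_add)
  from frechet_derivative_at[OF this, symmetric] show ?thesis by (simp only:)
qed

lemma frechet_derivative_bounded_linear:
  assumes "bounded_linear h" "f differentiable (at x)"
  shows "frechet_derivative (\<lambda>y. h (f y)) (at x) v = h (frechet_derivative f (at x) v)"
proof -
  have "((\<lambda>y. h (f y)) has_derivative (\<lambda>v. h (frechet_derivative f (at x) v))) (at x)"
    using assms[unfolded frechet_derivative_works] by (rule bounded_linear.has_derivative)
  from frechet_derivative_at[OF this, symmetric] show ?thesis by (simp only:)
qed

lemma frechet_derivative_cong_open:
  assumes "open S" "x \<in> S" "\<And>y. y \<in> S \<Longrightarrow> f y = g y"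
  shows "frechet_derivative f (at x) = frechet_derivative g (at x)"
proof -
  have "(f has_derivative D) (at x) \<longleftrightarrow> (g has_derivative D) (at x)" for D
  proof
    show "(g has_derivative D) (at x)" if "(f has_derivative D) (at x)"
      using has_derivative_transform_within_open[OF that assms] .
    show "(f has_derivative D) (at x)" if "(g has_derivative D) (at x)"
      using has_derivative_transform_within_open[OF that assms(1,2) assms(3)[symmetric]] .
  qed
  then show ?thesis by (simp add: frechet_derivative_def)
qed

lemma extd_Nil [simp]: "extd f x [] = 0"
  by (simp add: extd_def)

text \<open>
  Cartan's formula \<open>i\<^sub>v d + d i\<^sub>v = L\<^sub>v\<close> for a constant field \<open>v\<close>, whose Lie derivative is the
  directional derivative of the coefficients.  Like the recursion for the product it strips the first argument.
\<close>

lemma extd_Cons: "extd f x (v # vs) = dir_deriv v f x vs - extd (\<lambda>y. iprod v (f y)) x vs"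
  by (simp add: extd_def dir_deriv_def iprod_def sum.lessThan_Suc_shift sum_negf del: sum.lessThan_Suc)

lemma iprod_extd: "iprod v (extd f x) = dir_deriv v f x - extd (\<lambda>y. iprod v (f y)) x"
  by (simp add: fun_eq_iff iprod_def[of v "extd f x"] extd_Cons)

lemma extd_cong_open:
  assumes "open S" "x \<in> S" "\<And>y. y \<in> S \<Longrightarrow> f y = g y"
  shows "extd f x = extd g x"
  unfolding extd_def
  by (intro ext sum.cong refl arg_cong2[where f="(*)"] fun_cong[OF frechet_derivative_cong_open[OF assms(1,2)]])
    (simp add: assms(3))

lemma coeffs_diff_iprod: "coeffs_diff f x \<Longrightarrow> coeffs_diff (\<lambda>y. iprod v (f y)) x"
  by (simp add: coeffs_diff_def iprod_def)

lemma coeffs_diff_bounded_linear: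
  "bounded_linear h \<Longrightarrow> coeffs_diff f x \<Longrightarrow> coeffs_diff (\<lambda>y vs. h (f y vs)) x"
  unfolding coeffs_diff_def differentiable_def using bounded_linear.has_derivative by fast

lemma coeffs_diff_scale: "coeffs_diff f x \<Longrightarrow> coeffs_diff (\<lambda>y. z \<cdot> f y) x"
  unfolding scale_form_def by (rule coeffs_diff_bounded_linear[OF bounded_linear_mult_right])

lemma coeffs_diff_grade_inv: "coeffs_diff f x \<Longrightarrow> coeffs_diff (\<lambda>y. grade_inv (f y)) x"
  by (simp add: coeffs_diff_def grade_inv_def)

lemma coeffs_diff_add: "coeffs_diff f x \<Longrightarrow> coeffs_diff g x \<Longrightarrow> coeffs_diff (\<lambda>y. f y + g y) x"
  by (simp add: coeffs_diff_def)

lemma coeffs_diff_shuffle_prod: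
  "coeffs_diff f x \<Longrightarrow> coeffs_diff g x \<Longrightarrow> coeffs_diff (\<lambda>y. f y \<odot> g y) x"
  unfolding coeffs_diff_def shuffle_prod_def
  by (intro allI differentiable_sum differentiable_mult) auto

lemma extd_bounded_linear:
  assumes h: "bounded_linear h" and f: "coeffs_diff f x"
  shows "extd (\<lambda>y vs. h (f y vs)) x = (\<lambda>vs. h (extd f x vs))"
proof -
  have 1: "(- 1) ^ i * h z = h ((- 1) ^ i * z)" for i and z
    by (cases "even i") (simp_all add: linear_neg[OF bounded_linear.linear[OF h]])
  show ?thesis
    using f by (intro ext)
      (simp only: extd_def coeffs_diff_def frechet_derivative_bounded_linear[OF h] 1
        linear_sum[OF bounded_linear.linear[OF h]])
qed

lemma extd_scale: "coeffs_diff f x \<Longrightarrow> extd (\<lambda>y. z \<cdot> f y) x = z \<cdot> extd f x"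
  unfolding scale_form_def by (rule extd_bounded_linear[OF bounded_linear_mult_right])

lemma extd_add:
  "coeffs_diff f x \<Longrightarrow> coeffs_diff g x \<Longrightarrow> extd (\<lambda>y. f y + g y) x = extd f x + extd g x"
  by (simp add: coeffs_diff_def extd_def fun_eq_iff frechet_derivative_add_at algebra_simps sum.distrib)

lemma extd_grade_inv:
  assumes "coeffs_diff f x"
  shows "extd (\<lambda>y. grade_inv (f y)) x = - grade_inv (extd f x)"
proof
  fix vs :: "(real^6) list"
  have 1: "frechet_derivative (\<lambda>y. grade_inv (f y) us) (at x) v =
      (- 1) ^ length us * frechet_derivative (\<lambda>y. f y us) (at x) v" for us v
    unfolding grade_inv_def
    using assms by (intro frechet_derivative_bounded_linear[OF bounded_linear_mult_right])
      (simp add: coeffs_diff_def)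
  have "(- 1) ^ i * ((- 1) ^ length (take i vs @ drop (Suc i) vs) * z) =
      - ((- 1) ^ length vs * ((- 1) ^ i * z))" if "i < length vs" for i and z :: complex
  proof -
    from that obtain m where m: "length vs = Suc m" by (cases "length vs") auto
    moreover from m that have "length (take i vs @ drop (Suc i) vs) = m" by simp
    ultimately show ?thesis by (simp only: power_Suc) simp
  qed
  then show "extd (\<lambda>y. grade_inv (f y)) x vs = (- grade_inv (extd f x)) vs"
    by (simp add: extd_def 1 sum_negf del: length_append)
      (simp add: grade_inv_def sum_distrib_left)
qed

lemma dir_deriv_shuffle_prod:
  assumes "coeffs_diff f x" "coeffs_diff g x"
  shows "dir_deriv v (\<lambda>y. f y \<odot> g y) x vs = (dir_deriv v f x \<odot> g x) vs + (f x \<odot> dir_deriv v g x) vs"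
  using assms
proof (induction vs arbitrary: f g)
  case Nil
  then show ?case
    by (simp add: dir_deriv_def coeffs_diff_def frechet_derivative_mult_complex)
next
  case (Cons u vs)
  have d: "coeffs_diff (\<lambda>y. iprod u (f y) \<odot> g y) x"
    "coeffs_diff (\<lambda>y. grade_inv (f y) \<odot> iprod u (g y)) x"
    using Cons.prems by (intro coeffs_diff_shuffle_prod coeffs_diff_iprod coeffs_diff_grade_inv; simp)+
  have "dir_deriv v (\<lambda>y. f y \<odot> g y) x (u # vs) =
      dir_deriv v (\<lambda>y. iprod u (f y) \<odot> g y) x vs + dir_deriv v (\<lambda>y. grade_inv (f y) \<odot> iprod u (g y)) x vs"
    using d by (simp add: dir_deriv_def shuffle_prod_Cons coeffs_diff_def frechet_derivative_add_at)
  moreover have "dir_deriv v (\<lambda>y. iprod u (f y)) x = iprod u (dir_deriv v f x)" for f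
    by (simp add: dir_deriv_def iprod_def)
  moreover have "dir_deriv v (\<lambda>y. grade_inv (f y)) x = grade_inv (dir_deriv v f x)"
    using Cons.prems unfolding dir_deriv_def grade_inv_def
    by (intro ext frechet_derivative_bounded_linear[OF bounded_linear_mult_right])
      (simp add: coeffs_diff_def)
  ultimately show ?case
    using Cons.prems
    by (simp add: Cons.IH coeffs_diff_iprod coeffs_diff_grade_inv shuffle_prod_Cons)
qed

text \<open>
  The Leibniz rule.  Contract both sides with a constant field \<open>v\<close>: by Cartan's formula and the
  antiderivation property of the contraction, everything reduces to the product rule for directional derivatives
  and to the Leibniz rule for the contracted forms.
\<close>

lemma extd_shuffle_prod:
  assumes "coeffs_diff f x" "coeffs_diff g x"
  shows "extd (\<lambda>y. f y \<odot> g y) x = extd f x \<odot> g x + grade_inv (f x) \<odot> extd g x"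
proof
  show "extd (\<lambda>y. f y \<odot> g y) x vs = (extd f x \<odot> g x + grade_inv (f x) \<odot> extd g x) vs" for vs
    using assms
  proof (induction vs arbitrary: f g)
    case Nil
    then show ?case by simp
  next
    case (Cons v vs)
    note [simp] = Cons.prems coeffs_diff_iprod coeffs_diff_grade_inv coeffs_diff_shuffle_prod
    have "extd (\<lambda>y. iprod v (f y \<odot> g y)) x vs =
        extd (\<lambda>y. iprod v (f y) \<odot> g y) x vs + extd (\<lambda>y. grade_inv (f y) \<odot> iprod v (g y)) x vs"
      by (simp add: iprod_shuffle_prod extd_add)
    then show ?case
      by (simp add: extd_Cons dir_deriv_shuffle_prod Cons.IH shuffle_prod_Cons iprod_extd
          extd_grade_inv shuffle_prod_diff_left shuffle_prod_diff_right
          shuffle_prod_uminus_left[unfolded fun_Compl_def] grade_inv_iprod)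
  qed
qed

section \<open>Products of alternating forms\<close>

definition multilinear_form :: "(('v::real_vector) list \<Rightarrow> complex) \<Rightarrow> bool" where
  "multilinear_form a \<longleftrightarrow> (\<forall>us ws. linear (\<lambda>v. a (us @ v # ws)))"

text \<open>
  Only neighbouring arguments are compared, because this condition is inherited by contractions and
  can therefore be followed through the recursion for the product.
\<close>

definition adjacent_alternating :: "('v list \<Rightarrow> complex) \<Rightarrow> bool" where
  "adjacent_alternating a \<longleftrightarrow>
     (\<forall>us v w ws. a (us @ v # v # ws) = 0 \<and> a (us @ v # w # ws) + a (us @ w # v # ws) = 0)"

lemma alternating_form_iff:
  "alternating_form k a \<longleftrightarrow> homogeneous k a \<and> multilinear_form a \<and> adjacent_alternating a"
proof (intro iffI conjI)
  assume alt: "alternating_form k a"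
  show h: "homogeneous k a" using alt by (simp add: alternating_form_def homogeneous_def)
  show m: "multilinear_form a"
    unfolding multilinear_form_def
  proof (intro allI)
    fix us ws :: "(real^6) list"
    show "linear (\<lambda>v. a (us @ v # ws))"
    proof (cases "length us + length ws + 1 = k")
      case False
      then have "(\<lambda>v. a (us @ v # ws)) = (\<lambda>v. 0)" using alt by (auto simp: alternating_form_def)
      then show ?thesis by (simp add: linear_iff)
    qed (use alt in \<open>simp add: alternating_form_def\<close>)
  qed
  have z: "a (us @ v # v # ws) = 0" for us v ws
    using alt by (simp add: alternating_form_def)
  have "a (us @ v # w # ws) + a (us @ w # v # ws) = 0" for us v w ws
  proof -
    have l1: "a (us @ (p + q) # ws') = a (us @ p # ws') + a (us @ q # ws')" for p q ws'
      using m by (simp add: multilinear_form_def linear_iff)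
    have l2: "a (us @ r # (p + q) # ws) = a (us @ r # p # ws) + a (us @ r # q # ws)" for r p q
      using m[unfolded multilinear_form_def, rule_format, of "us @ [r]" ws] by (simp add: linear_iff)
    have "0 = a (us @ (v + w) # (v + w) # ws)" by (simp add: z)
    also have "\<dots> = a (us @ v # w # ws) + a (us @ w # v # ws)" unfolding l1 l2 by (simp add: z)
    finally show ?thesis by (rule sym)
  qed
  then show "adjacent_alternating a" using z by (simp add: adjacent_alternating_def)
next
  assume a: "homogeneous k a \<and> multilinear_form a \<and> adjacent_alternating a"
  have "a (us @ v # ys @ v # ws) = 0" for us v ys ws
    using a
  proof (induction ys arbitrary: us)
    case (Cons y ys)
    have "a (us @ v # y # ys @ v # ws) + a (us @ y # v # ys @ v # ws) = 0"
      using Cons.prems unfolding adjacent_alternating_def by blast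
    moreover have "a (us @ y # v # ys @ v # ws) = 0" using Cons.IH[of "us @ [y]"] Cons.prems by simp
    ultimately show ?case by simp
  qed (simp add: adjacent_alternating_def)
  then have "a vs = 0" if "\<not> distinct vs" for vs
    using not_distinct_decomp[OF that] by auto
  then show "alternating_form k a"
    using a by (simp add: alternating_form_def homogeneous_def multilinear_form_def)
qed

lemma homogeneous_shuffle_prod:
  assumes "homogeneous k a" "homogeneous l b" shows "homogeneous (k + l) (a \<odot> b)"
  unfolding homogeneous_def
proof (intro allI impI)
  fix vs :: "'a list" assume ne: "length vs \<noteq> k + l"
  show "(a \<odot> b) vs = 0"
    unfolding shuffle_prod_def
  proof (intro sum.neutral ballI)
    fix S assume S: "S \<in> Pow {..<length vs}"
    let ?n = "length vs"
    have "length (nths vs S) = card S"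
      unfolding length_nths by (rule arg_cong[where f=card]) (use S in auto)
    moreover have "length (nths vs ({..<?n} - S)) = card ({..<?n} - S)"
      unfolding length_nths by (rule arg_cong[where f=card]) auto
    moreover have "card ({..<?n} - S) + card S = ?n"
      using S card_Diff_subset[of S "{..<?n}"] finite_subset[of S] card_mono[of "{..<?n}" S] by auto
    ultimately have "length (nths vs S) \<noteq> k \<or> length (nths vs ({..<?n} - S)) \<noteq> l"
      using ne by auto
    then show "(- 1) ^ card {(i, j). i < j \<and> i \<in> {..<?n} - S \<and> j \<in> S} * a (nths vs S) *
        b (nths vs ({..<?n} - S)) = 0"
      using assms by (auto simp: homogeneous_def)
  qed
qed

lemma multilinear_form_shuffle_prod:
  assumes "multilinear_form a" "multilinear_form b" shows "multilinear_form (a \<odot> b)"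
proof -
  have ip: "multilinear_form (iprod v a)" if "multilinear_form a" for v and a :: "'a list \<Rightarrow> complex"
    unfolding multilinear_form_def iprod_def
  proof (intro allI)
    show "linear (\<lambda>w. a (v # us @ w # ws))" for us ws
      using that[unfolded multilinear_form_def, rule_format, of "v # us" ws] by simp
  qed
  have gi: "multilinear_form (grade_inv a)" if "multilinear_form a" for a :: "'a list \<Rightarrow> complex"
    using that unfolding multilinear_form_def grade_inv_def
    by (simp add: linear_iff algebra_simps)
  have ia: "iprod (v + w) a = iprod v a + iprod w a" "iprod (r *\<^sub>R v) a = of_real r \<cdot> iprod v a"
    if "multilinear_form a" for v w r and a :: "'a list \<Rightarrow> complex"
    using that[unfolded multilinear_form_def, rule_format, of "[]"]
    by (simp_all add: linear_iff fun_eq_iff iprod_def scale_form_def scaleR_conv_of_real)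
  have "linear (\<lambda>v. (a \<odot> b) (us @ v # ws))" for us ws
    using assms
  proof (induction us arbitrary: a b)
    case Nil
    then show ?case
      by (intro linearI) (simp_all add: shuffle_prod_Cons ia shuffle_prod_add_left shuffle_prod_add_right
          shuffle_prod_scale_left shuffle_prod_scale_right, simp add: scale_form_def scaleR_conv_of_real algebra_simps)
  next
    case (Cons u us)
    show ?case
      unfolding append_Cons shuffle_prod_Cons
      using Cons.prems by (intro linear_compose_add Cons.IH ip gi) auto
  qed
  then show ?thesis by (simp add: multilinear_form_def)
qed

text \<open>
  Alternation means that contractions anticommute and square to zero, at every depth of the
  argument list.
\<close>

lemma adjacent_alternating_iff_iprod:
  "adjacent_alternating a \<longleftrightarrow>
    (\<forall>v w. iprod v (iprod v a) = 0 \<and> iprod w (iprod v a) + iprod v (iprod w a) = 0) \<and>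
    (\<forall>u. adjacent_alternating (iprod u a))" (is "?l \<longleftrightarrow> ?r")
proof
  assume l: ?l
  have l': "a (us @ v # v # ws) = 0 \<and> a (us @ v # w # ws) + a (us @ w # v # ws) = 0" for us v w ws
    using l unfolding adjacent_alternating_def by blast
  have "a (v # v # ws) = 0 \<and> a (v # w # ws) + a (w # v # ws) = 0" for v w ws
    by (rule l'[of "[]", unfolded append_Nil])
  moreover have "adjacent_alternating (iprod u a)" for u
    unfolding adjacent_alternating_def iprod_def
    by (intro allI l'[of "u # _", unfolded append_Cons])
  ultimately show ?r by (auto simp: fun_eq_iff iprod_def)
next
  assume r: ?r
  show ?l
    unfolding adjacent_alternating_def
  proof (intro allI)
    fix us v w ws
    show "a (us @ v # v # ws) = 0 \<and> a (us @ v # w # ws) + a (us @ w # v # ws) = 0"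
    proof (cases us)
      case Nil
      have "iprod v (iprod v a) ws = 0" "(iprod w (iprod v a) + iprod v (iprod w a)) ws = 0"
        using r by (simp_all only: zero_fun_apply)
      then show ?thesis by (simp add: Nil iprod_def)
    next
      case (Cons u us')
      show ?thesis using r unfolding Cons adjacent_alternating_def iprod_def append_Cons by blast
    qed
  qed
qed

text \<open>
  A double contraction of a product is the sum of the products in which one factor absorbs both
  vectors and of two mixed terms; the mixed terms are skew in the two vectors.
\<close>

lemma adjacent_alternating_shuffle_prod:
  assumes "adjacent_alternating a" "adjacent_alternating b"
  shows "adjacent_alternating (a \<odot> b)"
proof -
  have gi: "adjacent_alternating (grade_inv a)" if "adjacent_alternating a" for a :: "'a list \<Rightarrow> complex"
    using that by (simp add: adjacent_alternating_def grade_inv_def flip: distrib_left)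
  have ip: "adjacent_alternating (iprod u a)" if "adjacent_alternating a" for u and a :: "'a list \<Rightarrow> complex"
    using that adjacent_alternating_iff_iprod by blast
  have z: "iprod v (iprod v a) = 0" "iprod w (iprod v a) + iprod v (iprod w a) = 0"
    if "adjacent_alternating a" for v w and a :: "'a list \<Rightarrow> complex"
    using that[unfolded adjacent_alternating_iff_iprod[of a]] by blast+
  \<comment> \<open>The two middle terms are exchanged, up to sign, when \<open>v\<close> and \<open>w\<close> are.\<close>
  have two: "iprod w (iprod v (a \<odot> b)) = iprod w (iprod v a) \<odot> b
      + grade_inv (iprod v a) \<odot> iprod w b - grade_inv (iprod w a) \<odot> iprod v b + a \<odot> iprod w (iprod v b)"
    for v w and a b :: "'a list \<Rightarrow> complex"
    by (simp add: iprod_shuffle_prod iprod_add iprod_grade_inv shuffle_prod_uminus_left add.assoc)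
  have "(a \<odot> b) (us @ v # v # ws) = 0 \<and> (a \<odot> b) (us @ v # w # ws) + (a \<odot> b) (us @ w # v # ws) = 0"
    for us v w ws
    using assms
  proof (induction us arbitrary: a b)
    case Nil
    have "iprod v (iprod v (a \<odot> b)) = 0"
      unfolding two z(1)[OF Nil(1)] z(1)[OF Nil(2)] by simp
    moreover have "iprod w (iprod v (a \<odot> b)) + iprod v (iprod w (a \<odot> b)) =
        (iprod w (iprod v a) + iprod v (iprod w a)) \<odot> b + a \<odot> (iprod w (iprod v b) + iprod v (iprod w b))"
      unfolding two shuffle_prod_add_left shuffle_prod_add_right by simp
    then have "iprod w (iprod v (a \<odot> b)) + iprod v (iprod w (a \<odot> b)) = 0"
      unfolding z(2)[OF Nil(1)] z(2)[OF Nil(2)] by simp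
    ultimately show ?case by (simp add: iprod_def fun_eq_iff)
  next
    case (Cons u us)
    show ?case
      using Cons.IH[OF ip[OF Cons.prems(1), of u] Cons.prems(2)]
        Cons.IH[OF gi[OF Cons.prems(1)] ip[OF Cons.prems(2), of u]]
      by (simp add: shuffle_prod_Cons algebra_simps)
  qed
  then show ?thesis by (simp add: adjacent_alternating_def)
qed

lemma alternating_form_shuffle_prod:
  "alternating_form k a \<Longrightarrow> alternating_form l b \<Longrightarrow> alternating_form (k + l) (a \<odot> b)"
  by (simp add: alternating_form_iff homogeneous_shuffle_prod multilinear_form_shuffle_prod
      adjacent_alternating_shuffle_prod)

section \<open>Smooth functions\<close>

text \<open>
  The recursive definition of \<open>C\<^sup>k\<close> speaks of the derivative as a function on the whole space, so each
  differentiation rule has to be transported along an equality that holds on the open set only.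
\<close>

lemma Ck_on_cong:
  assumes S: "open S"
  shows "(\<And>x. x \<in> S \<Longrightarrow> f x = g x) \<Longrightarrow> Ck_on k f S \<Longrightarrow> Ck_on k g S"
proof (induction k arbitrary: f g)
  case 0
  have "continuous_on S f \<longleftrightarrow> continuous_on S g" by (rule continuous_on_cong) (simp_all add: 0)
  then show ?case using 0 by simp
next
  case (Suc k)
  have D: "frechet_derivative f (at x) = frechet_derivative g (at x)" if "x \<in> S" for x
    using frechet_derivative_cong_open[OF S that Suc.prems(1)] .
  have "g differentiable (at x)" if x: "x \<in> S" for x
  proof -
    have "(f has_derivative frechet_derivative f (at x)) (at x)"
      using Suc.prems(2) x by (simp add: frechet_derivative_works[symmetric])
    from has_derivative_transform_within_open[OF this S x Suc.prems(1)]
    show ?thesis unfolding differentiable_def by blast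
  qed
  moreover have "Ck_on k (\<lambda>x. frechet_derivative g (at x) v) S" for v
    using Suc.IH[of "\<lambda>x. frechet_derivative f (at x) v" "\<lambda>x. frechet_derivative g (at x) v"]
      D Suc.prems(2) by simp
  ultimately show ?case by simp
qed

lemma Ck_on_Suc_imp: "Ck_on (Suc k) f S \<Longrightarrow> Ck_on k f S"
proof (induction k arbitrary: f)
  case 0
  then have "\<forall>x\<in>S. f differentiable (at x)" by simp
  then show ?case
    by (simp add: continuous_at_imp_continuous_on differentiable_imp_continuous_within)
next
  case (Suc k)
  have "Ck_on k (\<lambda>x. frechet_derivative f (at x) v) S" for v
    using Suc.prems by (intro Suc.IH) simp
  then show ?case using Suc.prems by simp
qed

lemma Ck_on_const: "Ck_on k (\<lambda>x. c) S"
  by (induction k arbitrary: c) simp_all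

lemma Ck_on_bounded_linear:
  assumes S: "open S" and h: "bounded_linear h"
  shows "Ck_on k f S \<Longrightarrow> Ck_on k (\<lambda>x. h (f x)) S"
proof (induction k arbitrary: f)
  case 0
  then show ?case using h by (simp add: bounded_linear.continuous_on)
next
  case (Suc k)
  have diff: "f differentiable (at x)" if "x \<in> S" for x using Suc.prems that by simp
  have "Ck_on k (\<lambda>x. h (frechet_derivative f (at x) v)) S" for v
    using Suc by simp
  then have "Ck_on k (\<lambda>x. frechet_derivative (\<lambda>x. h (f x)) (at x) v) S" for v
    by (rule Ck_on_cong[OF S, rotated]) (simp add: frechet_derivative_bounded_linear[OF h diff])
  moreover have "(\<lambda>x. h (f x)) differentiable (at x)" if "x \<in> S" for x
    using diff[OF that] bounded_linear.has_derivative[OF h] unfolding differentiable_def by blast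
  ultimately show ?case by simp
qed

lemma Ck_on_add:
  assumes S: "open S"
  shows "Ck_on k f S \<Longrightarrow> Ck_on k g S \<Longrightarrow> Ck_on k (\<lambda>x. f x + g x) S"
proof (induction k arbitrary: f g)
  case 0
  then show ?case by (simp add: continuous_on_add)
next
  case (Suc k)
  have diff: "f differentiable (at x)" "g differentiable (at x)" if "x \<in> S" for x
    using Suc.prems that by simp_all
  have "Ck_on k (\<lambda>x. frechet_derivative f (at x) v + frechet_derivative g (at x) v) S" for v
    using Suc by simp
  then have "Ck_on k (\<lambda>x. frechet_derivative (\<lambda>x. f x + g x) (at x) v) S" for v
    by (rule Ck_on_cong[OF S, rotated]) (simp add: frechet_derivative_add_at diff)
  then show ?case using diff by simp
qed

lemma Ck_on_bilinear:
  assumes S: "open S" and b: "bounded_bilinear h"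
  shows "Ck_on k f S \<Longrightarrow> Ck_on k g S \<Longrightarrow> Ck_on k (\<lambda>x. h (f x) (g x)) S"
proof (induction k arbitrary: f g)
  case 0
  then show ?case using b by (simp add: bounded_bilinear.continuous_on)
next
  case (Suc k)
  have D: "((\<lambda>x. h (f x) (g x)) has_derivative
      (\<lambda>v. h (f x) (frechet_derivative g (at x) v) + h (frechet_derivative f (at x) v) (g x))) (at x)"
    if "x \<in> S" for x
    using Suc.prems that by (intro bounded_bilinear.FDERIV[OF b]) (simp_all flip: frechet_derivative_works)
  have "Ck_on k (\<lambda>x. h (f x) (frechet_derivative g (at x) v) + h (frechet_derivative f (at x) v) (g x)) S"
    for v
    using Suc.prems by (intro Ck_on_add S Suc.IH Ck_on_Suc_imp[of k f] Ck_on_Suc_imp[of k g]) simp_all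
  then have "Ck_on k (\<lambda>x. frechet_derivative (\<lambda>x. h (f x) (g x)) (at x) v) S" for v
    by (rule Ck_on_cong[OF S, rotated]) (simp add: frechet_derivative_at[OF D, symmetric])
  then show ?case using D by (auto simp: differentiable_def)
qed

lemma Ck_on_inverse:
  fixes f :: "'a::real_normed_vector \<Rightarrow> real"
  assumes S: "open S" and nz: "\<And>x. x \<in> S \<Longrightarrow> f x \<noteq> 0"
  shows "Ck_on k f S \<Longrightarrow> Ck_on k (\<lambda>x. inverse (f x)) S"
proof (induction k)
  case 0
  then show ?case using nz by (simp add: continuous_on_inverse)
next
  case (Suc k)
  have D: "((\<lambda>x. inverse (f x)) has_derivative
      (\<lambda>v. - (inverse (f x) * frechet_derivative f (at x) v * inverse (f x)))) (at x)"
    if "x \<in> S" for x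
    using Suc.prems that nz by (intro Deriv.has_derivative_inverse) (simp_all flip: frechet_derivative_works)
  have inv: "Ck_on k (\<lambda>x. inverse (f x)) S"
    using Suc.IH Ck_on_Suc_imp[OF Suc.prems] .
  have *: "Ck_on k (\<lambda>x. - (inverse (f x) * frechet_derivative f (at x) v * inverse (f x))) S" for v
    using Suc.prems
    by (intro Ck_on_bounded_linear[OF S bounded_linear_minus[OF bounded_linear_ident]]
        Ck_on_bilinear[OF S bounded_bilinear_mult] inv) simp
  have "Ck_on k (\<lambda>x. frechet_derivative (\<lambda>x. inverse (f x)) (at x) v) S" for v
    by (rule Ck_on_cong[OF S _ *[of v]]) (simp add: frechet_derivative_at[OF D, symmetric])
  then show ?case using D by (auto simp: differentiable_def)
qed

lemma smooth_on_cong: "open S \<Longrightarrow> (\<And>x. x \<in> S \<Longrightarrow> f x = g x) \<Longrightarrow> smooth_on f S \<Longrightarrow> smooth_on g S"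
  unfolding smooth_on_def using Ck_on_cong by blast

lemma smooth_on_const: "smooth_on (\<lambda>x. c) S"
  by (simp add: smooth_on_def Ck_on_const)

lemma smooth_on_bounded_linear:
  "open S \<Longrightarrow> bounded_linear h \<Longrightarrow> smooth_on f S \<Longrightarrow> smooth_on (\<lambda>x. h (f x)) S"
  by (simp add: smooth_on_def Ck_on_bounded_linear)

lemma smooth_on_add:
  "open S \<Longrightarrow> smooth_on f S \<Longrightarrow> smooth_on g S \<Longrightarrow> smooth_on (\<lambda>x. f x + g x) S"
  by (simp add: smooth_on_def Ck_on_add)

lemma smooth_on_bilinear:
  "open S \<Longrightarrow> bounded_bilinear h \<Longrightarrow> smooth_on f S \<Longrightarrow> smooth_on g S \<Longrightarrow> smooth_on (\<lambda>x. h (f x) (g x)) S"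
  by (simp add: smooth_on_def Ck_on_bilinear)

lemmas smooth_on_mult = smooth_on_bilinear[OF _ bounded_bilinear_mult]
lemmas smooth_on_scaleR = smooth_on_bilinear[OF _ bounded_bilinear_scaleR]

lemma smooth_on_sum:
  "open S \<Longrightarrow> (\<And>i. i \<in> I \<Longrightarrow> smooth_on (f i) S) \<Longrightarrow> smooth_on (\<lambda>x. \<Sum>i\<in>I. f i x) S"
  by (induction I rule: infinite_finite_induct) (simp_all add: smooth_on_const smooth_on_add)

lemma smooth_on_prod:
  fixes f :: "'i \<Rightarrow> 'a::real_normed_vector \<Rightarrow> real"
  shows "open S \<Longrightarrow> (\<And>i. i \<in> I \<Longrightarrow> smooth_on (f i) S) \<Longrightarrow> smooth_on (\<lambda>x. \<Prod>i\<in>I. f i x) S"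
  by (induction I rule: infinite_finite_induct) (simp_all add: smooth_on_const smooth_on_mult)

text \<open>
  A determinant is a polynomial in the entries; this gives smoothness of the solutions of linear
  systems through Cramer's rule.
\<close>

lemma smooth_on_det:
  fixes M :: "'a::real_normed_vector \<Rightarrow> real^'n^'n"
  assumes "open S" "\<And>i j. smooth_on (\<lambda>x. M x $ i $ j) S"
  shows "smooth_on (\<lambda>x. det (M x)) S"
  unfolding det_def
  using assms by (intro smooth_on_sum smooth_on_mult smooth_on_const smooth_on_prod) auto

lemma smooth_on_vec:
  fixes f :: "'a::real_normed_vector \<Rightarrow> real^'n"
  assumes "open S" "\<And>i. smooth_on (\<lambda>x. f x $ i) S"
  shows "smooth_on f S"
proof (rule smooth_on_cong[OF assms(1)])
  show "smooth_on (\<lambda>x. \<Sum>i\<in>UNIV. (f x $ i) *\<^sub>R axis i 1) S"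
    using assms by (intro smooth_on_sum smooth_on_scaleR smooth_on_const)
  show "(\<Sum>i\<in>UNIV. (f x $ i) *\<^sub>R axis i 1) = f x" for x
    using basis_expansion[of "f x"] by (simp add: scalar_mult_eq_scaleR)
qed

lemma differentiable_smooth_on: "smooth_on f S \<Longrightarrow> x \<in> S \<Longrightarrow> f differentiable (at x)"
  unfolding smooth_on_def by (metis Ck_on.simps(2))


section \<open>Raising indices\<close>

definition inner_form :: "(('v::real_vector) \<Rightarrow> 'v \<Rightarrow> real) \<Rightarrow> bool" where
  "inner_form G \<longleftrightarrow> (\<forall>w. linear (\<lambda>v. G v w)) \<and> (\<forall>v w. G v w = G w v) \<and> (\<forall>v. v \<noteq> 0 \<longrightarrow> G v v > 0)"

lemma inner_form_linear:
  assumes "inner_form G"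
  shows "linear (\<lambda>v. G v w)" "linear (\<lambda>w. G v w)"
proof -
  show 1: "linear (\<lambda>v. G v w)" for w using assms by (simp add: inner_form_def)
  have "(\<lambda>w. G w v) = (\<lambda>w. G v w)" using assms unfolding inner_form_def by blast
  then show "linear (\<lambda>w. G v w)" using 1[of v] by (simp only:)
qed

lemma inner_form_eqI:
  assumes G: "inner_form G" and eq: "\<And>w. G v w = G u w"
  shows "v = u"
proof (rule ccontr)
  assume "v \<noteq> u"
  then have "G (v - u) (v - u) > 0" using G by (simp add: inner_form_def)
  moreover have "G (v - u) w = 0" for w
    using linear_diff[OF inner_form_linear(1)[OF G]] eq by simp
  ultimately show False by simp
qed

lemma sharp_eqI: "inner_form G \<Longrightarrow> (\<And>v. G X v = l v) \<Longrightarrow> sharp G l = X"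
  unfolding sharp_def by (intro the_equality) (auto intro: inner_form_eqI)

text \<open>
  Solving \<open>G X = l\<close> in the standard basis is a linear system with this matrix.
\<close>

definition gram :: "(real^6 \<Rightarrow> real^6 \<Rightarrow> real) \<Rightarrow> real^6^6" where
  "gram G = (\<chi> i j. G (axis j 1) (axis i 1))"

lemma linear_eq_sum_axis:
  fixes l :: "real^6 \<Rightarrow> real"
  assumes "linear l"
  shows "l v = (\<Sum>j\<in>UNIV. v $ j * l (axis j 1))"
proof -
  have "l v = l (\<Sum>j\<in>UNIV. (v $ j) *\<^sub>R axis j 1)"
    using basis_expansion[of v] by (simp add: scalar_mult_eq_scaleR)
  then show ?thesis using assms by (simp add: linear_sum linear_scale)
qed

lemma gram_mult:
  assumes "inner_form G" shows "gram G *v X = (\<chi> i. G X (axis i 1))"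
proof -
  have "G X (axis i 1) = (\<Sum>j\<in>UNIV. X $ j * G (axis j 1) (axis i 1))" for i
    by (rule linear_eq_sum_axis[OF inner_form_linear(1)[OF assms]])
  then show ?thesis
    by (simp add: gram_def matrix_vector_mult_def vec_eq_iff mult.commute)
qed

lemma det_gram:
  assumes G: "inner_form G" shows "det (gram G) \<noteq> 0"
proof -
  have "inj ((*v) (gram G))"
  proof (rule injI)
    fix v u assume "gram G *v v = gram G *v u"
    then have ax: "G v (axis i 1) = G u (axis i 1)" for i
      by (simp add: gram_mult[OF G] vec_eq_iff)
    show "v = u"
    proof (rule inner_form_eqI[OF G])
      fix w
      have "G v w = (\<Sum>j\<in>UNIV. w $ j * G v (axis j 1))"
        by (rule linear_eq_sum_axis[OF inner_form_linear(2)[OF G]])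
      also have "\<dots> = G u w"
        unfolding ax by (rule linear_eq_sum_axis[OF inner_form_linear(2)[OF G], symmetric])
      finally show "G v w = G u w" .
    qed
  qed
  then show ?thesis
    using matrix_left_invertible_injective invertible_left_inverse invertible_det_nz by blast
qed

lemma sharp_cramer:
  assumes G: "inner_form G" and l: "linear l"
  shows "sharp G l = (\<chi> k. det (\<chi> i j. if j = k then l (axis i 1) else gram G $ i $ j) / det (gram G))"
    (is "_ = ?X")
    and "G (sharp G l) v = l v"
proof -
  have "gram G *v ?X = (\<chi> i. l (axis i 1))"
    unfolding cramer[OF det_gram[OF G]] by (simp cong: if_cong)
  then have ax: "G ?X (axis i 1) = l (axis i 1)" for i
    by (simp add: gram_mult[OF G] vec_eq_iff)
  have X: "G ?X v = l v" for v
    using linear_eq_sum_axis[OF inner_form_linear(2)[OF G], of ?X v] linear_eq_sum_axis[OF l, of v] ax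
    by simp
  show "sharp G l = ?X" using X by (intro sharp_eqI[OF G])
  then show "G (sharp G l) v = l v" using X by simp
qed

text \<open>
  Raising an index is smooth, because Cramer's rule expresses the dual vector rationally in the entries
  of the Gram matrix, with nowhere vanishing denominator.
\<close>

lemma smooth_on_sharp:
  assumes S: "open S" and G: "\<And>x. x \<in> S \<Longrightarrow> inner_form (G x)"
    and l: "\<And>x. x \<in> S \<Longrightarrow> linear (l x)"
    and smG: "\<And>v w. smooth_on (\<lambda>x. G x v w) S" and sml: "\<And>v. smooth_on (\<lambda>x. l x v) S"
  shows "smooth_on (\<lambda>x. sharp (G x) (l x)) S"
proof (rule smooth_on_cong[OF S])
  let ?X = "\<lambda>x. \<chi> k. det (\<chi> i j. if j = k then l x (axis i 1) else gram (G x) $ i $ j) *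
    inverse (det (gram (G x)))"
  show "?X x = sharp (G x) (l x)" if "x \<in> S" for x
    by (simp add: sharp_cramer(1)[OF G[OF that] l[OF that]] divide_inverse)
  have g: "smooth_on (\<lambda>x. gram (G x) $ i $ j) S" for i j
    by (simp add: gram_def smG)
  have inv: "smooth_on (\<lambda>x. inverse (det (gram (G x)))) S"
    unfolding smooth_on_def
  proof
    show "Ck_on k (\<lambda>x. inverse (det (gram (G x)))) S" for k
      using det_gram[OF G] smooth_on_det[OF S g] by (intro Ck_on_inverse[OF S]) (auto simp: smooth_on_def)
  qed
  have "smooth_on (\<lambda>x. det (\<chi> i j. if j = k then l x (axis i 1) else gram (G x) $ i $ j)) S" for k :: 6
  proof (rule smooth_on_det[OF S])
    show "smooth_on (\<lambda>x. (\<chi> i j. if j = k then l x (axis i 1) else gram (G x) $ i $ j) $ i $ j) S" for i j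
      using g sml by (cases "j = k") simp_all
  qed
  then show "smooth_on ?X S"
    by (intro smooth_on_vec[OF S]) (simp add: smooth_on_mult[OF S] inv)
qed

section \<open>Differential forms on a manifold\<close>

lemma open_cimage: "smooth_manifold6 X A \<Longrightarrow> c \<in> A \<Longrightarrow> open (cimage c)"
  by (simp add: smooth_manifold6_def)

text \<open>
  The chart maps are injective, so a transition map really carries the overlap into the other chart image.
\<close>

lemma overlap_transition:
  assumes M: "smooth_manifold6 X A" and c: "c \<in> A" "c' \<in> A" and x: "x \<in> overlap c c'"
  shows "x \<in> cimage c" "transition c c' x \<in> cimage c'"
    "linear (frechet_derivative (transition c c') (at x))"
proof -
  obtain p where p: "p \<in> fst c" "p \<in> fst c'" "x = snd c p" using x by (auto simp: overlap_def)
  then show "x \<in> cimage c" by (simp add: cimage_def)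
  have "inj_on (snd c) (fst c)"
    using M c(1) unfolding smooth_manifold6_def
    by (metis (no_types, lifting) homeomorphic_imp_injective_map openin_subset topspace_subtopology_subset)
  then have "inv_into (fst c) (snd c) x = p" using p by simp
  then show "transition c c' x \<in> cimage c'" using p by (simp add: transition_def cimage_def)
  have "smooth_on (transition c c') (overlap c c')" using M c by (simp add: smooth_manifold6_def)
  then have "transition c c' differentiable (at x)" using x by (rule differentiable_smooth_on)
  then show "linear (frechet_derivative (transition c c') (at x))"
    by (rule linear_frechet_derivative)
qed


lemma diff_formD:
  assumes "diff_form A k a" "c \<in> A"
  shows "x \<in> cimage c \<Longrightarrow> alternating_form k (a c x)"
    and "smooth_on (\<lambda>x. a c x vs) (cimage c)"
    and "c' \<in> A \<Longrightarrow> x \<in> overlap c c' \<Longrightarrow>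
      a c x vs = a c' (transition c c' x) (map (frechet_derivative (transition c c') (at x)) vs)"
  using assms unfolding diff_form_def by blast+

lemma diff_form_coeffs_diff: "diff_form A k a \<Longrightarrow> c \<in> A \<Longrightarrow> x \<in> cimage c \<Longrightarrow> coeffs_diff (a c) x"
  unfolding diff_form_def coeffs_diff_def using differentiable_smooth_on by blast

lemma diff_form_bounded_linear:
  assumes M: "smooth_manifold6 X A" and h: "bounded_linear h" and a: "diff_form A k a"
  shows "diff_form A k (\<lambda>c x vs. h (a c x vs))"
proof -
  have h0: "h 0 = 0" using h by (simp add: linear_0 bounded_linear.linear)
  have "linear (\<lambda>v. h (f v))" if "linear f" for f :: "real^6 \<Rightarrow> complex"
    using linear_compose[OF that bounded_linear.linear[OF h]] by (simp add: o_def)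
  then have "alternating_form k (\<lambda>vs. h (b vs))" if "alternating_form k b" for b
    using that by (auto simp: alternating_form_def h0)
  then show ?thesis
    using a smooth_on_bounded_linear[OF open_cimage[OF M] h] unfolding diff_form_def by auto
qed

lemma diff_form_add:
  assumes M: "smooth_manifold6 X A" and a: "diff_form A k a" and b: "diff_form A k b"
  shows "diff_form A k (a + b)"
proof -
  have "alternating_form k (a + b)" if "alternating_form k a" "alternating_form k b" for a b
    using that by (auto simp: alternating_form_def intro!: linear_compose_add)
  moreover have "smooth_on (\<lambda>x. (a + b) c x vs) (cimage c)" if "c \<in> A" for c vs
    using smooth_on_add[OF open_cimage[OF M that] diff_formD(2)[OF a that] diff_formD(2)[OF b that]]
    by (simp add: plus_fun_def)
  moreover have "(a + b) c x vs =
      (a + b) c' (transition c c' x) (map (frechet_derivative (transition c c') (at x)) vs)"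
    if "c \<in> A" "c' \<in> A" "x \<in> overlap c c'" for c c' x vs
    using diff_formD(3)[OF a that, of vs] diff_formD(3)[OF b that, of vs] by simp
  ultimately show ?thesis using a b unfolding diff_form_def by simp
qed

lemma diff_form_scale: "smooth_manifold6 X A \<Longrightarrow> diff_form A k a \<Longrightarrow> diff_form A k (z *\<^sub>F a)"
  unfolding fscale_def by (rule diff_form_bounded_linear[OF _ bounded_linear_mult_right])

lemma diff_form_Re: "smooth_manifold6 X A \<Longrightarrow> diff_form A k a \<Longrightarrow> diff_form A k (fRe a)"
  unfolding fRe_def
  by (rule diff_form_bounded_linear[OF _ bounded_linear_compose[OF bounded_linear_of_real bounded_linear_Re]])

lemma diff_form_Im: "smooth_manifold6 X A \<Longrightarrow> diff_form A k a \<Longrightarrow> diff_form A k (fIm a)"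
  unfolding fIm_def
  by (rule diff_form_bounded_linear[OF _ bounded_linear_compose[OF bounded_linear_of_real bounded_linear_Im]])

lemma diff_form_wedge:
  assumes M: "smooth_manifold6 X A" and a: "diff_form A k a" and b: "diff_form A l b"
  shows "diff_form A (k + l) (a \<and>\<^sub>F b)"
  unfolding diff_form_def
proof (intro conjI ballI allI)
  fix c assume c: "c \<in> A"
  show "alternating_form (k + l) ((a \<and>\<^sub>F b) c x)" if "x \<in> cimage c" for x
    unfolding fwedge_at by (intro alternating_form_shuffle_prod diff_formD(1)[OF a c that] diff_formD(1)[OF b c that])
  show "smooth_on (\<lambda>x. (a \<and>\<^sub>F b) c x vs) (cimage c)" for vs
    unfolding fwedge_def
    by (intro smooth_on_sum smooth_on_mult smooth_on_const open_cimage[OF M] c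
        diff_formD(2)[OF a c] diff_formD(2)[OF b c])
  fix c' x vs assume c': "c' \<in> A" and x: "x \<in> overlap c c'"
  have *: "f c x = (\<lambda>us. f c' (transition c c' x) (map (frechet_derivative (transition c c') (at x)) us))"
    if "diff_form A m f" for f m
    using diff_formD(3)[OF that c c' x] by (intro ext)
  show "(a \<and>\<^sub>F b) c x vs = (a \<and>\<^sub>F b) c' (transition c c' x)
      (map (frechet_derivative (transition c c') (at x)) vs)"
    unfolding fwedge_at shuffle_prod_map by (simp only: *[OF a, symmetric] *[OF b, symmetric])
qed

text \<open>
  Being of type \<open>(p,0)\<close> says that contraction with \<open>v + i J v\<close> gives zero, and contraction is an antiderivation.
\<close>

lemma form_type_wedge:
  assumes M: "smooth_manifold6 X A" and a: "form_type A J k a" and b: "form_type A J l b"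
  shows "form_type A J (k + l) (a \<and>\<^sub>F b)"
  unfolding form_type_def
proof (intro conjI ballI allI)
  show "diff_form A (k + l) (a \<and>\<^sub>F b)"
    using a b by (simp add: form_type_def diff_form_wedge[OF M])
  fix c x v vs assume c: "c \<in> A" "x \<in> cimage c"
  have z: "iprod v (f c x) + \<i> \<cdot> iprod (J c x v) (f c x) = 0" if "form_type A J m f" for f m
    using that c by (simp add: form_type_def fun_eq_iff iprod_def scale_form_def)
  have "iprod v (a c x \<odot> b c x) + \<i> \<cdot> iprod (J c x v) (a c x \<odot> b c x) =
      (iprod v (a c x) + \<i> \<cdot> iprod (J c x v) (a c x)) \<odot> b c x +
      grade_inv (a c x) \<odot> (iprod v (b c x) + \<i> \<cdot> iprod (J c x v) (b c x))"
    unfolding iprod_shuffle_prod shuffle_prod_add_left shuffle_prod_add_right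
      shuffle_prod_scale_left shuffle_prod_scale_right
    by (simp add: scale_form_def fun_eq_iff algebra_simps)
  also have "\<dots> = 0" by (simp only: z[OF a] z[OF b] shuffle_prod_zero_left shuffle_prod_zero_right add_0)
  finally show "(a \<and>\<^sub>F b) c x (v # vs) + \<i> * (a \<and>\<^sub>F b) c x (J c x v # vs) = 0"
    by (simp add: fwedge_at fun_eq_iff iprod_def scale_form_def)
qed

section \<open>SU(2) structures on a vector space\<close>

definition alt_bilinear :: "(('v::real_vector) \<Rightarrow> 'v \<Rightarrow> real) \<Rightarrow> bool" where
  "alt_bilinear B \<longleftrightarrow> (\<forall>u. linear (\<lambda>v. B v u)) \<and> (\<forall>v u. B v u = - B u v)"

lemma alt_bilinearD:
  assumes "alt_bilinear B"
  shows "B v u = - B u v" "B v v = 0" "linear (\<lambda>v. B v u)" "linear (B v)"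
proof -
  show 1: "B v u = - B u v" for v u using assms unfolding alt_bilinear_def by blast
  show "B v v = 0" using 1[of v v] by linarith
  show 2: "linear (\<lambda>v. B v u)" for u using assms unfolding alt_bilinear_def by blast
  have "B v = (\<lambda>u. - B u v)" by (rule ext) (rule 1)
  then show "linear (B v)" using linear_compose_neg[OF 2[of v]] by (simp only:)
qed

text \<open>
  The wedge product of two real 2-forms, evaluated on four vectors.
\<close>

definition wedge4 :: "('v \<Rightarrow> 'v \<Rightarrow> real) \<Rightarrow> ('v \<Rightarrow> 'v \<Rightarrow> real) \<Rightarrow> 'v \<Rightarrow> 'v \<Rightarrow> 'v \<Rightarrow> 'v \<Rightarrow> real" where
  "wedge4 B C v u p q = B v u * C p q - B v p * C u q + B v q * C u p
     + C v u * B p q - C v p * B u q + C v q * B u p"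

text \<open>
  The Pluecker relation: a decomposable 2-form squares to zero.  Together with \<open>\<omega>\<^sup>2 \<noteq> 0\<close> this is how
  nondegeneracy on the 4-plane is used below, without a choice of basis.
\<close>

lemma wedge4_decomposable:
  fixes B :: "'v \<Rightarrow> 'v \<Rightarrow> real"
  assumes m: "m \<noteq> 0" and dec: "\<And>p q. m * B p q = f p * h q - f q * h p"
  shows "wedge4 B B v u p q = 0"
proof -
  have "m * m * wedge4 B B v u p q = 2 * ((m * B v u) * (m * B p q) - (m * B v p) * (m * B u q)
      + (m * B v q) * (m * B u p))"
    by (simp add: wedge4_def algebra_simps)
  also have "\<dots> = 0"
    unfolding dec by (simp add: algebra_simps)
  finally show ?thesis using m by simp
qed

text \<open>
  An SU(2) structure on one tangent space in real terms: \<open>\<alpha> = a + i b\<close>, \<open>\<Omega> = R + i I\<close>, with \<open>w\<close> for \<open>\<omega>\<close>.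
  The vectors \<open>X\<close>, \<open>Y\<close> are dual to \<open>a\<close>, \<open>b\<close>, and \<open>K\<close> is the skew endomorphism that corresponds
  to \<open>R\<close>.  They are parameters rather than definitions so that the locale makes sense over any vector space.
\<close>

locale su2_linear =
  fixes G :: "('v::real_vector) \<Rightarrow> 'v \<Rightarrow> real" and J :: "'v \<Rightarrow> 'v"
    and a b :: "'v \<Rightarrow> real" and w R I :: "'v \<Rightarrow> 'v \<Rightarrow> real" and X Y :: 'v and K :: "'v \<Rightarrow> 'v"
  assumes G: "inner_form G"
    and J_lin: "linear J" and JJ: "\<And>v. J (J v) = - v" and GJJ: "\<And>v u. G (J v) (J u) = G v u"
    and a_lin: "linear a" and b_lin: "linear b"
    and aJ: "\<And>v. a (J v) = - b v" and bJ: "\<And>v. b (J v) = a v"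
    and GX: "\<And>v. G X v = a v" and GY: "\<And>v. G Y v = b v" and aX_bY: "a X + b Y = 2"
    and w: "alt_bilinear w" and R: "alt_bilinear R" and I: "alt_bilinear I"
    and RJ: "\<And>v u. R (J v) u = - I v u" and IJ: "\<And>v u. I (J v) u = R v u"
    and GJ: "\<And>v u. G (J v) u = w v u + a v * b u - b v * a u"
    and wX: "\<And>u. w X u = 0" and wY: "\<And>u. w Y u = 0"
    and ww_RR: "\<And>v u p q. wedge4 w w v u p q = wedge4 R R v u p q"
    and wR: "\<And>v u p q. wedge4 w R v u p q = 0"
    and wI: "\<And>v u p q. wedge4 w I v u p q = 0"
    and ww_nz: "\<exists>v u p q. wedge4 w w v u p q \<noteq> 0"
    and GK: "\<And>v u. G (K v) u = R v u"
begin

lemma G_sym: "G v u = G u v"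
  using G unfolding inner_form_def by blast

lemma G_X: "G v X = a v" and G_Y: "G v Y = b v"
  using G_sym GX GY by metis+

lemma GJ_right: "G v (J u) = - G (J v) u"
  using GJJ[of v "J u"] inner_form_linear(2)[OF G, of "J v"] by (simp add: JJ linear_neg)

lemma Y_eq: "Y = J X"
proof (rule inner_form_eqI[OF G])
  show "G Y v = G (J X) v" for v
    using GJ_right[of X v] by (simp add: GX GY aJ)
qed

lemma aX: "a X = 1" and bX: "b X = 0" and aY: "a Y = 0" and bY: "b Y = 1"
proof -
  have "a (J X) = G (J X) X" by (simp only: GX G_sym[of "J X"])
  then have "a (J X) = 0" by (simp add: GJ wX)
  then show "b X = 0" "a Y = 0" by (simp_all add: aJ Y_eq)
  have "b Y = a X" by (simp add: bJ Y_eq)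
  then show "a X = 1" "b Y = 1" using aX_bY by simp_all
qed

text \<open>
  Contracting \<open>w \<and> B = 0\<close> with \<open>X\<close>, which annihilates \<open>w\<close>, gives \<open>w \<and> \<mu> = 0\<close> for the 1-form \<open>\<mu> = i\<^sub>X B\<close>.
  If \<open>\<mu>\<close> were nonzero at some \<open>z\<close>, a further contraction with \<open>z\<close> would make \<open>w\<close> decomposable.  Applied to \<open>R\<close>
  and \<open>I\<close> this shows that \<open>\<Omega>\<close> is horizontal.
\<close>

lemma kernel_of_wedge_zero:
  assumes B: "\<And>v u p q. wedge4 w B v u p q = 0" shows "B X z = 0"
proof (rule ccontr)
  assume m: "B X z \<noteq> 0"
  have "B X z * w p q = B X p * w z q - B X q * w z p" for p q
    using B[of X z p q] by (simp add: wedge4_def wX)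
  then have "wedge4 w w v u p q = 0" for v u p q by (rule wedge4_decomposable[OF m])
  then show False using ww_nz by blast
qed

lemma RX: "R X u = 0" and IX: "I X u = 0" and RY: "R Y u = 0" and IY: "I Y u = 0"
proof -
  show 1: "R X u = 0" "I X u = 0" using wR wI by (blast intro: kernel_of_wedge_zero)+
  show "R Y u = 0" "I Y u = 0" using 1 by (simp_all add: Y_eq RJ IJ)
qed

lemma R_X: "R u X = 0" and R_Y: "R u Y = 0"
  using RX[of u] RY[of u] alt_bilinearD(1)[OF R, of u] by simp_all

lemma aK: "a (K v) = 0" and bK: "b (K v) = 0"
  unfolding GX[symmetric] GY[symmetric] G_sym[of _ "K v"] GK by (rule R_X R_Y)+

lemma KX: "K X = 0" and KY: "K Y = 0"
  using linear_0[OF inner_form_linear(1)[OF G]]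
  by (auto intro!: inner_form_eqI[OF G] simp: GK RX RY)

lemma K_lin: "linear K"
proof (rule linearI)
  note l = inner_form_linear(1)[OF G] alt_bilinearD(3)[OF R]
  show "K (v + u) = K v + K u" for v u
    by (rule inner_form_eqI[OF G]) (simp add: GK linear_add[OF l(1)] linear_add[OF l(2)])
  show "K (r *\<^sub>R v) = r *\<^sub>R K v" for r v
    by (rule inner_form_eqI[OF G]) (simp add: GK linear_scale[OF l(1)] linear_scale[OF l(2)])
qed

lemma GJK: "G (J (K v)) u = I v u"
  using GJ_right[of "K v" u] GK[of v "J u"] alt_bilinearD(1)[OF R, of v "J u"] RJ[of u v]
    alt_bilinearD(1)[OF I, of u v] by simp

lemma KJ: "K (J v) = - J (K v)"
  by (rule inner_form_eqI[OF G])
    (simp add: GK RJ GJK linear_neg[OF inner_form_linear(1)[OF G]])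

text \<open>
  The normalisation of \<open>\<Omega>\<close> makes \<open>K\<close> an isometry of the 4-plane.  On the four vectors
  \<open>v, J v, K v, J (K v)\<close> the equation \<open>\<omega>\<^sup>2 = R\<^sup>2\<close> gives \<open>m n = n\<^sup>2\<close> for the square norms \<open>m\<close>, \<open>n\<close> of \<open>v\<close>
  and \<open>K v\<close>; and \<open>n = 0\<close> would make \<open>\<omega>\<close> decomposable.
\<close>

lemma norm_K_horizontal:
  assumes h: "a v = 0" "b v = 0"
  shows "G (K v) (K v) = G v v"
proof (cases "v = 0")
  case True
  then show ?thesis by (simp add: linear_0[OF K_lin])
next
  case False
  let ?m = "G v v" and ?n = "G (K v) (K v)"
  have m: "?m \<noteq> 0" using False G unfolding inner_form_def by fastforce
  have hJ: "a (J v) = 0" "b (J v) = 0" using h by (simp_all add: aJ bJ)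
  have w1: "w v u = G (J v) u" for u using GJ[of v u] h by simp
  have w2: "w (J v) u = - G v u" for u
    using GJ[of "J v" u] hJ by (simp add: JJ linear_neg[OF inner_form_linear(1)[OF G]])
  have w3: "w (K v) u = G (J (K v)) u" for u using GJ[of "K v" u] by (simp add: aK bK)
  have RvJv: "R v (J v) = 0"
    using alt_bilinearD(1)[OF R, of v "J v"] RJ[of v v] alt_bilinearD(2)[OF I, of v] by simp
  have vKv: "G v (K v) = 0" by (simp add: G_sym[of v] GK alt_bilinearD(2)[OF R])
  have JvKv: "G (J v) (K v) = 0" by (simp add: G_sym[of "J v"] GK RvJv)
  have vJKv: "G v (J (K v)) = 0" using GJ_right[of v "K v"] JvKv by simp
  have KvJKv: "G (K v) (J (K v)) = 0"
    by (simp add: G_sym[of "K v"] GJ aK bK alt_bilinearD(2)[OF w])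
  have R1: "R v u = G (K v) u" for u by (simp add: GK)
  have R2: "R (J v) u = - G (J (K v)) u" for u by (simp add: RJ GJK)
  have "wedge4 w w v (J v) (K v) (J (K v)) = 2 * ?m * ?n"
    by (simp add: wedge4_def w1 w2 w3 GJJ vKv JvKv vJKv KvJKv)
  moreover note ww_RR[of v "J v" "K v" "J (K v)"]
  moreover have "wedge4 R R v (J v) (K v) (J (K v)) = 2 * ?n * ?n"
    by (simp add: wedge4_def RvJv R2 GJJ) (simp add: R1 KvJKv)
  ultimately have "2 * ?m * ?n = 2 * ?n * ?n" by (simp only:)
  then have "?m = ?n \<or> ?n = 0" by auto
  moreover have "?n \<noteq> 0"
  proof
    assume "?n = 0"
    then have "K v = 0" using G unfolding inner_form_def by force
    then have "R v u = 0" "R (J v) u = 0" for u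
      by (simp_all add: R1 R2 linear_0[OF J_lin] linear_0[OF inner_form_linear(1)[OF G]])
    then have "wedge4 w w v (J v) p q = 0" for p q by (simp add: ww_RR) (simp add: wedge4_def)
    then have "?m * w p q = w v p * w (J v) q - w v q * w (J v) p" for p q
      unfolding wedge4_def by (simp add: w1[of "J v"] GJJ) (smt (verit) mult.commute)
    then have "wedge4 w w v u p q = 0" for v u p q by (rule wedge4_decomposable[OF m])
    then show False using ww_nz by blast
  qed
  ultimately show ?thesis by simp
qed

text \<open>
  By polarisation and skewness \<open>K\<^sup>2 = -1\<close> on the 4-plane; so \<open>J\<close>, \<open>K\<close> and \<open>J K\<close> form a quaternionic triple there.
\<close>

lemma KK: "K (K v) = - v + a v *\<^sub>R X + b v *\<^sub>R Y"
proof (rule inner_form_eqI[OF G])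
  fix u
  note Gl = inner_form_linear(1)[OF G] inner_form_linear(2)[OF G]
  note lin = linear_add[OF Gl(1)] linear_add[OF Gl(2)] linear_scale[OF Gl(1)] linear_scale[OF Gl(2)]
    linear_diff[OF Gl(1)] linear_diff[OF Gl(2)] linear_neg[OF Gl(1)]
  let ?P = "\<lambda>v. v - a v *\<^sub>R X - b v *\<^sub>R Y"
  have h: "a (?P v) = 0" "b (?P v) = 0" for v
    by (simp_all add: linear_diff[OF a_lin] linear_diff[OF b_lin] linear_scale[OF a_lin]
        linear_scale[OF b_lin] aX aY bX bY)
  have KP: "K (?P v) = K v" for v
    by (simp add: linear_diff[OF K_lin] linear_scale[OF K_lin] KX KY)
  have PP: "?P v + ?P u = ?P (v + u)"
    by (simp add: linear_add[OF a_lin] linear_add[OF b_lin] algebra_simps)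
  have sq: "G (K v) (K v) = G (?P v) (?P v)" for v
    using norm_K_horizontal[OF h] unfolding KP .
  have "G (K v + K u) (K v + K u) = G (?P v + ?P u) (?P v + ?P u)"
    unfolding linear_add[OF K_lin, symmetric] PP by (rule sq)
  then have "G (K v) (K u) = G (?P v) (?P u)"
    using sq[of v] sq[of u] G_sym[of "K v" "K u"] G_sym[of "?P v" "?P u"]
    unfolding linear_add[OF Gl(1)] linear_add[OF Gl(2)] by linarith
  also have "\<dots> = G v u - a v * a u - b v * b u"
    by (simp add: lin GX GY G_X G_Y h aX aY bX bY)
  finally have "G (K v) (K u) = G v u - a v * a u - b v * b u" .
  moreover have "G (K (K v)) u = - G (K v) (K u)"
    using alt_bilinearD(1)[OF R, of "K v" u] GK[of "K v" u] GK[of u "K v"] G_sym[of "K v" "K u"]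
    by linarith
  ultimately show "G (K (K v)) u = G (- v + a v *\<^sub>R X + b v *\<^sub>R Y) u"
    by (simp add: lin GX GY)
qed

lemma metric_lower_bound: "(a v)\<^sup>2 \<le> G v v"
proof -
  note Gl = inner_form_linear(1)[OF G] inner_form_linear(2)[OF G]
  have "0 \<le> G (v - a v *\<^sub>R X) (v - a v *\<^sub>R X)"
    using G linear_0[OF Gl(1)] unfolding inner_form_def by (metis less_eq_real_def)
  also have "\<dots> = G v v - (a v)\<^sup>2"
    by (simp add: linear_diff[OF Gl(1)] linear_diff[OF Gl(2)] linear_scale[OF Gl(1)]
        linear_scale[OF Gl(2)] GX G_X linear_diff[OF a_lin] linear_scale[OF a_lin] aX power2_eq_square)
  finally show ?thesis by simp
qed

lemma wJ: "w (J v) u = - G v u + a v * a u + b v * b u"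
  using GJ[of "J v" u] by (simp add: JJ aJ bJ linear_neg[OF inner_form_linear(1)[OF G]])

text \<open>
  On the 4-plane the new complex structure is the unit combination \<open>c J + s K\<close> of anticommuting complex
  structures, so that \<open>w\<close> and \<open>R\<close> get rotated into each other while \<open>I\<close> is unchanged.  On the
  complementary 2-plane \<open>a\<close> gets stretched by the factor \<open>t\<close>.
\<close>

context
  fixes c s t :: real
  assumes cs: "c\<^sup>2 + s\<^sup>2 = 1" and t: "t > 0"
begin

definition "G' v u = G v u + (t\<^sup>2 - 1) * (a v * a u)"

text \<open>
  The coefficients of \<open>X\<close> and \<open>Y\<close> are determined by the condition that \<open>t a + i b\<close> be of type \<open>(1,0)\<close>.
\<close>

definition "J' v = c *\<^sub>R J v + s *\<^sub>R K v + ((c - 1 / t) * b v) *\<^sub>R X + ((t - c) * a v) *\<^sub>R Y"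

lemma inner_form_G': "inner_form G'"
  unfolding inner_form_def
proof (intro conjI allI impI)
  show "linear (\<lambda>v. G' v u)" for u
    unfolding G'_def
    by (intro linearI)
      (simp_all add: linear_add[OF a_lin] linear_scale[OF a_lin] linear_add[OF inner_form_linear(1)[OF G]]
        linear_scale[OF inner_form_linear(1)[OF G]] algebra_simps)
  show "G' v u = G' u v" for v u by (simp add: G'_def G_sym[of v u])
  show "G' v v > 0" if "v \<noteq> 0" for v
  proof (cases "a v = 0")
    case True
    then show ?thesis using that G by (simp add: G'_def inner_form_def)
  next
    case False
    then have "t\<^sup>2 * (a v)\<^sup>2 > 0" using t by simp
    then show ?thesis
      using metric_lower_bound[of v] unfolding G'_def by (simp add: power2_eq_square algebra_simps)
  qed
qed

lemma linear_J': "linear J'"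
  unfolding J'_def
  by (intro linearI)
    (simp_all add: linear_add[OF a_lin] linear_scale[OF a_lin] linear_add[OF b_lin] linear_scale[OF b_lin]
      linear_add[OF J_lin] linear_scale[OF J_lin] linear_add[OF K_lin] linear_scale[OF K_lin] algebra_simps)

lemma aJ': "a (J' v) = - b v / t"
  by (simp add: J'_def linear_add[OF a_lin] linear_diff[OF a_lin] linear_scale[OF a_lin] aJ aK aX aY algebra_simps)

lemma bJ': "b (J' v) = t * a v"
  by (simp add: J'_def linear_add[OF b_lin] linear_diff[OF b_lin] linear_scale[OF b_lin] bJ bK bX bY algebra_simps)

lemma J'_J': "J' (J' v) = - v"
proof -
  have JX: "J X = Y" "J Y = - X" by (simp_all add: Y_eq JJ)
  have J: "J (J' v) = - (c *\<^sub>R v) + s *\<^sub>R J (K v) + ((c - 1 / t) * b v) *\<^sub>R Y - ((t - c) * a v) *\<^sub>R X"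
    unfolding J'_def
    by (simp add: linear_add[OF J_lin] linear_scale[OF J_lin] JJ JX)
  have K: "K (J' v) = - (c *\<^sub>R J (K v)) + s *\<^sub>R (- v + a v *\<^sub>R X + b v *\<^sub>R Y)"
    unfolding J'_def
    by (simp add: linear_add[OF K_lin] linear_scale[OF K_lin] KX KY KJ KK)
  have "J' (J' v) = - ((c * c + s * s) *\<^sub>R v)
      + (s * s * a v - c * ((t - c) * a v) + (c - 1 / t) * (t * a v)) *\<^sub>R X
      + (s * s * b v + c * ((c - 1 / t) * b v) - (t - c) * (b v / t)) *\<^sub>R Y"
    unfolding J'_def[of "J' v"] aJ' bJ' J K by (simp add: algebra_simps)
  moreover have c1: "c * c + s * s = 1" using cs by (simp add: power2_eq_square)
  moreover have "s * s * a v - c * ((t - c) * a v) + (c - 1 / t) * (t * a v) = (c * c + s * s - 1) * a v"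
    using t by (simp add: field_simps)
  moreover have "s * s * b v + c * ((c - 1 / t) * b v) - (t - c) * (b v / t) = (c * c + s * s - 1) * b v"
    using t by (simp add: field_simps)
  ultimately show ?thesis by simp
qed

lemma G'_J': "G' (J' v) u = c * w v u + s * R v u + t * (a v * b u - b v * a u)"
proof -
  note Gl = inner_form_linear(1)[OF G]
  have "G (J' v) u = c * (w v u + a v * b u - b v * a u) + s * R v u + (c - 1 / t) * b v * a u
      + (t - c) * a v * b u"
    unfolding J'_def by (simp add: linear_add[OF Gl] linear_scale[OF Gl] GJ GK GX GY)
  then show ?thesis
    unfolding G'_def aJ' using t by (simp add: field_simps power2_eq_square)
qed

text \<open>
  The bilinear form \<open>G' (J' v) u\<close> is skew; with \<open>J'\<^sup>2 = -1\<close> this means that \<open>J'\<close> is an isometry.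
\<close>

lemma G'_J'_J': "G' (J' v) (J' u) = G' v u"
proof -
  have skew: "G' (J' v) u = - G' (J' u) v" for v u
    unfolding G'_J' using alt_bilinearD(1)[OF w, of v u] alt_bilinearD(1)[OF R, of v u]
    by (simp add: algebra_simps)
  have "G' (J' v) (J' u) = - G' (- u) v" unfolding skew[of v "J' u"] J'_J' ..
  also have "\<dots> = G' u v" using linear_neg[OF inner_form_linear(1)[OF inner_form_G']] by simp
  finally show ?thesis using inner_form_G' unfolding inner_form_def by metis
qed

lemma G'_dual: "G' ((1 / t) *\<^sub>R X) u = t * a u" "G' Y u = b u"
  using t by (simp_all add: G'_def linear_scale[OF inner_form_linear(1)[OF G]] linear_scale[OF a_lin]
      GX GY aX aY field_simps power2_eq_square)

lemma R'_J': "c * R (J' v) u - s * w (J' v) u = - I v u"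
  and I_J': "I (J' v) u = c * R v u - s * w v u"
proof -
  note l = alt_bilinearD(3)[OF R] alt_bilinearD(3)[OF w] alt_bilinearD(3)[OF I]
  note lin = linear_add[OF l(1)] linear_add[OF l(2)] linear_add[OF l(3)]
    linear_scale[OF l(1)] linear_scale[OF l(2)] linear_scale[OF l(3)]
  note Gl = inner_form_linear(1)[OF G]
  have wK: "w (K v) u = I v u" using GJ[of "K v" u] by (simp add: aK bK GJK)
  have RK: "R (K v) u = - G v u + a v * a u + b v * b u"
    unfolding GK[symmetric] KK by (simp add: linear_add[OF Gl] linear_diff[OF Gl] linear_neg[OF Gl] linear_scale[OF Gl] GX GY)
  have "J (K (K v)) = - J v + a v *\<^sub>R Y - b v *\<^sub>R X"
    unfolding KK by (simp add: linear_add[OF J_lin] linear_neg[OF J_lin] linear_scale[OF J_lin]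
        linear_diff[OF J_lin] JJ Y_eq)
  then have "I (K v) u = G (- J v + a v *\<^sub>R Y - b v *\<^sub>R X) u"
    using GJK[of "K v" u] by simp
  also have "\<dots> = - w v u"
    unfolding linear_add[OF Gl] linear_diff[OF Gl] linear_neg[OF Gl] linear_scale[OF Gl] GX GY GJ
    by simp
  finally have IK: "I (K v) u = - w v u" .
  have "R (J' v) u = - c * I v u + s * (- G v u + a v * a u + b v * b u)"
    unfolding J'_def by (simp add: lin RJ RK RX RY)
  moreover have "w (J' v) u = c * (- G v u + a v * a u + b v * b u) + s * I v u"
    unfolding J'_def by (simp add: lin wJ wK wX wY)
  moreover have "c * (- c * z + s * y) - s * (c * y + s * z) = - (c\<^sup>2 + s\<^sup>2) * z" for y z
    by (simp add: power2_eq_square algebra_simps)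
  ultimately show "c * R (J' v) u - s * w (J' v) u = - I v u" by (simp only: cs)
  show "I (J' v) u = c * R v u - s * w v u"
    unfolding J'_def by (simp add: lin IJ IK IX IY)
qed

end

end

section \<open>SU(2) structures on a manifold\<close>

lemma shuffle_prod_1_1:
  assumes "homogeneous 1 a" "homogeneous 1 b"
  shows "(a \<odot> b) [v, u] = a [v] * b [u] - a [u] * b [v]"
  using assms by (simp add: homogeneous_def shuffle_prod_Cons iprod_def grade_inv_def)

lemma shuffle_prod_2_2:
  assumes "homogeneous 2 a" "homogeneous 2 b"
  shows "(a \<odot> b) [v, u, p, q] = a [v, u] * b [p, q] - a [v, p] * b [u, q] + a [v, q] * b [u, p]
     + a [u, p] * b [v, q] - a [u, q] * b [v, p] + a [p, q] * b [v, u]"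
  using assms by (simp add: homogeneous_def shuffle_prod_Cons iprod_def grade_inv_def)

lemma alternating_form_1D:
  assumes "alternating_form 1 f"
  shows "linear (\<lambda>v. f [v])"
proof -
  have *: "length us + length ws + 1 = 1 \<Longrightarrow> linear (\<lambda>v. f (us @ v # ws))" for us ws
    using assms unfolding alternating_form_def by blast
  show ?thesis using *[of "[]" "[]"] by simp
qed

lemma alternating_form_2D:
  assumes f: "alternating_form 2 f"
  shows "linear (\<lambda>v. f [v, u])" "linear (\<lambda>u. f [v, u])" "f [v, u] = - f [u, v]"
proof -
  have *: "length us + length ws + 1 = 2 \<Longrightarrow> linear (\<lambda>v. f (us @ v # ws))" for us ws
    using f unfolding alternating_form_def by blast
  show "linear (\<lambda>v. f [v, u])" "linear (\<lambda>u. f [v, u])" using *[of "[]" "[u]"] *[of "[v]" "[]"] by simp_all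
  have "f ([] @ v # u # []) + f ([] @ u # v # []) = 0"
    using f unfolding alternating_form_iff adjacent_alternating_def by blast
  then show "f [v, u] = - f [u, v]" by (simp add: eq_neg_iff_add_eq_0)
qed

lemma alt_bilinear_Re_Im:
  assumes f: "alternating_form 2 f"
  shows "alt_bilinear (\<lambda>v u. Re (f [v, u]))" "alt_bilinear (\<lambda>v u. Im (f [v, u]))"
proof -
  have "linear (\<lambda>v. Re (f [v, u]))" "linear (\<lambda>v. Im (f [v, u]))" for u
    using linear_compose[OF alternating_form_2D(1)[OF f], of Re u]
      linear_compose[OF alternating_form_2D(1)[OF f], of Im u]
    by (simp_all add: o_def bounded_linear.linear bounded_linear_Re bounded_linear_Im)
  moreover have "Re (f [v, u]) = - Re (f [u, v])" "Im (f [v, u]) = - Im (f [u, v])" for v u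
    by (simp_all only: alternating_form_2D(3)[OF f, of v u] uminus_complex.simps)
  ultimately show "alt_bilinear (\<lambda>v u. Re (f [v, u]))" "alt_bilinear (\<lambda>v u. Im (f [v, u]))"
    unfolding alt_bilinear_def by blast+
qed

lemma riemannian_inner_form:
  "riemannian_metric A g \<Longrightarrow> ch \<in> A \<Longrightarrow> x \<in> cimage ch \<Longrightarrow> inner_form (g ch x)"
  unfolding riemannian_metric_def inner_form_def by blast

abbreviation dual_Re :: "'m metric_field \<Rightarrow> 'm dform \<Rightarrow> 'm chart \<Rightarrow> real^6 \<Rightarrow> real^6" where
  "dual_Re g \<alpha> ch x \<equiv> sharp (g ch x) (\<lambda>v. Re (\<alpha> ch x [v]))"

abbreviation dual_Im :: "'m metric_field \<Rightarrow> 'm dform \<Rightarrow> 'm chart \<Rightarrow> real^6 \<Rightarrow> real^6" where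
  "dual_Im g \<alpha> ch x \<equiv> sharp (g ch x) (\<lambda>v. Im (\<alpha> ch x [v]))"

abbreviation raise_Re :: "'m metric_field \<Rightarrow> 'm dform \<Rightarrow> 'm endo" where
  "raise_Re g \<Omega> ch x v \<equiv> sharp (g ch x) (\<lambda>u. Re (\<Omega> ch x [v, u]))"

lemma sharp_uminus:
  assumes G: "inner_form G" and l: "linear l"
  shows "sharp G (\<lambda>v. - l v) = - sharp G l"
  by (rule sharp_eqI[OF G])
    (simp add: linear_neg[OF inner_form_linear(1)[OF G]] sharp_cramer(2)[OF G l])

lemma su2_structureD:
  assumes "su2_structure A J g \<alpha> \<omega> \<Omega>"
  shows "almost_hermitian A J g" "form_type A J 1 \<alpha>"
    "\<And>ch x. ch \<in> A \<Longrightarrow> x \<in> cimage ch \<Longrightarrow> contract g (fcnj \<alpha>) \<alpha> ch x [] = 2"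
    "diff_form A 2 \<omega>" "real_form A \<omega>" "form_type A J 2 \<Omega>"
    "\<And>ch x. ch \<in> A \<Longrightarrow> x \<in> cimage ch \<Longrightarrow> \<omega> ch x \<odot> \<omega> ch x = (1/2) \<cdot> (\<Omega> ch x \<odot> (cnj \<circ> \<Omega> ch x))"
    "\<And>ch x. ch \<in> A \<Longrightarrow> x \<in> cimage ch \<Longrightarrow> \<omega> ch x \<odot> \<omega> ch x \<noteq> 0"
    "\<And>ch x. ch \<in> A \<Longrightarrow> x \<in> cimage ch \<Longrightarrow> \<omega> ch x \<odot> \<Omega> ch x = 0"
    "\<And>ch x. ch \<in> A \<Longrightarrow> x \<in> cimage ch \<Longrightarrow> \<Omega> ch x \<odot> \<Omega> ch x = 0"
    "\<And>ch x vs. ch \<in> A \<Longrightarrow> x \<in> cimage ch \<Longrightarrow> contract g \<alpha> \<Omega> ch x vs = 0"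
    "\<And>ch x vs. ch \<in> A \<Longrightarrow> x \<in> cimage ch \<Longrightarrow> contract g \<alpha> \<omega> ch x vs = 0"
    "\<And>ch x. ch \<in> A \<Longrightarrow> x \<in> cimage ch \<Longrightarrow> fundamental_form J g ch x = assoc_F \<alpha> \<omega> ch x"
proof -
  note su2 = assms[unfolded su2_structure_def form_eq_def nowhere_zero_def fwedge_at fscale_at]
  show "almost_hermitian A J g" "form_type A J 1 \<alpha>" "diff_form A 2 \<omega>" "real_form A \<omega>" "form_type A J 2 \<Omega>"
    using su2 by blast+
  fix ch :: "'a chart" and x assume c: "ch \<in> A" "x \<in> cimage ch"
  have "fcnj \<Omega> ch x = cnj \<circ> \<Omega> ch x" by (simp add: fcnj_def o_def)
  then show "\<omega> ch x \<odot> \<omega> ch x = (1/2) \<cdot> (\<Omega> ch x \<odot> (cnj \<circ> \<Omega> ch x))"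
    using su2 c by metis
  show "contract g (fcnj \<alpha>) \<alpha> ch x [] = 2" "\<omega> ch x \<odot> \<omega> ch x \<noteq> 0" 
    "fundamental_form J g ch x = assoc_F \<alpha> \<omega> ch x" using su2 c by blast+
  have z: "\<omega> ch x \<odot> \<Omega> ch x = 0 ch x" "\<Omega> ch x \<odot> \<Omega> ch x = 0 ch x"
      "contract g \<alpha> \<Omega> ch x = 0 ch x" "contract g \<alpha> \<omega> ch x = 0 ch x"
    using su2 c by blast+
  show "\<omega> ch x \<odot> \<Omega> ch x = 0" "\<Omega> ch x \<odot> \<Omega> ch x = 0"
    "contract g \<alpha> \<Omega> ch x vs = 0" "contract g \<alpha> \<omega> ch x vs = 0" for vs
    unfolding z by simp_all
qed

text \<open>
  Separate the equations between complex forms into real and imaginary parts.  In particular \<open>\<Omega> \<and> \<Omega> = 0\<close> gives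
  \<open>R\<^sup>2 = I\<^sup>2\<close>, and so \<open>\<omega>\<^sup>2 = (R\<^sup>2 + I\<^sup>2) / 2 = R\<^sup>2\<close>.
\<close>

lemma su2_structure_pointwise:
  assumes su2: "su2_structure A J g \<alpha> \<omega> \<Omega>" and ch: "ch \<in> A" and x: "x \<in> cimage ch"
  shows "su2_linear (g ch x) (J ch x) (\<lambda>v. Re (\<alpha> ch x [v])) (\<lambda>v. Im (\<alpha> ch x [v]))
    (\<lambda>v u. Re (\<omega> ch x [v, u])) (\<lambda>v u. Re (\<Omega> ch x [v, u])) (\<lambda>v u. Im (\<Omega> ch x [v, u]))
    (dual_Re g \<alpha> ch x) (dual_Im g \<alpha> ch x) (raise_Re g \<Omega> ch x)"
proof -
  note S = su2_structureD[OF su2]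
  note S7 = S(7-13)[OF ch x]
  have alm: "almost_complex_structure A J" "riemannian_metric A g"
    "\<And>v u. g ch x (J ch x v) (J ch x u) = g ch x v u"
    using S(1) ch x unfolding almost_hermitian_def by blast+
  have G: "inner_form (g ch x)" by (rule riemannian_inner_form[OF alm(2) ch x])
  have J: "linear (J ch x)" "\<And>v. J ch x (J ch x v) = - v"
    using alm(1) ch x unfolding almost_complex_structure_def by blast+
  have \<alpha>: "alternating_form 1 (\<alpha> ch x)" "\<And>v. \<alpha> ch x [v] + \<i> * \<alpha> ch x [J ch x v] = 0"
    and \<Omega>: "alternating_form 2 (\<Omega> ch x)" "\<And>v u. \<Omega> ch x [v, u] + \<i> * \<Omega> ch x [J ch x v, u] = 0"
    using S(2,6) ch x diff_formD(1) unfolding form_type_def by blast+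
  have \<omega>: "alternating_form 2 (\<omega> ch x)" by (rule diff_formD(1)[OF S(4) ch x])
  have real: "\<omega> ch x vs = of_real (Re (\<omega> ch x vs))" for vs
    using S(5) ch x unfolding real_form_def by (simp add: complex_is_Real_iff complex_eq_iff)
  have hom: "homogeneous 1 (\<alpha> ch x)" "homogeneous 2 (\<Omega> ch x)" "homogeneous 2 (\<omega> ch x)"
    using \<alpha>(1) \<Omega>(1) \<omega> unfolding alternating_form_iff by blast+
  then have homc: "homogeneous 1 (cnj \<circ> \<alpha> ch x)" "homogeneous 2 (cnj \<circ> \<Omega> ch x)"
    unfolding homogeneous_def by simp_all
  have ab: "linear (\<lambda>v. Re (\<alpha> ch x [v]))" "linear (\<lambda>v. Im (\<alpha> ch x [v]))"
    using linear_compose[OF alternating_form_1D[OF \<alpha>(1)], of Re]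
      linear_compose[OF alternating_form_1D[OF \<alpha>(1)], of Im]
    by (simp_all add: o_def bounded_linear.linear bounded_linear_Re bounded_linear_Im)
  note GX = sharp_cramer(2)[OF G ab(1)] and GY = sharp_cramer(2)[OF G ab(2)]
  have Rlin: "linear (\<lambda>u. Re (\<Omega> ch x [v, u]))" for v
    using alt_bilinearD(4)[OF alt_bilinear_Re_Im(1)[OF \<Omega>(1)]] .
  have \<alpha>J: "\<alpha> ch x [J ch x v] = \<i> * \<alpha> ch x [v]" for v
    using arg_cong[OF \<alpha>(2)[of v], of "\<lambda>z. \<i> * z"] by (simp add: algebra_simps)
  have \<Omega>J: "\<Omega> ch x [J ch x v, u] = \<i> * \<Omega> ch x [v, u]" for v u
    using arg_cong[OF \<Omega>(2)[of v u], of "\<lambda>z. \<i> * z"] by (simp add: algebra_simps)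
  have "sharp (g ch x) (\<lambda>v. Im (fcnj \<alpha> ch x [v])) = - dual_Im g \<alpha> ch x"
    "sharp (g ch x) (\<lambda>v. Re (fcnj \<alpha> ch x [v])) = dual_Re g \<alpha> ch x"
    using sharp_uminus[OF G ab(2)] by (simp_all add: fcnj_def)
  then have "\<alpha> ch x [dual_Re g \<alpha> ch x] - \<i> * \<alpha> ch x [dual_Im g \<alpha> ch x] = 2"
    using S(3)[OF ch x] linear_neg[OF alternating_form_1D[OF \<alpha>(1)]] by (simp add: contract_def)
  then have aXbY: "Re (\<alpha> ch x [dual_Re g \<alpha> ch x]) + Im (\<alpha> ch x [dual_Im g \<alpha> ch x]) = 2"
    by (simp add: complex_eq_iff)
  have F: "g ch x (J ch x v) u = Re (\<omega> ch x [v, u])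
      + Re (\<alpha> ch x [v]) * Im (\<alpha> ch x [u]) - Im (\<alpha> ch x [v]) * Re (\<alpha> ch x [u])" for v u
  proof -
    have "complex_of_real (g ch x (J ch x v) u) =
        \<omega> ch x [v, u] + (\<i>/2) * (\<alpha> ch x \<odot> (cnj \<circ> \<alpha> ch x)) [v, u]"
      using fun_cong[OF S7(7), of "[v, u]"]
      by (simp add: fundamental_form_def assoc_F_def fscale_at fwedge_at scale_form_def fcnj_def o_def)
    then show ?thesis
      unfolding shuffle_prod_1_1[OF hom(1) homc(1)] by (simp add: complex_eq_iff field_simps)
  qed
  have ker: "Re (\<omega> ch x [dual_Re g \<alpha> ch x, u]) = 0" "Re (\<omega> ch x [dual_Im g \<alpha> ch x, u]) = 0" for u
  proof -
    have "\<omega> ch x [dual_Re g \<alpha> ch x, u] + \<i> * \<omega> ch x [dual_Im g \<alpha> ch x, u] = 0"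
      using S7(6)[of "[u]"] by (simp add: contract_def)
    then show "Re (\<omega> ch x [dual_Re g \<alpha> ch x, u]) = 0" "Re (\<omega> ch x [dual_Im g \<alpha> ch x, u]) = 0"
      using real[of "[dual_Re g \<alpha> ch x, u]"] real[of "[dual_Im g \<alpha> ch x, u]"]
      by (simp_all add: complex_eq_iff)
  qed
  have im: "Im (\<omega> ch x vs) = 0" for vs using real[of vs] by (metis Im_complex_of_real)
  have wO: "wedge4 (\<lambda>v u. Re (\<omega> ch x [v, u])) (\<lambda>v u. Re (\<Omega> ch x [v, u])) v u p q = 0"
    "wedge4 (\<lambda>v u. Re (\<omega> ch x [v, u])) (\<lambda>v u. Im (\<Omega> ch x [v, u])) v u p q = 0" for v u p q
    using fun_cong[OF S7(3), of "[v, u, p, q]"] unfolding shuffle_prod_2_2[OF hom(3,2)]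
    by (simp_all add: complex_eq_iff im wedge4_def algebra_simps)
  have OO: "wedge4 (\<lambda>v u. Re (\<Omega> ch x [v, u])) (\<lambda>v u. Re (\<Omega> ch x [v, u])) v u p q =
      wedge4 (\<lambda>v u. Im (\<Omega> ch x [v, u])) (\<lambda>v u. Im (\<Omega> ch x [v, u])) v u p q" for v u p q
    using arg_cong[OF fun_cong[OF S7(4), of "[v, u, p, q]"], of Re] unfolding shuffle_prod_2_2[OF hom(2,2)]
    by (simp add: wedge4_def)
  have ww: "wedge4 (\<lambda>v u. Re (\<omega> ch x [v, u])) (\<lambda>v u. Re (\<omega> ch x [v, u])) v u p q =
      wedge4 (\<lambda>v u. Re (\<Omega> ch x [v, u])) (\<lambda>v u. Re (\<Omega> ch x [v, u])) v u p q" for v u p q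
    using arg_cong[OF fun_cong[OF S7(1), of "[v, u, p, q]"], of Re] OO[of v u p q]
    unfolding scale_form_def shuffle_prod_2_2[OF hom(3,3)] shuffle_prod_2_2[OF hom(2) homc(2)]
    by (simp add: wedge4_def im)
  obtain vs where vs: "(\<omega> ch x \<odot> \<omega> ch x) vs \<noteq> 0" using S7(2) by (auto simp: fun_eq_iff)
  then have "length vs = 4"
    using homogeneous_shuffle_prod[OF hom(3,3)] unfolding homogeneous_def by auto
  then obtain v u p q where "vs = [v, u, p, q]"
    by (auto simp: numeral_eq_Suc length_Suc_conv)
  then have "(\<omega> ch x \<odot> \<omega> ch x) [v, u, p, q] \<noteq> 0" using vs by simp
  then have "wedge4 (\<lambda>v u. Re (\<omega> ch x [v, u])) (\<lambda>v u. Re (\<omega> ch x [v, u])) v u p q \<noteq> 0"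
    unfolding shuffle_prod_2_2[OF hom(3,3)] by (simp add: complex_eq_iff im wedge4_def)
  then have nz: "\<exists>v u p q. wedge4 (\<lambda>v u. Re (\<omega> ch x [v, u])) (\<lambda>v u. Re (\<omega> ch x [v, u])) v u p q \<noteq> 0"
    by blast
  show ?thesis
    apply (rule su2_linear.intro)
                      apply (rule G J alm(3) ab GX GY)+
    subgoal by (simp add: \<alpha>J)
    subgoal by (simp add: \<alpha>J)
                apply (rule GX GY aXbY alt_bilinear_Re_Im[OF \<omega>] alt_bilinear_Re_Im[OF \<Omega>(1)])+
    subgoal by (simp add: \<Omega>J)
    subgoal by (simp add: \<Omega>J)
        apply (rule F ker ww wO nz sharp_cramer(2)[OF G Rlin])+
    done
qed

lemma su2_structure_kernel:
  assumes su2: "su2_structure A J g \<alpha> \<omega> \<Omega>" and ch: "ch \<in> A" and x: "x \<in> cimage ch"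
  shows "iprod (dual_Re g \<alpha> ch x) (\<omega> ch x) = 0" "iprod (dual_Im g \<alpha> ch x) (\<omega> ch x) = 0"
    "iprod (dual_Re g \<alpha> ch x) (\<Omega> ch x) = 0" "iprod (dual_Im g \<alpha> ch x) (\<Omega> ch x) = 0"
    "\<alpha> ch x [dual_Re g \<alpha> ch x] = 1" "\<alpha> ch x [dual_Im g \<alpha> ch x] = \<i>"
proof -
  interpret P: su2_linear "g ch x" "J ch x" "\<lambda>v. Re (\<alpha> ch x [v])" "\<lambda>v. Im (\<alpha> ch x [v])"
    "\<lambda>v u. Re (\<omega> ch x [v, u])" "\<lambda>v u. Re (\<Omega> ch x [v, u])" "\<lambda>v u. Im (\<Omega> ch x [v, u])"
    "dual_Re g \<alpha> ch x" "dual_Im g \<alpha> ch x" "raise_Re g \<Omega> ch x"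
    by (rule su2_structure_pointwise[OF su2 ch x])
  have hom: "homogeneous 2 (\<omega> ch x)" "homogeneous 2 (\<Omega> ch x)"
    using su2_structureD(4,6)[OF su2] diff_formD(1)[OF _ ch x]
    unfolding form_type_def alternating_form_iff by blast+
  have list: "iprod Z f = 0" if "homogeneous 2 f" "\<And>u. f [Z, u] = 0" for Z :: "real^6" and f
  proof
    show "iprod Z f vs = 0 vs" for vs
    proof (cases "length vs = 1")
      case True
      then obtain u where "vs = [u]" by (auto simp: length_Suc_conv)
      then show ?thesis using that(2) by (simp add: iprod_def)
    next
      case False
      then show ?thesis using that(1) by (simp add: homogeneous_def iprod_def)
    qed
  qed
  have im: "Im (\<omega> ch x vs) = 0" for vs
    using su2_structureD(5)[OF su2] ch x unfolding real_form_def by (simp add: complex_is_Real_iff)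
  show "iprod (dual_Re g \<alpha> ch x) (\<omega> ch x) = 0" "iprod (dual_Im g \<alpha> ch x) (\<omega> ch x) = 0"
    "iprod (dual_Re g \<alpha> ch x) (\<Omega> ch x) = 0" "iprod (dual_Im g \<alpha> ch x) (\<Omega> ch x) = 0"
    using P.wX P.wY P.RX P.RY P.IX P.IY by (auto intro!: list hom simp: complex_eq_iff im)
  show "\<alpha> ch x [dual_Re g \<alpha> ch x] = 1" "\<alpha> ch x [dual_Im g \<alpha> ch x] = \<i>"
    using P.aX P.aY P.bX P.bY by (simp_all add: complex_eq_iff)
qed

text \<open>
  An isometry is injective, hence surjective on a space of finite dimension, and so it transports dual
  vectors to dual vectors.
\<close>

lemma sharp_natural:
  fixes D :: "real^6 \<Rightarrow> real^6"
  assumes G: "inner_form G" and H: "inner_form H" and D: "linear D" and iso: "\<And>v u. G v u = H (D v) (D u)"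
    and l: "linear l" and lm: "\<And>v. l v = m (D v)"
  shows "D (sharp G l) = sharp H m"
proof -
  have "inj D"
  proof (rule injI)
    fix v u assume "D v = D u"
    then show "v = u" by (intro inner_form_eqI[OF G]) (simp add: iso)
  qed
  then have "surj D" using linear_injective_imp_surjective[OF D] by blast
  then have "\<exists>w. v = D w" for v by (metis surjD)
  then have "H (D (sharp G l)) v = m v" for v
    using sharp_cramer(2)[OF G l] iso lm by metis
  then show ?thesis by (intro sharp_eqI[OF H, symmetric])
qed

lemma shuffle_prod_cnj: "(cnj \<circ> f) \<odot> (cnj \<circ> h) = cnj \<circ> (f \<odot> h)"
  by (simp add: fun_eq_iff cnj_shuffle_prod)

lemmas shuffle_prod_bilinear = shuffle_prod_add_left shuffle_prod_add_right shuffle_prod_diff_left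
  shuffle_prod_diff_right shuffle_prod_scale_left shuffle_prod_scale_right

text \<open>
  Writing \<open>R\<close>, \<open>I\<close> for the real and imaginary part of \<open>\<Omega>\<close>, the hypotheses say that \<open>\<omega>\<close>, \<open>R\<close>, \<open>I\<close> have equal squares
  and vanishing mixed products.  These relations are invariant under orthogonal changes of the
  triple, in particular under a rotation of the first two.
\<close>

lemma rotate_pair:
  fixes W Z :: "'v list \<Rightarrow> complex" and k s :: real
  defines "R \<equiv> \<lambda>vs. complex_of_real (Re (Z vs))" and "I \<equiv> \<lambda>vs. complex_of_real (Im (Z vs))"
  defines "W' \<equiv> of_real k \<cdot> W + of_real s \<cdot> R" and "Z' \<equiv> of_real k \<cdot> R - of_real s \<cdot> W + \<i> \<cdot> I"
  assumes hom: "homogeneous 2 W" "homogeneous 2 Z" and real: "\<And>vs. W vs \<in> \<real>"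
    and WW: "W \<odot> W = (1/2) \<cdot> (Z \<odot> (cnj \<circ> Z))" and WO: "W \<odot> Z = 0" and OO: "Z \<odot> Z = 0"
    and ks: "k\<^sup>2 + s\<^sup>2 = 1"
  shows "W' \<odot> W' = W \<odot> W" "W \<odot> W = (1/2) \<cdot> (Z' \<odot> (cnj \<circ> Z'))" "W' \<odot> Z' = 0" "Z' \<odot> Z' = 0"
    "I \<odot> I = W \<odot> W"
proof -
  define C where "C = cnj \<circ> Z"
  have W: "cnj \<circ> W = W" using real by (auto simp: fun_eq_iff intro!: Reals_cnj_iff[THEN iffD1])
  have R: "R = (1/2) \<cdot> (Z + C)"
    unfolding R_def C_def by (simp add: fun_eq_iff scale_form_def complex_eq_iff)
  have I: "I = (- \<i>/2) \<cdot> (Z - C)"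
    unfolding I_def C_def by (simp add: fun_eq_iff scale_form_def complex_eq_iff)
  have WC: "W \<odot> C = 0"
    using arg_cong[OF WO, of "(\<circ>) cnj"] unfolding C_def shuffle_prod_cnj[symmetric] W
    by (simp add: fun_eq_iff)
  have CC: "C \<odot> C = 0"
    unfolding C_def shuffle_prod_cnj OO by (simp add: fun_eq_iff)
  have even: "grade_inv f = f" if "homogeneous 2 f" for f :: "'v list \<Rightarrow> complex"
    unfolding homogeneous_grade_inv[OF that] by (simp add: fun_eq_iff scale_form_def)
  have CO: "C \<odot> Z = Z \<odot> C" and OW: "Z \<odot> W = 0" and CW: "C \<odot> W = 0"
    using even_commute[OF even[OF hom(2)], of C] even_commute[OF even[OF hom(1)], of Z]
      even_commute[OF even[OF hom(1)], of C] WO WC by simp_all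
  have RR: "R \<odot> R = W \<odot> W" and II: "I \<odot> I = W \<odot> W" and RI: "R \<odot> I = 0" and IR: "I \<odot> R = 0"
    and WR: "W \<odot> R = 0" "R \<odot> W = 0" and WI: "W \<odot> I = 0" "I \<odot> W = 0"
    unfolding R I WW C_def[symmetric] shuffle_prod_bilinear OO CC CO WO WC OW CW
    by (simp_all add: scale_form_def fun_eq_iff algebra_simps)
  show "I \<odot> I = W \<odot> W" by (rule II)
  note rules = shuffle_prod_bilinear RR II RI IR WR WI
  have ks': "of_real k * of_real k + of_real s * of_real s = (1 :: complex)"
    using ks by (metis of_real_1 of_real_add of_real_mult power2_eq_square)
  have ks'': "of_real k * (of_real k * z) + of_real s * (of_real s * z) = z" for z :: complex
    using ks' by (metis (no_types, lifting) distrib_right mult.assoc mult_1)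
  show "W' \<odot> W' = W \<odot> W"
    unfolding W'_def rules by (simp add: scale_form_def fun_eq_iff ks'')
  have cO': "cnj \<circ> Z' = of_real k \<cdot> R - of_real s \<cdot> W - \<i> \<cdot> I"
  proof -
    have "cnj (W vs) = W vs" for vs using W by (metis comp_apply)
    then show ?thesis by (simp add: Z'_def R_def I_def fun_eq_iff scale_form_def)
  qed
  show "W \<odot> W = (1/2) \<cdot> (Z' \<odot> (cnj \<circ> Z'))"
    unfolding cO' unfolding Z'_def rules
    by (simp add: scale_form_def fun_eq_iff algebra_simps ks'')
  show "W' \<odot> Z' = 0" "Z' \<odot> Z' = 0"
    unfolding W'_def Z'_def rules
    by (simp_all add: scale_form_def fun_eq_iff algebra_simps ks'')
qed

lemma form_eq_zero: "form_eq A a 0 \<longleftrightarrow> (\<forall>c\<in>A. \<forall>x\<in>cimage c. a c x = 0)"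
  by (auto simp: form_eq_def fun_eq_iff)

text \<open>
  The one construction of structures that is needed: rotate \<open>(\<omega>, Re \<Omega>)\<close> and stretch \<open>Re \<alpha>\<close>.  Its inverse
  is of the same kind, so it serves both directions.  The new tensors are built from the old ones by raising indices,
  which makes them smooth and independent of the chart.
\<close>

lemma su2_structure_squash_rotate:
  assumes M: "smooth_manifold6 X A" and su2: "su2_structure A J g \<alpha> \<omega> \<Omega>"
    and ks: "k\<^sup>2 + s\<^sup>2 = 1" and t: "t > 0"
    and df: "diff_form A 1 \<alpha>'" "diff_form A 2 \<omega>'" "diff_form A 2 \<Omega>'"
    and \<alpha>': "form_eq A \<alpha>' (complex_of_real t *\<^sub>F fRe \<alpha> + \<i> *\<^sub>F fIm \<alpha>)"
    and \<omega>': "form_eq A \<omega>' (complex_of_real k *\<^sub>F \<omega> + complex_of_real s *\<^sub>F fRe \<Omega>)"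
    and \<Omega>': "form_eq A \<Omega>' (complex_of_real k *\<^sub>F fRe \<Omega> - complex_of_real s *\<^sub>F \<omega> + \<i> *\<^sub>F fIm \<Omega>)"
  shows "\<exists>J' g'. su2_structure A J' g' \<alpha>' \<omega>' \<Omega>'"
proof -
  define J' where "J' ch x v = k *\<^sub>R J ch x v + s *\<^sub>R raise_Re g \<Omega> ch x v
      + ((k - 1 / t) * Im (\<alpha> ch x [v])) *\<^sub>R dual_Re g \<alpha> ch x
      + ((t - k) * Re (\<alpha> ch x [v])) *\<^sub>R dual_Im g \<alpha> ch x" for ch x v
  define g' where "g' ch x v u = g ch x v u + (t\<^sup>2 - 1) * (Re (\<alpha> ch x [v]) * Re (\<alpha> ch x [u]))" for ch x v u
  note S = su2_structureD[OF su2]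
  have alm: "almost_complex_structure A J" and gmet: "riemannian_metric A g"
    using S(1) unfolding almost_hermitian_def by blast+
  have diff: "diff_form A 1 \<alpha>" "diff_form A 2 \<omega>" "diff_form A 2 \<Omega>"
    using S(2,4,6) unfolding form_type_def by blast+
  have im: "Im (\<omega> ch x vs) = 0" if "ch \<in> A" "x \<in> cimage ch" for ch x vs
    using S(5) that unfolding real_form_def by (simp add: complex_is_Real_iff)
  have \<alpha>'_at: "\<alpha>' ch x vs = of_real t * of_real (Re (\<alpha> ch x vs)) + \<i> * of_real (Im (\<alpha> ch x vs))"
    and \<omega>'_at: "\<omega>' ch x vs = of_real k * \<omega> ch x vs + of_real s * of_real (Re (\<Omega> ch x vs))"
    and \<Omega>'_at: "\<Omega>' ch x vs = of_real k * of_real (Re (\<Omega> ch x vs)) - of_real s * \<omega> ch x vs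
        + \<i> * of_real (Im (\<Omega> ch x vs))"
    if "ch \<in> A" "x \<in> cimage ch" for ch x vs
    using \<alpha>' \<omega>' \<Omega>' that unfolding form_eq_def by (simp_all add: fscale_def fRe_def fIm_def)
  have pt: "inner_form (g' ch x)" "linear (J' ch x)" "J' ch x (J' ch x v) = - v"
    "g' ch x (J' ch x v) (J' ch x u) = g' ch x v u"
    "\<alpha>' ch x [J' ch x v] = \<i> * \<alpha>' ch x [v]"
    "\<Omega>' ch x [J' ch x v, u] = \<i> * \<Omega>' ch x [v, u]"
    "g' ch x (J' ch x v) u = Re (\<omega>' ch x [v, u]) + t * (Re (\<alpha> ch x [v]) * Im (\<alpha> ch x [u])
        - Im (\<alpha> ch x [v]) * Re (\<alpha> ch x [u]))"
    "g' ch x ((1 / t) *\<^sub>R dual_Re g \<alpha> ch x) u = t * Re (\<alpha> ch x [u])"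
    "g' ch x (dual_Im g \<alpha> ch x) u = Im (\<alpha> ch x [u])"
    if ch: "ch \<in> A" and x: "x \<in> cimage ch" for ch x v u
  proof -
    interpret P: su2_linear "g ch x" "J ch x" "\<lambda>v. Re (\<alpha> ch x [v])" "\<lambda>v. Im (\<alpha> ch x [v])"
      "\<lambda>v u. Re (\<omega> ch x [v, u])" "\<lambda>v u. Re (\<Omega> ch x [v, u])" "\<lambda>v u. Im (\<Omega> ch x [v, u])"
      "dual_Re g \<alpha> ch x" "dual_Im g \<alpha> ch x" "raise_Re g \<Omega> ch x"
      by (rule su2_structure_pointwise[OF su2 ch x])
    note at = \<alpha>'_at[OF ch x] \<omega>'_at[OF ch x] \<Omega>'_at[OF ch x] im[OF ch x]
    have J: "J' ch x = P.J' k s t" by (simp add: fun_eq_iff J'_def P.J'_def[OF ks t])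
    have G: "g' ch x = P.G' t" by (simp add: fun_eq_iff g'_def P.G'_def[OF ks t])
    show "inner_form (g' ch x)" "linear (J' ch x)" "J' ch x (J' ch x v) = - v"
      "g' ch x (J' ch x v) (J' ch x u) = g' ch x v u"
      unfolding J G by (intro P.inner_form_G'[OF ks t] P.linear_J'[OF ks t] P.J'_J'[OF ks t] P.G'_J'_J'[OF ks t])+
    show "g' ch x ((1 / t) *\<^sub>R dual_Re g \<alpha> ch x) u = t * Re (\<alpha> ch x [u])"
      "g' ch x (dual_Im g \<alpha> ch x) u = Im (\<alpha> ch x [u])"
      unfolding G by (rule P.G'_dual[OF ks t])+
    show "\<alpha>' ch x [J' ch x v] = \<i> * \<alpha>' ch x [v]"
      unfolding J using t by (simp add: at complex_eq_iff P.aJ'[OF ks t] P.bJ'[OF ks t])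
    show "\<Omega>' ch x [J' ch x v, u] = \<i> * \<Omega>' ch x [v, u]"
      using P.R'_J'[OF ks t, of v u] P.I_J'[OF ks t, of v u]
      unfolding J by (simp add: at complex_eq_iff)
    show "g' ch x (J' ch x v) u = Re (\<omega>' ch x [v, u]) + t * (Re (\<alpha> ch x [v]) * Im (\<alpha> ch x [u])
        - Im (\<alpha> ch x [v]) * Re (\<alpha> ch x [u]))"
      unfolding J G P.G'_J'[OF ks t] by (simp add: at)
  qed
  have lin: "linear (\<lambda>v. Re (\<alpha> ch x [v]))" "linear (\<lambda>v. Im (\<alpha> ch x [v]))"
      "linear (\<lambda>u. Re (\<Omega> ch x [v, u]))"
    if "ch \<in> A" "x \<in> cimage ch" for ch x v
    using su2_linear.a_lin[OF su2_structure_pointwise[OF su2 that]]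
      su2_linear.b_lin[OF su2_structure_pointwise[OF su2 that]]
      alt_bilinearD(4)[OF su2_linear.R[OF su2_structure_pointwise[OF su2 that]]] by simp_all
  have smooth_form: "smooth_on (\<lambda>x. Re (f ch x vs)) (cimage ch)" "smooth_on (\<lambda>x. Im (f ch x vs)) (cimage ch)"
    if "diff_form A n f" "ch \<in> A" for f n ch vs
    by (rule smooth_on_bounded_linear[OF open_cimage[OF M that(2)] bounded_linear_Re diff_formD(2)[OF that]])
      (rule smooth_on_bounded_linear[OF open_cimage[OF M that(2)] bounded_linear_Im diff_formD(2)[OF that]])
  have smooth_g: "smooth_on (\<lambda>x. g ch x v u) (cimage ch)" if "ch \<in> A" for ch v u
    using gmet that unfolding riemannian_metric_def by blast
  have smooth_sharp: "smooth_on (\<lambda>x. dual_Re g \<alpha> ch x) (cimage ch)" "smooth_on (\<lambda>x. dual_Im g \<alpha> ch x) (cimage ch)"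
    "smooth_on (\<lambda>x. raise_Re g \<Omega> ch x v) (cimage ch)" if "ch \<in> A" for ch v
  proof -
    note sh = smooth_on_sharp[OF open_cimage[OF M that] riemannian_inner_form[OF gmet that]]
    note sg = smooth_g[OF that]
    show "smooth_on (\<lambda>x. dual_Re g \<alpha> ch x) (cimage ch)"
      by (rule sh[OF _ lin(1)[OF that] sg smooth_form(1)[OF diff(1) that]])
    show "smooth_on (\<lambda>x. dual_Im g \<alpha> ch x) (cimage ch)"
      by (rule sh[OF _ lin(2)[OF that] sg smooth_form(2)[OF diff(1) that]])
    show "smooth_on (\<lambda>x. raise_Re g \<Omega> ch x v) (cimage ch)"
      by (rule sh[OF _ lin(3)[OF that] sg smooth_form(1)[OF diff(3) that]])
  qed
  have acs': "almost_complex_structure A J'"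
    unfolding almost_complex_structure_def
  proof (intro conjI ballI allI)
    fix ch assume ch: "ch \<in> A"
    note op = open_cimage[OF M ch]
    show "linear (J' ch x)" "J' ch x (J' ch x v) = - v" if "x \<in> cimage ch" for x v
      by (rule pt[OF ch that])+
    have J: "smooth_on (\<lambda>x. J ch x v) (cimage ch)" for v
      using alm ch unfolding almost_complex_structure_def by blast
    show "smooth_on (\<lambda>x. J' ch x v) (cimage ch)" for v
      unfolding J'_def
      by (intro smooth_on_add[OF op] smooth_on_scaleR[OF op] smooth_on_mult[OF op] smooth_on_const J
          smooth_sharp[OF ch] smooth_form[OF diff(1) ch])
  next
    fix ch c' x v assume ch: "ch \<in> A" "c' \<in> A" and x: "x \<in> overlap ch c'"
    let ?D = "frechet_derivative (transition ch c') (at x)"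
    let ?x' = "transition ch c' x"
    note ov = overlap_transition[OF M ch x]
    have \<alpha>: "\<alpha> ch x [v] = \<alpha> c' ?x' [?D v]" for v
      using diff_formD(3)[OF diff(1) ch x, of "[v]"] by simp
    have \<Omega>: "\<Omega> ch x [v, u] = \<Omega> c' ?x' [?D v, ?D u]" for v u
      using diff_formD(3)[OF diff(3) ch x, of "[v, u]"] by simp
    have g: "g ch x v u = g c' ?x' (?D v) (?D u)" for v u
      using gmet ch x unfolding riemannian_metric_def by blast
    note nat = sharp_natural[OF riemannian_inner_form[OF gmet ch(1) ov(1)]
        riemannian_inner_form[OF gmet ch(2) ov(2)] ov(3) g]
    have X: "?D (dual_Re g \<alpha> ch x) = dual_Re g \<alpha> c' ?x'"
      by (rule nat[OF lin(1)[OF ch(1) ov(1)]]) (simp only: \<alpha>)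
    have Y: "?D (dual_Im g \<alpha> ch x) = dual_Im g \<alpha> c' ?x'"
      by (rule nat[OF lin(2)[OF ch(1) ov(1)]]) (simp only: \<alpha>)
    have K: "?D (raise_Re g \<Omega> ch x v) = raise_Re g \<Omega> c' ?x' (?D v)"
      by (rule nat[OF lin(3)[OF ch(1) ov(1)]]) (simp only: \<Omega>)
    have J: "?D (J ch x v) = J c' ?x' (?D v)"
      using alm ch x unfolding almost_complex_structure_def by blast
    show "?D (J' ch x v) = J' c' ?x' (?D v)"
      unfolding J'_def linear_add[OF ov(3)] linear_scale[OF ov(3)] X Y K J unfolding \<alpha>[of v] ..
  qed
  have gmet': "riemannian_metric A g'"
    unfolding riemannian_metric_def
  proof (intro conjI ballI)
    fix ch assume ch: "ch \<in> A"
    note op = open_cimage[OF M ch]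
    show "\<forall>w. linear (\<lambda>v. g' ch x v w)" "\<forall>v w. g' ch x v w = g' ch x w v"
      "\<forall>v. v \<noteq> 0 \<longrightarrow> g' ch x v v > 0" if "x \<in> cimage ch" for x
      using pt(1)[OF ch that] unfolding inner_form_def by blast+
    show "\<forall>v w. smooth_on (\<lambda>x. g' ch x v w) (cimage ch)"
      unfolding g'_def
      by (intro allI smooth_on_add[OF op] smooth_on_mult[OF op] smooth_on_const smooth_g[OF ch]
          smooth_form[OF diff(1) ch])
  next
    fix ch c' x assume ch: "ch \<in> A" "c' \<in> A" and x: "x \<in> overlap ch c'"
    have \<alpha>: "\<alpha> ch x [v] = \<alpha> c' (transition ch c' x) [frechet_derivative (transition ch c') (at x) v]" for v
      using diff_formD(3)[OF diff(1) ch x, of "[v]"] by simp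
    have g: "g ch x v u = g c' (transition ch c' x) (frechet_derivative (transition ch c') (at x) v)
        (frechet_derivative (transition ch c') (at x) u)" for v u
      using gmet ch x unfolding riemannian_metric_def by blast
    show "\<forall>v w. g' ch x v w = g' c' (transition ch c' x) (frechet_derivative (transition ch c') (at x) v)
        (frechet_derivative (transition ch c') (at x) w)"
      unfolding g'_def by (simp only: \<alpha>[symmetric] g[symmetric]) simp
  qed
  have herm': "almost_hermitian A J' g'"
    using acs' gmet' pt(4) unfolding almost_hermitian_def by blast
  have hom: "homogeneous n (f ch x)" if "diff_form A n f" "ch \<in> A" "x \<in> cimage ch" for n f ch x
    using diff_formD(1)[OF that] unfolding alternating_form_iff by blast
  have type: "form_type A J' 1 \<alpha>'" "form_type A J' 2 \<Omega>'"
  proof -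
    have "\<alpha>' ch x (v # vs) + \<i> * \<alpha>' ch x (J' ch x v # vs) = 0"
      if "ch \<in> A" "x \<in> cimage ch" for ch x v vs
      using hom[OF df(1) that] pt(5)[OF that, of v]
      by (cases vs) (simp_all add: homogeneous_def flip: mult.assoc)
    then show "form_type A J' 1 \<alpha>'" using df(1) unfolding form_type_def by blast
    have "\<Omega>' ch x (v # vs) + \<i> * \<Omega>' ch x (J' ch x v # vs) = 0"
      if "ch \<in> A" "x \<in> cimage ch" for ch x v vs
    proof (cases "length vs = 1")
      case True
      then obtain u where "vs = [u]" by (auto simp: length_Suc_conv)
      then show ?thesis using pt(6)[OF that, of v u] by (simp flip: mult.assoc)
    qed (use hom[OF df(3) that] in \<open>simp add: homogeneous_def\<close>)
    then show "form_type A J' 2 \<Omega>'" using df(3) unfolding form_type_def by blast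
  qed
  have sharp': "sharp (g' ch x) (\<lambda>v. Re (\<alpha>' ch x [v])) = (1 / t) *\<^sub>R dual_Re g \<alpha> ch x"
    "sharp (g' ch x) (\<lambda>v. Im (\<alpha>' ch x [v])) = dual_Im g \<alpha> ch x"
    if "ch \<in> A" "x \<in> cimage ch" for ch x
    by (intro sharp_eqI pt(1)[OF that]; simp add: pt(8,9)[OF that] \<alpha>'_at[OF that])+
  have sharp'_neg: "sharp (g' ch x) (\<lambda>v. - Im (\<alpha>' ch x [v])) = - dual_Im g \<alpha> ch x"
    if "ch \<in> A" "x \<in> cimage ch" for ch x
    using lin(2)[OF that] sharp_uminus[OF pt(1)[OF that], of "\<lambda>v. Im (\<alpha>' ch x [v])"]
    unfolding sharp'(2)[OF that] by (simp add: \<alpha>'_at[OF that])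
  have \<alpha>'_lin: "linear (\<lambda>v. \<alpha>' ch x [v])" if "ch \<in> A" "x \<in> cimage ch" for ch x
    by (rule alternating_form_1D[OF diff_formD(1)[OF df(1) that]])
  have norm': "contract g' (fcnj \<alpha>') \<alpha>' ch x [] = 2" if "ch \<in> A" "x \<in> cimage ch" for ch x
  proof -
    have "contract g' (fcnj \<alpha>') \<alpha>' ch x [] =
        \<alpha>' ch x [(1 / t) *\<^sub>R dual_Re g \<alpha> ch x] + \<i> * \<alpha>' ch x [- dual_Im g \<alpha> ch x]"
      using sharp'(1)[OF that] sharp'_neg[OF that] by (simp add: contract_def fcnj_def)
    also have "\<dots> = (1 / t) *\<^sub>R \<alpha>' ch x [dual_Re g \<alpha> ch x] - \<i> * \<alpha>' ch x [dual_Im g \<alpha> ch x]"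
      by (simp only: linear_scale[OF \<alpha>'_lin[OF that]] linear_neg[OF \<alpha>'_lin[OF that]]) simp
    also have "\<dots> = 2"
      using t by (simp add: \<alpha>'_at[OF that] su2_structure_kernel[OF su2 that] scaleR_conv_of_real)
    finally show ?thesis .
  qed
  have ker': "contract g' \<alpha>' f ch x vs = 0"
    if f: "diff_form A 2 f" and ch: "ch \<in> A" "x \<in> cimage ch"
      and z: "\<And>v. iprod v (\<omega> ch x) = 0 \<Longrightarrow> iprod v (\<Omega> ch x) = 0 \<Longrightarrow> iprod v (f ch x) = 0" for f ch x vs
  proof -
    have "iprod (dual_Re g \<alpha> ch x) (f ch x) = 0" and Y: "iprod (dual_Im g \<alpha> ch x) (f ch x) = 0"
      by (intro z su2_structure_kernel[OF su2 ch])+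
    moreover have "multilinear_form (f ch x)" using diff_formD(1)[OF f ch] unfolding alternating_form_iff by blast
    then have "linear (\<lambda>v. f ch x ([] @ v # vs))" unfolding multilinear_form_def by blast
    note linear_scale[OF this, of "1 / t" "dual_Re g \<alpha> ch x"]
    ultimately have "f ch x (((1 / t) *\<^sub>R dual_Re g \<alpha> ch x) # vs) = 0"
      by (simp add: fun_eq_iff iprod_def)
    then show ?thesis using Y by (simp add: contract_def sharp'[OF ch] fun_eq_iff iprod_def)
  qed
  have ker_\<omega>: "contract g' \<alpha>' \<omega>' ch x = 0" and ker_\<Omega>: "contract g' \<alpha>' \<Omega>' ch x = 0"
    if "ch \<in> A" "x \<in> cimage ch" for ch x
    by (intro ext; simp only: zero_fun_apply; rule ker'[OF _ that]; simp add: df fun_eq_iff iprod_def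
        \<omega>'_at[OF that] \<Omega>'_at[OF that])+
  have real': "real_form A \<omega>'"
    unfolding real_form_def
  proof (intro ballI allI)
    fix ch x vs assume c: "ch \<in> A" "x \<in> cimage ch"
    show "\<omega>' ch x vs \<in> \<real>" by (simp add: \<omega>'_at[OF c] complex_is_Real_iff im[OF c])
  qed
  have alg: "\<omega>' ch x \<odot> \<omega>' ch x = \<omega> ch x \<odot> \<omega> ch x"
    "\<omega>' ch x \<odot> \<omega>' ch x = (1/2) \<cdot> (\<Omega>' ch x \<odot> (cnj \<circ> \<Omega>' ch x))"
    "\<omega>' ch x \<odot> \<Omega>' ch x = 0" "\<Omega>' ch x \<odot> \<Omega>' ch x = 0"
    if "ch \<in> A" "x \<in> cimage ch" for ch x
  proof -
    have W: "\<omega>' ch x = of_real k \<cdot> \<omega> ch x + of_real s \<cdot> (\<lambda>vs. of_real (Re (\<Omega> ch x vs)))"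
      and O: "\<Omega>' ch x = of_real k \<cdot> (\<lambda>vs. of_real (Re (\<Omega> ch x vs))) - of_real s \<cdot> \<omega> ch x
          + \<i> \<cdot> (\<lambda>vs. of_real (Im (\<Omega> ch x vs)))"
      by (simp_all add: fun_eq_iff \<omega>'_at[OF that] \<Omega>'_at[OF that] scale_form_def)
    have r: "\<omega> ch x vs \<in> \<real>" for vs using S(5) that unfolding real_form_def by blast
    note rot = rotate_pair[OF hom[OF diff(2) that] hom[OF diff(3) that] r S(7,9,10)[OF that] ks, folded W O]
    show "\<omega>' ch x \<odot> \<omega>' ch x = \<omega> ch x \<odot> \<omega> ch x" "\<omega>' ch x \<odot> \<Omega>' ch x = 0" "\<Omega>' ch x \<odot> \<Omega>' ch x = 0"
      by (rule rot)+
    show "\<omega>' ch x \<odot> \<omega>' ch x = (1/2) \<cdot> (\<Omega>' ch x \<odot> (cnj \<circ> \<Omega>' ch x))"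
      unfolding rot(1) by (rule rot(2))
  qed
  have fund: "fundamental_form J' g' ch x = assoc_F \<alpha>' \<omega>' ch x" if c: "ch \<in> A" "x \<in> cimage ch" for ch x
  proof
    fix vs
    let ?A = "\<alpha>' ch x \<odot> (cnj \<circ> \<alpha>' ch x)"
    have h1: "homogeneous 1 (\<alpha>' ch x)" "homogeneous 1 (cnj \<circ> \<alpha>' ch x)"
      using hom[OF df(1) c] by (simp_all add: homogeneous_def)
    have assoc: "assoc_F \<alpha>' \<omega>' ch x vs = \<omega>' ch x vs + (\<i>/2) * ?A vs"
      by (simp add: assoc_F_def fscale_at fwedge_at scale_form_def fcnj_def o_def)
    show "fundamental_form J' g' ch x vs = assoc_F \<alpha>' \<omega>' ch x vs"
    proof (cases "length vs = 2")
      case False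
      then have "?A vs = 0" "\<omega>' ch x vs = 0"
        using homogeneous_shuffle_prod[OF h1] hom[OF df(2) c] by (simp_all add: homogeneous_def)
      then show ?thesis using False unfolding assoc by (simp add: fundamental_form_def)
    next
      case True
      then obtain v u where vs: "vs = [v, u]" by (auto simp: numeral_eq_Suc length_Suc_conv)
      have "\<omega>' ch x [v, u] = of_real (Re (\<omega>' ch x [v, u]))"
        using real' c unfolding real_form_def by (simp add: complex_is_Real_iff complex_eq_iff)
      moreover have "(\<i>/2) * ?A [v, u] = of_real (t * (Re (\<alpha> ch x [v]) * Im (\<alpha> ch x [u])
          - Im (\<alpha> ch x [v]) * Re (\<alpha> ch x [u])))"
        unfolding shuffle_prod_1_1[OF h1] by (simp add: \<alpha>'_at[OF c] complex_eq_iff algebra_simps)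
      ultimately show ?thesis
        unfolding assoc unfolding vs by (simp add: fundamental_form_def pt(7)[OF c])
    qed
  qed
  have c': "cnj \<circ> f ch x = fcnj f ch x" for f :: "'a dform" and ch x by (simp add: fcnj_def o_def)
  have "su2_structure A J' g' \<alpha>' \<omega>' \<Omega>'"
    unfolding su2_structure_def form_eq_zero unfolding form_eq_def nowhere_zero_def fwedge_at fscale_at
  proof (intro conjI ballI herm' type norm' df real' ker_\<omega> ker_\<Omega> fund alg(2)[unfolded c'] alg(3,4))
    show "\<omega>' ch x \<odot> \<omega>' ch x \<noteq> 0" if "ch \<in> A" "x \<in> cimage ch" for ch x
      using S(8)[OF that] unfolding alg(1)[OF that] .
  qed
  then show ?thesis by blast
qed

text \<open>
  A quarter turn of \<open>\<alpha>\<close> exchanges the roles of its real and imaginary part; this reduces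
  the second hatted structure to the first one.
\<close>

lemma su2_structure_times_minus_i:
  assumes M: "smooth_manifold6 X A" and su2: "su2_structure A J g \<alpha> \<omega> \<Omega>"
  shows "su2_structure A J g ((- \<i>) *\<^sub>F \<alpha>) \<omega> \<Omega>"
proof -
  let ?\<beta> = "(- \<i>) *\<^sub>F \<alpha>"
  note S = su2_structureD[OF su2]
  have diff: "diff_form A 1 \<alpha>" "diff_form A 2 \<omega>" "diff_form A 2 \<Omega>"
    using S(2,4,6) unfolding form_type_def by blast+
  have gmet: "riemannian_metric A g" using S(1) unfolding almost_hermitian_def by blast
  have type: "form_type A J 1 ?\<beta>"
    unfolding form_type_def
  proof (intro conjI ballI allI)
    show "diff_form A 1 ?\<beta>" by (rule diff_form_scale[OF M diff(1)])
    fix ch x v vs assume "ch \<in> A" "x \<in> cimage ch"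
    then have "\<alpha> ch x (v # vs) + \<i> * \<alpha> ch x (J ch x v # vs) = 0"
      using S(2) unfolding form_type_def by blast
    then have "- \<i> * (\<alpha> ch x (v # vs) + \<i> * \<alpha> ch x (J ch x v # vs)) = 0" by (simp only: mult_zero_right)
    then show "?\<beta> ch x (v # vs) + \<i> * ?\<beta> ch x (J ch x v # vs) = 0"
      unfolding fscale_def by (simp only: algebra_simps)
  qed
  have sharps: "sharp (g ch x) (\<lambda>v. Re (?\<beta> ch x [v])) = dual_Im g \<alpha> ch x"
    "sharp (g ch x) (\<lambda>v. Im (?\<beta> ch x [v])) = - dual_Re g \<alpha> ch x"
    if c: "ch \<in> A" "x \<in> cimage ch" for ch x
    using sharp_uminus[OF riemannian_inner_form[OF gmet c] su2_linear.a_lin[OF su2_structure_pointwise[OF su2 c]]]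
    by (simp_all add: fscale_def)
  have norm: "contract g (fcnj ?\<beta>) ?\<beta> ch x [] = 2" if c: "ch \<in> A" "x \<in> cimage ch" for ch x
    using sharps[OF c] su2_structure_kernel(5,6)[OF su2 c]
    by (simp add: contract_def fcnj_def) (simp add: fscale_def)
  have ker: "contract g ?\<beta> f ch x vs = 0"
    if c: "ch \<in> A" "x \<in> cimage ch" and f: "diff_form A 2 f"
      and z: "iprod (dual_Re g \<alpha> ch x) (f ch x) = 0" "iprod (dual_Im g \<alpha> ch x) (f ch x) = 0" for ch x vs f
  proof -
    have "multilinear_form (f ch x)" using diff_formD(1)[OF f c] unfolding alternating_form_iff by blast
    then have "linear (\<lambda>v. f ch x ([] @ v # vs))" unfolding multilinear_form_def by blast
    note linear_neg[OF this, of "dual_Re g \<alpha> ch x"]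
    then show ?thesis using z sharps[OF c] by (simp add: contract_def fun_eq_iff iprod_def)
  qed
  have F: "assoc_F ?\<beta> \<omega> ch x = assoc_F \<alpha> \<omega> ch x" for ch x
  proof -
    have "fcnj ?\<beta> ch x = \<i> \<cdot> fcnj \<alpha> ch x" by (simp add: fcnj_def fscale_def scale_form_def)
    then show ?thesis
      by (simp add: assoc_F_def fwedge_at fscale_at shuffle_prod_scale_left shuffle_prod_scale_right)
        (simp add: scale_form_def)
  qed
  have K: "contract g ?\<beta> \<omega> ch x = 0" "contract g ?\<beta> \<Omega> ch x = 0"
    if c: "ch \<in> A" "x \<in> cimage ch" for ch x
    using ker[OF c diff(2) su2_structure_kernel(1,2)[OF su2 c]]
      ker[OF c diff(3) su2_structure_kernel(3,4)[OF su2 c]] by (simp_all add: fun_eq_iff)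
  have F': "form_eq A (fundamental_form J g) (assoc_F ?\<beta> \<omega>)"
    unfolding form_eq_def F by (intro ballI S(13))
  show ?thesis
    using su2 unfolding su2_structure_def form_eq_zero
    by (elim conjE, intro conjI) (assumption | rule type F' | intro ballI norm K)+
qed

section \<open>The associated SU(3) structure\<close>

lemma homogeneous_0_shuffle_prod:
  assumes "homogeneous 0 f" shows "f \<odot> h = f [] \<cdot> h"
proof
  have z: "iprod v f = 0" for v using assms by (simp add: homogeneous_def iprod_def fun_eq_iff)
  have e: "grade_inv f = f" using homogeneous_grade_inv[OF assms] by (simp add: scale_form_def)
  show "(f \<odot> h) vs = (f [] \<cdot> h) vs" for vs
    by (induction vs arbitrary: h) (simp_all add: shuffle_prod_Cons z e scale_form_def, simp add: iprod_def)
qed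

lemma odd_square_zero:
  assumes "homogeneous 1 a" shows "a \<odot> a = 0"
proof -
  have "grade_inv a = - a" using homogeneous_grade_inv[OF assms] by (simp add: scale_form_def fun_eq_iff)
  then have "a \<odot> a = - (a \<odot> a)" using odd_commute[of a a] by (simp only: shuffle_prod_uminus_left)
  then have "(a \<odot> a) vs = - (a \<odot> a) vs" for vs by (metis uminus_apply)
  then show ?thesis by (simp add: fun_eq_iff)
qed

lemma odd_anticommute:
  assumes "homogeneous 1 a" "homogeneous 1 b" shows "b \<odot> a = - (a \<odot> b)"
proof -
  have *: "grade_inv f = - f" if "homogeneous 1 f" for f :: "'a list \<Rightarrow> complex"
    using homogeneous_grade_inv[OF that] by (simp add: scale_form_def fun_eq_iff)
  show ?thesis using odd_commute[OF *[OF assms(2)], of a] by (simp only: *[OF assms(1)] shuffle_prod_uminus_left)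
qed

lemma even_homogeneous:
  assumes "homogeneous k a" "even k" shows "a \<odot> b = b \<odot> a"
  using homogeneous_grade_inv[OF assms(1)] assms(2) by (intro even_commute) (simp add: scale_form_def)

text \<open>
  The 2-forms commute with all forms and \<open>\<alpha> \<and> \<alpha> = 0\<close>, while \<open>\<omega>\<^sup>3 = 0\<close> because \<open>\<omega>\<^sup>2\<close> is a multiple of
  \<open>\<Omega> \<and> cnj \<Omega>\<close> and \<open>\<omega> \<and> \<Omega> = 0\<close>.  So only \<open>3 \<omega>\<^sup>2 \<and> (i/2) \<alpha> \<and> cnj \<alpha>\<close> survives in \<open>F\<^sup>3\<close>.
\<close>

lemma su2_forms_algebra:
  fixes a W Z :: "'v list \<Rightarrow> complex"
  assumes hom: "homogeneous 1 a" "homogeneous 2 W" "homogeneous 2 Z"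
    and WW: "W \<odot> W = (1/2) \<cdot> (Z \<odot> (cnj \<circ> Z))" and WZ: "W \<odot> Z = 0"
  defines "E \<equiv> a \<odot> (cnj \<circ> a)"
  defines "F \<equiv> W + (\<i>/2) \<cdot> E" and "\<Psi> \<equiv> a \<odot> Z"
  shows "F \<odot> \<Psi> = 0" "\<Psi> \<odot> (cnj \<circ> \<Psi>) = 2 \<cdot> (E \<odot> W \<odot> W)"
    "(4/3) \<cdot> (F \<odot> F \<odot> F) = \<i> \<cdot> (\<Psi> \<odot> (cnj \<circ> \<Psi>))"
proof -
  define ab C where "ab = cnj \<circ> a" and "C = cnj \<circ> Z"
  have E: "E = a \<odot> ab" by (simp add: E_def ab_def)
  have homc: "homogeneous 1 ab" "homogeneous 2 C" using hom by (simp_all add: homogeneous_def ab_def C_def)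
  have homE: "homogeneous 2 E" using homogeneous_shuffle_prod[OF hom(1) homc(1)] unfolding E by (simp add: numeral_2_eq_2)
  have "even (2 :: nat)" by simp
  note comm = even_homogeneous[OF hom(2) this] even_homogeneous[OF hom(3) this]
  have aE: "E \<odot> a = 0"
    unfolding E shuffle_prod_assoc odd_anticommute[OF hom(1) homc(1)] shuffle_prod_uminus_right
    by (simp add: shuffle_prod_assoc[symmetric] odd_square_zero[OF hom(1)])
  have EE: "E \<odot> E = 0" unfolding E[symmetric] by (subst (2) E) (simp add: aE flip: shuffle_prod_assoc)
  have "W \<odot> a \<odot> Z = a \<odot> (W \<odot> Z)"
    by (simp add: comm(1)[of a] flip: shuffle_prod_assoc)
  then show "F \<odot> \<Psi> = 0"
    unfolding F_def \<Psi>_def shuffle_prod_bilinear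
    by (simp add: WZ aE scale_form_def fun_eq_iff flip: shuffle_prod_assoc)
  have C\<Psi>: "cnj \<circ> \<Psi> = ab \<odot> C" unfolding \<Psi>_def ab_def C_def by (simp add: shuffle_prod_cnj)
  have "a \<odot> Z \<odot> ab \<odot> C = a \<odot> ab \<odot> Z \<odot> C"
    using comm(2)[of ab] by (metis shuffle_prod_assoc)
  then have "\<Psi> \<odot> (cnj \<circ> \<Psi>) = E \<odot> (Z \<odot> C)"
    unfolding C\<Psi> unfolding \<Psi>_def E by (simp add: shuffle_prod_assoc)
  also have "Z \<odot> C = 2 \<cdot> (W \<odot> W)"
    unfolding WW C_def by (simp add: scale_form_def)
  finally show \<Psi>\<Psi>: "\<Psi> \<odot> (cnj \<circ> \<Psi>) = 2 \<cdot> (E \<odot> W \<odot> W)"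
    by (simp only: shuffle_prod_scale_right)
  have WWW: "W \<odot> W \<odot> W = 0"
    unfolding WW shuffle_prod_scale_right shuffle_prod_assoc[symmetric] WZ
    by (simp add: scale_form_def fun_eq_iff)
  have WWE: "W \<odot> W \<odot> E = E \<odot> W \<odot> W" "W \<odot> E \<odot> W = E \<odot> W \<odot> W"
    using comm(1)[of E] by (metis shuffle_prod_assoc)+
  have WEE: "W \<odot> E \<odot> E = 0" "E \<odot> W \<odot> E = 0" "E \<odot> E \<odot> f = 0" for f
    using comm(1)[of E] EE by (metis shuffle_prod_assoc shuffle_prod_zero_left shuffle_prod_zero_right)+
  show "(4/3) \<cdot> (F \<odot> F \<odot> F) = \<i> \<cdot> (\<Psi> \<odot> (cnj \<circ> \<Psi>))"
    unfolding \<Psi>\<Psi> F_def shuffle_prod_bilinear WWW WWE WEE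
    by (simp add: scale_form_def fun_eq_iff EE field_simps)
qed

text \<open>
  The volume form is nonzero since contraction with \<open>X\<close> and \<open>Y\<close>, which annihilate \<open>\<omega>\<close>,
  turns it into a nonzero multiple of \<open>\<omega>\<^sup>2\<close>.
\<close>

lemma su2_structure_imp_su3_structure:
  assumes M: "smooth_manifold6 X A" and su2: "su2_structure A J g \<alpha> \<omega> \<Omega>"
  shows "su3_structure A J g (assoc_F \<alpha> \<omega>) (assoc_Psi \<alpha> \<Omega>)"
proof -
  note S = su2_structureD[OF su2]
  have type: "form_type A J 3 (assoc_Psi \<alpha> \<Omega>)"
    using form_type_wedge[OF M S(2) S(6)] by (simp add: assoc_Psi_def numeral_3_eq_3)
  have diff: "diff_form A 1 \<alpha>" "diff_form A 2 \<Omega>"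
    using S(2,6) unfolding form_type_def by blast+
  have hom: "homogeneous n (f ch x)" if "diff_form A n f" "ch \<in> A" "x \<in> cimage ch" for n f ch x
    using diff_formD(1)[OF that] unfolding alternating_form_iff by blast
  note alg = su2_forms_algebra[OF hom[OF diff(1)] hom[OF S(4)] hom[OF diff(2)] S(7,9)]
  have at: "assoc_F \<alpha> \<omega> ch x = \<omega> ch x + (\<i>/2) \<cdot> (\<alpha> ch x \<odot> (cnj \<circ> \<alpha> ch x))"
    "assoc_Psi \<alpha> \<Omega> ch x = \<alpha> ch x \<odot> \<Omega> ch x"
    "fcnj (assoc_Psi \<alpha> \<Omega>) ch x = cnj \<circ> (\<alpha> ch x \<odot> \<Omega> ch x)" for ch x
    by (simp_all add: assoc_F_def assoc_Psi_def fwedge_at fscale_at fcnj_def o_def)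
  have nz: "(\<alpha> ch x \<odot> \<Omega> ch x) \<odot> (cnj \<circ> (\<alpha> ch x \<odot> \<Omega> ch x)) \<noteq> 0"
    if c: "ch \<in> A" "x \<in> cimage ch" for ch x
  proof -
    let ?X = "dual_Re g \<alpha> ch x" and ?Y = "dual_Im g \<alpha> ch x"
    let ?E = "\<alpha> ch x \<odot> (cnj \<circ> \<alpha> ch x)" and ?B = "\<omega> ch x \<odot> \<omega> ch x"
    note ker = su2_structure_kernel[OF su2 c]
    have h: "homogeneous 1 (\<alpha> ch x)" "homogeneous 1 (cnj \<circ> \<alpha> ch x)"
      using hom[OF diff(1) c] by (simp_all add: homogeneous_def)
    have hE: "homogeneous 2 ?E" using homogeneous_shuffle_prod[OF h] by (simp add: numeral_2_eq_2)
    have B: "iprod ?X ?B = 0" "iprod ?Y ?B = 0" by (simp_all add: iprod_shuffle_prod ker(1,2))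
    have "homogeneous 0 (iprod ?Y (iprod ?X ?E))"
      using hE by (simp add: homogeneous_def iprod_def)
    moreover have "iprod ?Y (iprod ?X ?E) [] = - 2 * \<i>"
      using shuffle_prod_1_1[OF h, of ?X ?Y] by (simp add: iprod_def ker(5,6))
    moreover have "iprod ?Y (iprod ?X (?E \<odot> ?B)) = iprod ?Y (iprod ?X ?E) \<odot> ?B"
      by (simp only: iprod_shuffle_prod[of _ _ ?B] B shuffle_prod_zero_right add_0_right)
    ultimately have "iprod ?Y (iprod ?X (?E \<odot> ?B)) = (- 2 * \<i>) \<cdot> ?B"
      by (simp only: homogeneous_0_shuffle_prod)
    moreover obtain vs where "?B vs \<noteq> 0" using S(8)[OF c] by (auto simp: fun_eq_iff)
    ultimately have "(?E \<odot> ?B) (?X # ?Y # vs) \<noteq> 0"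
      by (simp add: fun_eq_iff iprod_def scale_form_def)
    then have "(2 \<cdot> (?E \<odot> ?B)) (?X # ?Y # vs) \<noteq> 0" by (simp add: scale_form_def)
    then have "2 \<cdot> (?E \<odot> ?B) \<noteq> 0" by (rule contrapos_nn) (simp only: zero_fun_apply)
    then show ?thesis unfolding alg(2)[OF c c c c c] .
  qed
  show ?thesis
    unfolding su3_structure_def form_eq_zero unfolding form_eq_def nowhere_zero_def fwedge_at fscale_at
  proof (intro conjI ballI)
    show "almost_hermitian A J g" "form_type A J 3 (assoc_Psi \<alpha> \<Omega>)" by (rule S(1) type)+
    fix ch x assume c: "ch \<in> A" "x \<in> cimage ch"
    show "assoc_F \<alpha> \<omega> ch x = fundamental_form J g ch x" by (rule S(13)[OF c, symmetric])
    show "assoc_F \<alpha> \<omega> ch x \<odot> assoc_Psi \<alpha> \<Omega> ch x = 0"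
      unfolding at by (rule alg(1)[OF c c c c c])
    show "(4/3) \<cdot> (assoc_F \<alpha> \<omega> ch x \<odot> assoc_F \<alpha> \<omega> ch x \<odot> assoc_F \<alpha> \<omega> ch x) =
        \<i> \<cdot> (assoc_Psi \<alpha> \<Omega> ch x \<odot> fcnj (assoc_Psi \<alpha> \<Omega>) ch x)"
      unfolding at by (rule alg(3)[OF c c c c c])
    show "assoc_Psi \<alpha> \<Omega> ch x \<odot> fcnj (assoc_Psi \<alpha> \<Omega>) ch x \<noteq> 0"
      unfolding at by (rule nz[OF c])
  qed
qed

section \<open>Half-flatness and the SUSY equations\<close>

lemma ext_d_cong:
  assumes M: "smooth_manifold6 X A" and eq: "form_eq A a b"
  shows "form_eq A (ext_d a) (ext_d b)"
  unfolding form_eq_def ext_d_at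
proof (intro ballI)
  fix c x assume c: "c \<in> A" "x \<in> cimage c"
  show "extd (a c) x = extd (b c) x"
    using eq c(1) unfolding form_eq_def by (intro extd_cong_open[OF open_cimage[OF M c(1)] c(2)]) blast
qed

lemma form_eq_sym: "form_eq A a b \<Longrightarrow> form_eq A b a"
  by (simp add: form_eq_def)

lemma form_eq_trans: "form_eq A a b \<Longrightarrow> form_eq A b c \<Longrightarrow> form_eq A a c"
  by (simp add: form_eq_def)

lemma form_eq_wedge: "form_eq A a b \<Longrightarrow> form_eq A a' b' \<Longrightarrow> form_eq A (a \<and>\<^sub>F a') (b \<and>\<^sub>F b')"
  by (simp add: form_eq_def fwedge_at)

lemma extd_square:
  assumes "coeffs_diff f x" "homogeneous 2 (f x)"
  shows "extd (\<lambda>y. f y \<odot> f y) x = 2 \<cdot> (f x \<odot> extd f x)"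
proof -
  have "even (2::nat)" by simp
  note comm = even_homogeneous[OF assms(2) this]
  have gi: "grade_inv (f x) = f x" using homogeneous_grade_inv[OF assms(2)] by (simp add: scale_form_def)
  show ?thesis
    unfolding extd_shuffle_prod[OF assms(1,1)] gi comm[of "extd f x", symmetric]
    by (simp add: scale_form_def fun_eq_iff)
qed

lemma extd_closed_shuffle_prod:
  assumes "coeffs_diff a x" "coeffs_diff f x" "homogeneous 1 (a x)" "extd a x = 0"
  shows "extd (\<lambda>y. a y \<odot> f y) x = (- 1) \<cdot> (a x \<odot> extd f x)"
  using homogeneous_grade_inv[OF assms(3)]
  by (simp only: extd_shuffle_prod[OF assms(1,2)] assms(4) shuffle_prod_zero_left add_0_left
      power_one_right shuffle_prod_scale_left)

text \<open>
  Let \<open>\<alpha> = a + i b\<close> be closed.  Then \<open>d(w + k a \<and> b) = dw\<close>, so by \<open>w\<^sup>2 = I\<^sup>2\<close> half of the derivative of the square of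
  \<open>w + k a \<and> b\<close> is \<open>I \<and> dI + k a \<and> b \<and> dw\<close>: the last SUSY equation.  The derivatives of the two 3-forms
  are \<open>- k a \<and> dr + b \<and> dI\<close> and \<open>- k b \<and> dr - a \<and> dI\<close>: the two equations for \<open>b \<and> H\<close> and \<open>a \<and> H\<close>.
\<close>

lemma susy_IIB_equations_iff:
  fixes \<alpha> w r I :: "'m dform"
  assumes M: "smooth_manifold6 X A" and ks: "k > 0" "s > 0"
    and diff: "diff_form A 1 \<alpha>" "diff_form A 2 w" "diff_form A 2 r" "diff_form A 2 I"
    and par: "form_eq A R_par (complex_of_real s *\<^sub>F w)" and perp: "form_eq A R_perp (complex_of_real k *\<^sub>F r)"
    and ww: "form_eq A (w \<and>\<^sub>F w) (I \<and>\<^sub>F I)"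
    and closed: "form_eq A (ext_d (fRe \<alpha>)) 0" "form_eq A (ext_d (fIm \<alpha>)) 0"
  shows "susy_IIB_equations A k s \<alpha> R_par R_perp I \<longleftrightarrow>
    form_eq A (ext_d ((w + complex_of_real k *\<^sub>F (fRe \<alpha> \<and>\<^sub>F fIm \<alpha>)) \<and>\<^sub>F
      (w + complex_of_real k *\<^sub>F (fRe \<alpha> \<and>\<^sub>F fIm \<alpha>)))) 0 \<and>
    form_eq A (ext_d (complex_of_real k *\<^sub>F (fRe \<alpha> \<and>\<^sub>F r) + (- 1) *\<^sub>F (fIm \<alpha> \<and>\<^sub>F I))) 0 \<and>
    form_eq A (ext_d (complex_of_real k *\<^sub>F (fIm \<alpha> \<and>\<^sub>F r) + fRe \<alpha> \<and>\<^sub>F I)) 0"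
    (is "?susy \<longleftrightarrow> form_eq A (ext_d ?FF) 0 \<and> form_eq A (ext_d ?P1) 0 \<and> form_eq A (ext_d ?P2) 0")
proof -
  let ?a = "fRe \<alpha>" and ?b = "fIm \<alpha>" and ?k = "complex_of_real k" and ?s = "complex_of_real s"
  have dab: "diff_form A 1 ?a" "diff_form A 1 ?b" by (intro diff_form_Re[OF M] diff_form_Im[OF M] diff)+
  define S1 where "S1 c x \<longleftrightarrow> I c x \<odot> ext_d I c x + ?k \<cdot> (?a c x \<odot> ?b c x \<odot> ext_d w c x) = 0" for c x
  define S2 where "S2 c x \<longleftrightarrow> ?b c x \<odot> ext_d I c x = ?k \<cdot> (?a c x \<odot> ext_d r c x)" for c x
  define S3 where "S3 c x \<longleftrightarrow> ?a c x \<odot> ext_d I c x = - (?k \<cdot> (?b c x \<odot> ext_d r c x))" for c x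
  have hom: "homogeneous n (f ch x)" if "diff_form A n f" "ch \<in> A" "x \<in> cimage ch"
    for n and f :: "'m dform" and ch x
    using diff_formD(1)[OF that] unfolding alternating_form_iff by blast
  have half_flat: "ext_d ?FF c x = 0 \<longleftrightarrow> S1 c x" "ext_d ?P1 c x = 0 \<longleftrightarrow> S2 c x" "ext_d ?P2 c x = 0 \<longleftrightarrow> S3 c x"
    if c: "c \<in> A" "x \<in> cimage c" for c x
  proof -
    note cd = diff_form_coeffs_diff[OF _ c]
    note cds = cd[OF dab(1)] cd[OF dab(2)] cd[OF diff(2)] cd[OF diff(3)] cd[OF diff(4)]
    have da: "extd (?a c) x = 0" "extd (?b c) x = 0"
      using closed c unfolding form_eq_zero ext_d_at by blast+
    note ha = hom[OF dab(1) c] and hb = hom[OF dab(2) c]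
    have dP: "extd (\<lambda>y. ?a c y \<odot> f y) x = (- 1) \<cdot> (?a c x \<odot> extd f x)"
      "extd (\<lambda>y. ?b c y \<odot> f y) x = (- 1) \<cdot> (?b c x \<odot> extd f x)" if "coeffs_diff f x" for f
      by (intro extd_closed_shuffle_prod cds that ha hb da)+
    have P1: "?P1 c = (\<lambda>y. ?k \<cdot> (?a c y \<odot> r c y) + (- 1) \<cdot> (?b c y \<odot> I c y))"
      and P2: "?P2 c = (\<lambda>y. ?k \<cdot> (?b c y \<odot> r c y) + ?a c y \<odot> I c y)"
      by (simp_all add: fun_eq_iff fwedge_at fscale_at)
    note cd' = coeffs_diff_shuffle_prod coeffs_diff_scale cds
    have "ext_d ?P1 c x = ?k \<cdot> extd (\<lambda>y. ?a c y \<odot> r c y) x + (- 1) \<cdot> extd (\<lambda>y. ?b c y \<odot> I c y) x"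
      unfolding ext_d_at P1 by (simp add: extd_add extd_scale cd')
    then show "ext_d ?P1 c x = 0 \<longleftrightarrow> S2 c x"
      unfolding S2_def ext_d_at[of r] ext_d_at[of I] dP(1)[OF cds(4)] dP(2)[OF cds(5)]
      by (simp add: scale_form_def fun_eq_iff add_eq_0_iff)
    have "ext_d ?P2 c x = ?k \<cdot> extd (\<lambda>y. ?b c y \<odot> r c y) x + extd (\<lambda>y. ?a c y \<odot> I c y) x"
      unfolding ext_d_at P2 by (simp add: extd_add extd_scale cd')
    then show "ext_d ?P2 c x = 0 \<longleftrightarrow> S3 c x"
      unfolding S3_def ext_d_at[of r] ext_d_at[of I] dP(2)[OF cds(4)] dP(1)[OF cds(5)]
      by (auto simp add: scale_form_def fun_eq_iff add_eq_0_iff)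
    define F where "F y = w c y + ?k \<cdot> (?a c y \<odot> ?b c y)" for y
    have cdF: "coeffs_diff F x" unfolding F_def by (intro coeffs_diff_add cd')
    have dF: "extd F x = extd (w c) x"
      unfolding F_def by (simp add: extd_add extd_scale cd' dP(1) da) (simp add: scale_form_def fun_eq_iff)
    have hab: "homogeneous 2 (?a c x \<odot> ?b c x)"
      using homogeneous_shuffle_prod[OF ha hb] by (simp add: numeral_2_eq_2)
    have hF: "homogeneous 2 (F x)"
      using hom[OF diff(2) c] hab unfolding F_def homogeneous_def by (simp add: scale_form_def)
    have "ext_d ?FF c x = extd (\<lambda>y. F y \<odot> F y) x"
      unfolding ext_d_at by (rule arg_cong[where f="\<lambda>f. extd f x"]) (simp add: fun_eq_iff F_def fwedge_at fscale_at)
    also have "\<dots> = 2 \<cdot> (w c x \<odot> extd (w c) x + ?k \<cdot> (?a c x \<odot> ?b c x \<odot> extd (w c) x))"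
      unfolding extd_square[OF cdF hF] dF
      by (simp add: F_def shuffle_prod_add_left shuffle_prod_scale_left shuffle_prod_assoc)
    finally have FF: "ext_d ?FF c x = 2 \<cdot> (w c x \<odot> extd (w c) x + ?k \<cdot> (?a c x \<odot> ?b c x \<odot> extd (w c) x))" .
    have "extd (\<lambda>y. w c y \<odot> w c y) x = extd (\<lambda>y. I c y \<odot> I c y) x"
      using ww c unfolding form_eq_def fwedge_at
      by (intro extd_cong_open[OF open_cimage[OF M c(1)] c(2)]) blast
    then have "w c x \<odot> extd (w c) x = I c x \<odot> extd (I c) x"
      unfolding extd_square[OF cds(3) hom[OF diff(2) c]] extd_square[OF cds(5) hom[OF diff(4) c]]
      by (simp add: scale_form_def fun_eq_iff)
    then show "ext_d ?FF c x = 0 \<longleftrightarrow> S1 c x"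
      unfolding S1_def FF ext_d_at[of w] ext_d_at[of I]
      by (simp add: scale_form_def fun_eq_iff del: distrib_left_numeral)
  qed
  have dR: "ext_d R_par c x = ?s \<cdot> ext_d w c x" "ext_d R_perp c x = ?k \<cdot> ext_d r c x"
    if c: "c \<in> A" "x \<in> cimage c" for c x
  proof -
    note cd = diff_form_coeffs_diff[OF _ c]
    have "(z *\<^sub>F f) c = (\<lambda>y. z \<cdot> f c y)" for z and f :: "'m dform" by (simp add: fun_eq_iff fscale_at)
    then have scale: "ext_d (z *\<^sub>F f) c x = z \<cdot> ext_d f c x" if "diff_form A n f" for z n and f :: "'m dform"
      unfolding ext_d_at by (simp add: extd_scale cd[OF that])
    have "ext_d R_par c x = ext_d (?s *\<^sub>F w) c x" "ext_d R_perp c x = ext_d (?k *\<^sub>F r) c x"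
      using ext_d_cong[OF M par] ext_d_cong[OF M perp] c unfolding form_eq_def by blast+
    then show "ext_d R_par c x = ?s \<cdot> ext_d w c x" "ext_d R_perp c x = ?k \<cdot> ext_d r c x"
      by (simp_all only: scale[OF diff(2)] scale[OF diff(3)])
  qed
  have pointwise: "(?a c x \<odot> H = of_real (- (s / k)) \<cdot> (?b c x \<odot> ext_d R_perp c x) \<longleftrightarrow> S3 c x) \<and>
      (?b c x \<odot> H = of_real (s / k) \<cdot> (?a c x \<odot> ext_d R_perp c x) \<longleftrightarrow> S2 c x) \<and>
      (?a c x \<odot> ?b c x \<odot> ext_d R_par c x = - (H \<odot> I c x) \<longleftrightarrow> S1 c x)"
    if c: "c \<in> A" "x \<in> cimage c" and H: "?k \<cdot> H = ?s \<cdot> ext_d I c x" for c x H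
  proof -
    define z where "z = ?s / ?k"
    have z: "z \<noteq> 0" "z * ?k = ?s" using ks by (simp_all add: z_def)
    have cancel: "z \<cdot> P = z \<cdot> Q \<longleftrightarrow> P = Q" for P Q :: "(real^6) list \<Rightarrow> complex"
      using z(1) by (simp add: scale_form_def fun_eq_iff)
    have neg: "- (z \<cdot> P) = z \<cdot> (- P)" "(- z) \<cdot> P = z \<cdot> (- P)" for P :: "(real^6) list \<Rightarrow> complex"
      by (simp_all add: scale_form_def fun_eq_iff)
    have H': "H = z \<cdot> ext_d I c x"
    proof
      show "H vs = (z \<cdot> ext_d I c x) vs" for vs
        using fun_cong[OF H, of vs] ks by (simp add: z_def scale_form_def field_simps)
    qed
    have sz: "?s \<cdot> P = z \<cdot> (?k \<cdot> P)" for P :: "(real^6) list \<Rightarrow> complex"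
      unfolding z(2)[symmetric] by (simp add: scale_form_def mult.assoc)
    have "even (2::nat)" by simp
    note comm = even_homogeneous[OF hom[OF diff(4) c] this, of "ext_d I c x"]
    have coeff: "of_real (- (s / k)) = - z" "of_real (s / k) = z" by (simp_all add: z_def)
    have "?k \<cdot> T = - U \<longleftrightarrow> U + ?k \<cdot> T = 0" for T U :: "(real^6) list \<Rightarrow> complex"
      by (simp only: eq_neg_iff_add_eq_0 add.commute)
    then show ?thesis
      unfolding H' dR[OF c] S1_def S2_def S3_def shuffle_prod_scale_left shuffle_prod_scale_right comm
        coeff neg sz cancel by blast
  qed
  have "?susy \<longleftrightarrow> (\<forall>c\<in>A. \<forall>x\<in>cimage c. S1 c x \<and> S2 c x \<and> S3 c x)"
  proof
    assume ?susy
    then obtain H where H: "form_eq A (?k *\<^sub>F H) (?s *\<^sub>F ext_d I)"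
      "form_eq A (?a \<and>\<^sub>F H) (of_real (- (s / k)) *\<^sub>F (?b \<and>\<^sub>F ext_d R_perp))"
      "form_eq A (?b \<and>\<^sub>F H) (of_real (s / k) *\<^sub>F (?a \<and>\<^sub>F ext_d R_perp))"
      "form_eq A (?a \<and>\<^sub>F ?b \<and>\<^sub>F ext_d R_par) (- (H \<and>\<^sub>F I))"
      unfolding susy_IIB_equations_def by blast
    show "\<forall>c\<in>A. \<forall>x\<in>cimage c. S1 c x \<and> S2 c x \<and> S3 c x"
    proof (intro ballI)
      fix c x assume c: "c \<in> A" "x \<in> cimage c"
      have "(- (H \<and>\<^sub>F I)) c x = - (H c x \<odot> I c x)" by (simp add: fwedge_at fun_eq_iff)
      then have "?a c x \<odot> ?b c x \<odot> ext_d R_par c x = - (H c x \<odot> I c x)"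
        using H(4) c unfolding form_eq_def fwedge_at by (simp only:)
      moreover have "?k \<cdot> H c x = ?s \<cdot> ext_d I c x"
        "?a c x \<odot> H c x = of_real (- (s / k)) \<cdot> (?b c x \<odot> ext_d R_perp c x)"
        "?b c x \<odot> H c x = of_real (s / k) \<cdot> (?a c x \<odot> ext_d R_perp c x)"
        using H(1-3) c unfolding form_eq_def fwedge_at fscale_at by blast+
      ultimately show "S1 c x \<and> S2 c x \<and> S3 c x" using pointwise[OF c] by blast
    qed
  next
    assume S: "\<forall>c\<in>A. \<forall>x\<in>cimage c. S1 c x \<and> S2 c x \<and> S3 c x"
    let ?H = "(?s / ?k) *\<^sub>F ext_d I"
    have H: "?k \<cdot> ?H c x = ?s \<cdot> ext_d I c x" for c x
      using ks by (simp add: fscale_def scale_form_def fun_eq_iff)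
    have "(- (?H \<and>\<^sub>F I)) c x = - (?H c x \<odot> I c x)" for c x by (simp add: fwedge_at fun_eq_iff)
    then have "form_eq A (?a \<and>\<^sub>F ?b \<and>\<^sub>F ext_d R_par) (- (?H \<and>\<^sub>F I))"
      using pointwise[OF _ _ H] S unfolding form_eq_def fwedge_at[of ?a] fwedge_at[of ?b] by simp
    moreover have "form_eq A (?k *\<^sub>F ?H) (?s *\<^sub>F ext_d I)"
      unfolding form_eq_def fscale_at using H unfolding fscale_at by blast
    moreover have "form_eq A (?a \<and>\<^sub>F ?H) (of_real (- (s / k)) *\<^sub>F (?b \<and>\<^sub>F ext_d R_perp))"
      "form_eq A (?b \<and>\<^sub>F ?H) (of_real (s / k) *\<^sub>F (?a \<and>\<^sub>F ext_d R_perp))"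
      unfolding form_eq_def fwedge_at fscale_at[of _ "_ \<and>\<^sub>F _"]
      using pointwise[OF _ _ H] S by blast+
    ultimately show ?susy
      using closed unfolding susy_IIB_equations_def by blast
  qed
  then show ?thesis unfolding form_eq_zero using half_flat by blast
qed

lemma shuffle_prod_real:
  assumes "\<And>vs. a vs \<in> \<real>" "\<And>vs. b vs \<in> \<real>" shows "(a \<odot> b) vs \<in> \<real>"
proof -
  have "cnj \<circ> a = a" "cnj \<circ> b = b" using assms by (simp_all add: fun_eq_iff Reals_cnj_iff)
  then show ?thesis by (simp add: Reals_cnj_iff cnj_shuffle_prod)
qed

text \<open>
  The parameters \<open>(p, q) = (k, 1)\<close> for the coframe \<open>(a, b)\<close> and \<open>(k, -1)\<close> for \<open>(b, a)\<close> give the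
  two hatted 1-forms.  Both lead to the same fundamental form, since \<open>b \<and> a = - a \<and> b\<close>.
\<close>

lemma squashed_frame_forms:
  fixes p q :: real
  assumes hom: "homogeneous 1 a" "homogeneous 1 b"
    and real: "\<And>vs. a vs \<in> \<real>" "\<And>vs. b vs \<in> \<real>" "\<And>vs. r vs \<in> \<real>" "\<And>vs. i vs \<in> \<real>"
    and f: "f = of_real p \<cdot> a + (\<i> * of_real q) \<cdot> b" and Z: "Z = r + \<i> \<cdot> i"
  shows "(\<i>/2) \<cdot> (f \<odot> (cnj \<circ> f)) = of_real (p * q) \<cdot> (a \<odot> b)"
    and "of_real (Re ((f \<odot> Z) vs)) = (of_real p \<cdot> (a \<odot> r) - of_real q \<cdot> (b \<odot> i)) vs"
proof -
  have cf: "cnj \<circ> f = of_real p \<cdot> a - (\<i> * of_real q) \<cdot> b"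
    using real(1,2) by (simp add: f fun_eq_iff scale_form_def Reals_cnj_iff)
  show "(\<i>/2) \<cdot> (f \<odot> (cnj \<circ> f)) = of_real (p * q) \<cdot> (a \<odot> b)"
    unfolding cf unfolding f shuffle_prod_bilinear odd_square_zero[OF hom(1)] odd_square_zero[OF hom(2)]
      odd_anticommute[OF hom]
    by (simp add: scale_form_def fun_eq_iff algebra_simps)
  have fZ: "(f \<odot> Z) vs = (of_real p * (a \<odot> r) vs - of_real q * (b \<odot> i) vs)
      + \<i> * (of_real p * (a \<odot> i) vs + of_real q * (b \<odot> r) vs)"
    unfolding f Z shuffle_prod_bilinear by (simp add: scale_form_def algebra_simps)
  have im: "Im ((a \<odot> r) vs) = 0" "Im ((b \<odot> i) vs) = 0" "Im ((a \<odot> i) vs) = 0" "Im ((b \<odot> r) vs) = 0"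
    using shuffle_prod_real[OF real(1,3)] shuffle_prod_real[OF real(2,4)] shuffle_prod_real[OF real(1,4)]
      shuffle_prod_real[OF real(2,3)] by (simp_all add: complex_is_Real_iff)
  show "of_real (Re ((f \<odot> Z) vs)) = (of_real p \<cdot> (a \<odot> r) - of_real q \<cdot> (b \<odot> i)) vs"
    unfolding fZ by (simp add: complex_eq_iff im scale_form_def)
qed

lemma half_flat_su2_iff:
  assumes "smooth_manifold6 X A"
  shows "half_flat_su2 A J g \<alpha> \<omega> \<Omega> \<longleftrightarrow> su2_structure A J g \<alpha> \<omega> \<Omega> \<and>
    form_eq A (ext_d (assoc_F \<alpha> \<omega> \<and>\<^sub>F assoc_F \<alpha> \<omega>)) 0 \<and> form_eq A (ext_d (fRe (assoc_Psi \<alpha> \<Omega>))) 0"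
  using su2_structure_imp_su3_structure[OF assms] unfolding half_flat_su2_def half_flat_su3_def by blast

lemma closed_cong:
  assumes "smooth_manifold6 X A" "form_eq A a b"
  shows "form_eq A (ext_d a) 0 \<longleftrightarrow> form_eq A (ext_d b) 0"
  using ext_d_cong[OF assms] form_eq_sym form_eq_trans by blast

text \<open>
  The two half-flat structures share \<open>F\<close>, so together they impose three equations on the derivatives, and these
  are the three SUSY equations on derivatives of 2-forms.
\<close>

lemma susy_iff_half_flat_pair:
  fixes \<alpha> w r I :: "'m dform"
  assumes M: "smooth_manifold6 X A" and ks: "k > 0" "s > 0"
    and diff: "diff_form A 1 \<alpha>" "diff_form A 2 w" "diff_form A 2 r" "diff_form A 2 I"
    and real: "real_form A r" "real_form A I"
    and \<alpha>1: "form_eq A \<alpha>1 (complex_of_real k *\<^sub>F fRe \<alpha> + \<i> *\<^sub>F fIm \<alpha>)"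
    and \<alpha>2: "form_eq A \<alpha>2 (complex_of_real k *\<^sub>F fIm \<alpha> - \<i> *\<^sub>F fRe \<alpha>)"
    and \<Omega>: "form_eq A \<Omega> (r + \<i> *\<^sub>F I)"
    and su2: "su2_structure A J1 g1 \<alpha>1 w \<Omega>" "su2_structure A J2 g2 \<alpha>2 w \<Omega>"
    and par: "form_eq A R_par (complex_of_real s *\<^sub>F w)" and perp: "form_eq A R_perp (complex_of_real k *\<^sub>F r)"
    and closed: "form_eq A (ext_d (fRe \<alpha>)) 0" "form_eq A (ext_d (fIm \<alpha>)) 0"
  shows "susy_IIB_equations A k s \<alpha> R_par R_perp I \<longleftrightarrow>
    half_flat_su2 A J1 g1 \<alpha>1 w \<Omega> \<and> half_flat_su2 A J2 g2 \<alpha>2 w \<Omega>"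
proof -
  let ?a = "fRe \<alpha>" and ?b = "fIm \<alpha>" and ?k = "complex_of_real k"
  have dab: "diff_form A 1 ?a" "diff_form A 1 ?b" by (intro diff_form_Re[OF M] diff_form_Im[OF M] diff)+
  have hom: "homogeneous n (f ch x)" if "diff_form A n f" "ch \<in> A" "x \<in> cimage ch"
    for n and f :: "'m dform" and ch x
    using diff_formD(1)[OF that] unfolding alternating_form_iff by blast
  have re: "?a c x vs \<in> \<real>" "?b c x vs \<in> \<real>" for c x vs by (simp_all add: fRe_def fIm_def)
  have \<Omega>_at: "\<Omega> c x = r c x + \<i> \<cdot> I c x" if "c \<in> A" "x \<in> cimage c" for c x
    using \<Omega> that unfolding form_eq_def by (simp add: fscale_at)
  have real_at: "r c x vs \<in> \<real>" "I c x vs \<in> \<real>" if "c \<in> A" "x \<in> cimage c" for c x vs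
    using real that unfolding real_form_def by blast+
  \<comment> \<open>The trivial rotation in the rotation lemma yields \<open>I\<^sup>2 = w\<^sup>2\<close>.\<close>
  have ww: "form_eq A (w \<and>\<^sub>F w) (I \<and>\<^sub>F I)"
    unfolding form_eq_def fwedge_at
  proof (intro ballI)
    fix c x assume c: "c \<in> A" "x \<in> cimage c"
    note S = su2_structureD[OF su2(1)]
    have d\<Omega>: "diff_form A 2 \<Omega>" using S(6) unfolding form_type_def by blast
    have wr: "w c x vs \<in> \<real>" for vs using S(5) c unfolding real_form_def by blast
    have "I c x = (\<lambda>vs. complex_of_real (Im (\<Omega> c x vs)))"
      unfolding \<Omega>_at[OF c] using real_at[OF c]
      by (simp add: fun_eq_iff scale_form_def complex_is_Real_iff complex_eq_iff)
    then show "w c x \<odot> w c x = I c x \<odot> I c x"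
      using rotate_pair(5)[OF hom[OF diff(2) c] hom[OF d\<Omega> c] wr S(7,9,10)[OF c], of 1 0] by simp
  qed
  have at: "assoc_F f w c x = w c x + (\<i>/2) \<cdot> (f c x \<odot> (cnj \<circ> f c x))"
    "fRe (assoc_Psi f \<Omega>) c x vs = complex_of_real (Re ((f c x \<odot> \<Omega> c x) vs))" for f c x vs
    by (simp_all add: assoc_F_def assoc_Psi_def fwedge_at fscale_at fcnj_def o_def fRe_def)
  let ?F = "w + ?k *\<^sub>F (?a \<and>\<^sub>F ?b)"
  let ?P1 = "?k *\<^sub>F (?a \<and>\<^sub>F r) + (- 1) *\<^sub>F (?b \<and>\<^sub>F I)" and ?P2 = "?k *\<^sub>F (?b \<and>\<^sub>F r) + ?a \<and>\<^sub>F I"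
  have "assoc_F \<alpha>1 w c x = ?F c x \<and> fRe (assoc_Psi \<alpha>1 \<Omega>) c x = ?P1 c x \<and>
      assoc_F \<alpha>2 w c x = ?F c x \<and> fRe (assoc_Psi \<alpha>2 \<Omega>) c x = ?P2 c x"
    if c: "c \<in> A" "x \<in> cimage c" for c x
  proof -
    note ha = hom[OF dab(1) c] and hb = hom[OF dab(2) c]
    have 1: "\<alpha>1 c x = of_real k \<cdot> ?a c x + (\<i> * of_real 1) \<cdot> ?b c x"
      using \<alpha>1 c unfolding form_eq_def by (simp add: fscale_at)
    have "\<alpha>2 c x = (?k *\<^sub>F ?b - \<i> *\<^sub>F ?a) c x" using \<alpha>2 c unfolding form_eq_def by blast
    then have 2: "\<alpha>2 c x = of_real k \<cdot> ?b c x + (\<i> * of_real (- 1)) \<cdot> ?a c x"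
      by (simp add: fscale_at scale_form_def fun_eq_iff)
    note sq1 = squashed_frame_forms[OF ha hb re real_at[OF c] 1 \<Omega>_at[OF c]]
    note sq2 = squashed_frame_forms[OF hb ha re(2,1) real_at[OF c] 2 \<Omega>_at[OF c]]
    have "assoc_F \<alpha>1 w c x = ?F c x" unfolding at(1) sq1(1) by (simp add: fscale_at fwedge_at)
    moreover have "assoc_F \<alpha>2 w c x = ?F c x"
      unfolding at(1) sq2(1) odd_anticommute[OF ha hb] by (simp add: fscale_at fwedge_at scale_form_def fun_eq_iff)
    moreover have "fRe (assoc_Psi \<alpha>1 \<Omega>) c x vs = ?P1 c x vs" for vs
      unfolding at(2) sq1(2) by (simp add: fscale_at fwedge_at scale_form_def)
    moreover have "fRe (assoc_Psi \<alpha>2 \<Omega>) c x vs = ?P2 c x vs" for vs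
      unfolding at(2) sq2(2) by (simp add: fscale_at fwedge_at scale_form_def)
    ultimately show ?thesis by blast
  qed
  then have eq: "form_eq A (assoc_F \<alpha>1 w) ?F" "form_eq A (fRe (assoc_Psi \<alpha>1 \<Omega>)) ?P1"
    "form_eq A (assoc_F \<alpha>2 w) ?F" "form_eq A (fRe (assoc_Psi \<alpha>2 \<Omega>)) ?P2"
    unfolding form_eq_def by blast+
  show ?thesis
    unfolding susy_IIB_equations_iff[OF M ks diff par perp ww closed] half_flat_su2_iff[OF M]
      closed_cong[OF M form_eq_wedge[OF eq(1,1)]] closed_cong[OF M form_eq_wedge[OF eq(3,3)]]
      closed_cong[OF M eq(2)] closed_cong[OF M eq(4)]
    using su2 by blast
qed

section \<open>The correspondence\<close>

lemma proj_angle_cos_sin: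
  assumes "k \<in> {0<..<1}" "s \<in> {0<..<1}" "k\<^sup>2 + s\<^sup>2 = 1"
  shows "cos (proj_angle k s) = k" "sin (proj_angle k s) = s"
proof -
  let ?P = "\<lambda>\<phi>. 0 < \<phi> \<and> \<phi> < pi / 2 \<and> k = cos \<phi> \<and> s = sin \<phi>"
  have "1 - k\<^sup>2 = s\<^sup>2" using assms(3) by simp
  then have s: "s = sqrt (1 - k\<^sup>2)" using assms(2) by (simp only: real_sqrt_abs) simp
  have "?P (arccos k)"
    using assms arccos_less_arccos[of 0 k] arccos_less_arccos[of k 1] by (simp add: s sin_arccos)
  moreover have "\<phi> = arccos k" if "?P \<phi>" for \<phi> using that by (simp add: arccos_cos)
  ultimately have "?P (proj_angle k s)" unfolding proj_angle_def by (rule theI)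
  then show "cos (proj_angle k s) = k" "sin (proj_angle k s) = s" by simp_all
qed

lemma ReOmega_eq:
  assumes "k \<in> {0<..<1}" "s \<in> {0<..<1}" "k\<^sup>2 + s\<^sup>2 = 1"
  shows "ReOmega_par k s \<omega> \<Omega> =
      complex_of_real s *\<^sub>F (complex_of_real k *\<^sub>F \<omega> + complex_of_real s *\<^sub>F fRe \<Omega>)"
    and "ReOmega_perp k s \<omega> \<Omega> =
      complex_of_real k *\<^sub>F (complex_of_real k *\<^sub>F fRe \<Omega> - complex_of_real s *\<^sub>F \<omega>)"
proof -
  let ?\<phi> = "proj_angle k s"
  note cs = proj_angle_cos_sin[OF assms]
  have "1 - cos (2 * ?\<phi>) = 2 * s\<^sup>2" "1 + cos (2 * ?\<phi>) = 2 * k\<^sup>2" "sin (2 * ?\<phi>) = 2 * s * k"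
    using assms(3) by (simp_all add: cos_double sin_double cs)
  then show "ReOmega_par k s \<omega> \<Omega> =
      complex_of_real s *\<^sub>F (complex_of_real k *\<^sub>F \<omega> + complex_of_real s *\<^sub>F fRe \<Omega>)"
    "ReOmega_perp k s \<omega> \<Omega> =
      complex_of_real k *\<^sub>F (complex_of_real k *\<^sub>F fRe \<Omega> - complex_of_real s *\<^sub>F \<omega>)"
    by (simp_all only: ReOmega_par_def ReOmega_perp_def Let_def)
      (simp_all add: fscale_def fun_eq_iff power2_eq_square algebra_simps)
qed

lemma ext_d_add_scale:
  fixes a b :: "'m dform"
  assumes M: "smooth_manifold6 X A" and d: "diff_form A n a" "diff_form A n b"
    and closed: "form_eq A (ext_d a) 0" "form_eq A (ext_d b) 0"
  shows "form_eq A (ext_d (y *\<^sub>F a + z *\<^sub>F b)) 0"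
  unfolding form_eq_zero ext_d_at
proof (intro ballI)
  fix c x assume c: "c \<in> A" "x \<in> cimage c"
  note cd = diff_form_coeffs_diff[OF d(1) c] diff_form_coeffs_diff[OF d(2) c]
  have "(y *\<^sub>F a + z *\<^sub>F b) c = (\<lambda>x. y \<cdot> a c x + z \<cdot> b c x)" by (simp add: fun_eq_iff fscale_at)
  moreover have "extd (a c) x = 0" "extd (b c) x = 0"
    using closed c unfolding form_eq_zero ext_d_at by blast+
  ultimately show "extd ((y *\<^sub>F a + z *\<^sub>F b) c) x = 0"
    by (simp add: extd_add extd_scale coeffs_diff_scale cd) (simp add: scale_form_def fun_eq_iff)
qed

lemma closed_Re_Im:
  assumes M: "smooth_manifold6 X A" and d: "diff_form A n a" and closed: "form_eq A (ext_d a) 0"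
  shows "form_eq A (ext_d (fRe a)) 0" "form_eq A (ext_d (fIm a)) 0"
proof -
  note blR = bounded_linear_compose[OF bounded_linear_of_real bounded_linear_Re, where ?'a1=complex]
    and blI = bounded_linear_compose[OF bounded_linear_of_real bounded_linear_Im, where ?'a1=complex]
  have "ext_d (fRe a) c x = 0 \<and> ext_d (fIm a) c x = 0" if c: "c \<in> A" "x \<in> cimage c" for c x
  proof -
    note cd = diff_form_coeffs_diff[OF d c]
    have "extd (a c) x = 0" using closed c unfolding form_eq_zero ext_d_at by blast
    then show ?thesis
      unfolding ext_d_at fRe_def fIm_def extd_bounded_linear[OF blR cd] extd_bounded_linear[OF blI cd]
      by (simp add: fun_eq_iff)
  qed
  then show "form_eq A (ext_d (fRe a)) 0" "form_eq A (ext_d (fIm a)) 0" unfolding form_eq_zero by blast+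
qed

lemma susy_gives_half_flat_pair:
  fixes \<alpha> \<omega> \<Omega> :: "'m dform"
  assumes M: "smooth_manifold6 X A" and k: "k \<in> {0<..<1}" and s: "s \<in> {0<..<1}" and ks: "k\<^sup>2 + s\<^sup>2 = 1"
    and su2: "su2_structure A J g \<alpha> \<omega> \<Omega>"
    and susy: "susy_IIB_equations A k s \<alpha> (ReOmega_par k s \<omega> \<Omega>) (ReOmega_perp k s \<omega> \<Omega>) (fIm \<Omega>)"
  defines "\<alpha>1 \<equiv> complex_of_real k *\<^sub>F fRe \<alpha> + \<i> *\<^sub>F fIm \<alpha>"
    and "\<alpha>2 \<equiv> complex_of_real k *\<^sub>F fIm \<alpha> - \<i> *\<^sub>F fRe \<alpha>"
    and "w \<equiv> complex_of_real (1 / s) *\<^sub>F ReOmega_par k s \<omega> \<Omega>"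
    and "Z \<equiv> complex_of_real (1 / k) *\<^sub>F ReOmega_perp k s \<omega> \<Omega> + \<i> *\<^sub>F fIm \<Omega>"
  shows "(\<exists>J1 g1. half_flat_su2 A J1 g1 \<alpha>1 w Z) \<and> (\<exists>J2 g2. half_flat_su2 A J2 g2 \<alpha>2 w Z)"
    and "form_eq A (ext_d \<alpha>1) 0" and "form_eq A \<alpha>2 (hat_alpha2 k \<alpha>1)"
proof -
  have pos: "k > 0" "s > 0" using k s by simp_all
  note S = su2_structureD[OF su2]
  have diff: "diff_form A 1 \<alpha>" "diff_form A 2 \<omega>" "diff_form A 2 \<Omega>"
    using S(2,4,6) unfolding form_type_def by blast+
  define r where "r = complex_of_real k *\<^sub>F fRe \<Omega> + complex_of_real (- s) *\<^sub>F \<omega>"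
  note closure = diff_form_add[OF M] diff_form_scale[OF M] diff_form_Re[OF M] diff_form_Im[OF M]
  note par = ReOmega_eq(1)[OF k s ks, of \<omega> \<Omega>] and perp = ReOmega_eq(2)[OF k s ks, of \<omega> \<Omega>]
  have w: "w = complex_of_real k *\<^sub>F \<omega> + complex_of_real s *\<^sub>F fRe \<Omega>"
    unfolding w_def par using pos by (simp add: fscale_def fun_eq_iff)
  have Z: "Z = r + \<i> *\<^sub>F fIm \<Omega>"
    unfolding Z_def perp r_def using pos by (simp add: fscale_def fun_eq_iff)
  have \<alpha>2: "\<alpha>2 = complex_of_real k *\<^sub>F fIm \<alpha> + (- \<i>) *\<^sub>F fRe \<alpha>"
    unfolding \<alpha>2_def by (simp add: fscale_def fun_eq_iff)
  have dw: "diff_form A 2 w" unfolding w by (intro closure diff)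
  have dr: "diff_form A 2 r" unfolding r_def by (intro closure diff)
  have dI: "diff_form A 2 (fIm \<Omega>)" by (intro closure diff)
  have dZ: "diff_form A 2 Z" unfolding Z by (intro closure dr dI)
  have d\<alpha>: "diff_form A 1 \<alpha>1" "diff_form A 1 \<alpha>2" unfolding \<alpha>1_def \<alpha>2 by (intro closure diff)+
  have Z': "form_eq A Z (complex_of_real k *\<^sub>F fRe \<Omega> - complex_of_real s *\<^sub>F \<omega> + \<i> *\<^sub>F fIm \<Omega>)"
    unfolding Z r_def by (simp add: form_eq_def fscale_def fun_eq_iff)
  have w': "form_eq A w (complex_of_real k *\<^sub>F \<omega> + complex_of_real s *\<^sub>F fRe \<Omega>)"
    unfolding w by (simp add: form_eq_def)
  have "form_eq A \<alpha>1 (complex_of_real k *\<^sub>F fRe \<alpha> + \<i> *\<^sub>F fIm \<alpha>)"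
    unfolding \<alpha>1_def by (simp add: form_eq_def)
  from su2_structure_squash_rotate[OF M su2 ks pos(1) d\<alpha>(1) dw dZ this w' Z']
  obtain J1 g1 where 1: "su2_structure A J1 g1 \<alpha>1 w Z" by blast
  \<comment> \<open>\<open>\<alpha>2\<close> arises from \<open>- i \<alpha>\<close>, whose real and imaginary parts are \<open>Im \<alpha>\<close> and \<open>- Re \<alpha>\<close>, as \<open>\<alpha>1\<close> does from \<open>\<alpha>\<close>.\<close>
  have "form_eq A \<alpha>2 (complex_of_real k *\<^sub>F fRe ((- \<i>) *\<^sub>F \<alpha>) + \<i> *\<^sub>F fIm ((- \<i>) *\<^sub>F \<alpha>))"
    unfolding \<alpha>2 by (simp add: form_eq_def fscale_def fRe_def fIm_def fun_eq_iff)
  from su2_structure_squash_rotate[OF M su2_structure_times_minus_i[OF M su2] ks pos(1) d\<alpha>(2) dw dZ this w' Z']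
  obtain J2 g2 where 2: "su2_structure A J2 g2 \<alpha>2 w Z" by blast
  have real: "real_form A r" "real_form A (fIm \<Omega>)"
    using S(5) unfolding real_form_def r_def by (simp_all add: fscale_def fRe_def fIm_def)
  have closed: "form_eq A (ext_d (fRe \<alpha>)) 0" "form_eq A (ext_d (fIm \<alpha>)) 0"
    using susy unfolding susy_IIB_equations_def by blast+
  have "form_eq A \<alpha>1 (complex_of_real k *\<^sub>F fRe \<alpha> + \<i> *\<^sub>F fIm \<alpha>)"
    "form_eq A \<alpha>2 (complex_of_real k *\<^sub>F fIm \<alpha> - \<i> *\<^sub>F fRe \<alpha>)" "form_eq A Z (r + \<i> *\<^sub>F fIm \<Omega>)"
    unfolding \<alpha>1_def \<alpha>2_def Z by (simp_all add: form_eq_def)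
  moreover have "form_eq A (ReOmega_par k s \<omega> \<Omega>) (complex_of_real s *\<^sub>F w)"
    "form_eq A (ReOmega_perp k s \<omega> \<Omega>) (complex_of_real k *\<^sub>F r)"
    unfolding par perp w r_def by (simp_all add: form_eq_def fscale_def fun_eq_iff)
  ultimately show "(\<exists>J1 g1. half_flat_su2 A J1 g1 \<alpha>1 w Z) \<and> (\<exists>J2 g2. half_flat_su2 A J2 g2 \<alpha>2 w Z)"
    using susy_iff_half_flat_pair[OF M pos diff(1) dw dr dI real _ _ _ 1 2 _ _ closed] susy by blast
  show "form_eq A (ext_d \<alpha>1) 0"
    unfolding \<alpha>1_def by (intro ext_d_add_scale[where n=1, OF M _ _ closed] closure diff)
  show "form_eq A \<alpha>2 (hat_alpha2 k \<alpha>1)"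
    using pos unfolding \<alpha>2_def \<alpha>1_def hat_alpha2_def
    by (simp add: form_eq_def fscale_def fRe_def fIm_def fun_eq_iff)
qed

text \<open>
  The structure behind the solution is the one obtained from \<open>(J1, g1, \<alpha>1, w, Z)\<close> by the inverse
  rotation and by stretching \<open>Re \<alpha>1\<close> by \<open>1 / k\<close>.
\<close>

lemma half_flat_pair_gives_susy:
  fixes \<alpha> \<alpha>1 w Z R_par R_perp I :: "'m dform"
  assumes M: "smooth_manifold6 X A" and k: "k \<in> {0<..<1}" and s_def: "s = sqrt (1 - k\<^sup>2)"
    and hf: "half_flat_su2 A J1 g1 \<alpha>1 w Z" "half_flat_su2 A J2 g2 (hat_alpha2 k \<alpha>1) w Z"
    and closed1: "form_eq A (ext_d \<alpha>1) 0"
    and d\<alpha>: "diff_form A 1 \<alpha>" and dI: "diff_form A 2 I"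
    and real: "real_form A R_perp" "real_form A I"
    and par: "form_eq A (complex_of_real (1 / s) *\<^sub>F R_par) w"
    and perp: "form_eq A (complex_of_real (1 / k) *\<^sub>F R_perp + \<i> *\<^sub>F I) Z"
    and \<alpha>: "form_eq A (complex_of_real k *\<^sub>F fRe \<alpha> + \<i> *\<^sub>F fIm \<alpha>) \<alpha>1"
  shows "susy_IIB_solution A k s \<alpha> R_par R_perp I"
proof -
  have "k\<^sup>2 < 1" using k by (simp add: power_less_one_iff)
  then have s: "s \<in> {0<..<1}" and ks: "k\<^sup>2 + s\<^sup>2 = 1" using k by (simp_all add: s_def)
  have pos: "k > 0" "s > 0" using k s by simp_all
  have su2: "su2_structure A J1 g1 \<alpha>1 w Z" "su2_structure A J2 g2 (hat_alpha2 k \<alpha>1) w Z"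
    using hf unfolding half_flat_su2_def by blast+
  note S = su2_structureD[OF su2(1)]
  have diff: "diff_form A 1 \<alpha>1" "diff_form A 2 w" "diff_form A 2 Z"
    using S(2,4,6) unfolding form_type_def by blast+
  note closure = diff_form_add[OF M] diff_form_scale[OF M] diff_form_Re[OF M] diff_form_Im[OF M]
  let ?r = "fRe Z"
  have at: "Re (\<alpha>1 c x vs) = k * Re (\<alpha> c x vs)" "Im (\<alpha>1 c x vs) = Im (\<alpha> c x vs)"
    "R_par c x vs = of_real s * w c x vs" "Re (Z c x vs) = Re (R_perp c x vs) / k" "Im (Z c x vs) = Re (I c x vs)"
    "Im (R_perp c x vs) = 0" "Im (I c x vs) = 0" "Im (w c x vs) = 0"
    if c: "c \<in> A" "x \<in> cimage c" for c x vs
  proof -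
    show r: "Im (R_perp c x vs) = 0" "Im (I c x vs) = 0" "Im (w c x vs) = 0"
      using real S(5) c unfolding real_form_def by (simp_all add: complex_is_Real_iff)
    have "\<alpha>1 c x = (complex_of_real k *\<^sub>F fRe \<alpha> + \<i> *\<^sub>F fIm \<alpha>) c x"
      and "w c x = (complex_of_real (1 / s) *\<^sub>F R_par) c x"
      and Z: "Z c x = (complex_of_real (1 / k) *\<^sub>F R_perp + \<i> *\<^sub>F I) c x"
      using \<alpha> par perp c unfolding form_eq_def by simp_all
    then show "Re (\<alpha>1 c x vs) = k * Re (\<alpha> c x vs)" "Im (\<alpha>1 c x vs) = Im (\<alpha> c x vs)"
      "R_par c x vs = of_real s * w c x vs"
      using pos by (simp_all add: fscale_def fRe_def fIm_def)
    show "Re (Z c x vs) = Re (R_perp c x vs) / k" "Im (Z c x vs) = Re (I c x vs)"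
      unfolding Z using r by (simp_all add: fscale_def)
  qed
  have "form_eq A (fRe \<alpha>) (complex_of_real (1 / k) *\<^sub>F fRe \<alpha>1)" "form_eq A (fIm \<alpha>) (fIm \<alpha>1)"
    using pos by (simp_all add: form_eq_def fscale_def fRe_def fIm_def fun_eq_iff at)
  moreover have "form_eq A (ext_d (complex_of_real (1 / k) *\<^sub>F fRe \<alpha>1 + 0 *\<^sub>F fIm \<alpha>1)) 0"
    by (intro ext_d_add_scale[where n=1, OF M _ _ closed_Re_Im[OF M diff(1) closed1]] closure diff)
  then have "form_eq A (ext_d (complex_of_real (1 / k) *\<^sub>F fRe \<alpha>1)) 0"
    by (simp add: fscale_def plus_fun_def)
  ultimately have closed: "form_eq A (ext_d (fRe \<alpha>)) 0" "form_eq A (ext_d (fIm \<alpha>)) 0"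
    using closed_cong[OF M] closed_Re_Im(2)[OF M diff(1) closed1] by blast+
  have real_r: "real_form A ?r" unfolding real_form_def by (simp add: fRe_def)
  have 1: "form_eq A \<alpha>1 (complex_of_real k *\<^sub>F fRe \<alpha> + \<i> *\<^sub>F fIm \<alpha>)"
    by (rule form_eq_sym[OF \<alpha>])
  have 2: "form_eq A (hat_alpha2 k \<alpha>1) (complex_of_real k *\<^sub>F fIm \<alpha> - \<i> *\<^sub>F fRe \<alpha>)"
    unfolding hat_alpha2_def using pos
    by (simp add: form_eq_def fscale_def fRe_def fIm_def fun_eq_iff at)
  have 3: "form_eq A Z (?r + \<i> *\<^sub>F I)"
    by (simp add: form_eq_def fscale_def fRe_def fun_eq_iff complex_eq_iff at)
  have 4: "form_eq A R_par (complex_of_real s *\<^sub>F w)" "form_eq A R_perp (complex_of_real k *\<^sub>F ?r)"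
    using pos by (simp_all add: form_eq_def fscale_def fRe_def fun_eq_iff complex_eq_iff at)
  have susy: "susy_IIB_equations A k s \<alpha> R_par R_perp I"
    using susy_iff_half_flat_pair[OF M pos d\<alpha> diff(2) diff_form_Re[OF M diff(3)] dI real_r real(2) 1 2 3 su2 4 closed]
      hf by blast
  define \<omega> where "\<omega> = complex_of_real k *\<^sub>F w + complex_of_real (- s) *\<^sub>F ?r"
  define \<Omega> where "\<Omega> = complex_of_real k *\<^sub>F ?r + complex_of_real s *\<^sub>F w + \<i> *\<^sub>F fIm Z"
  have d: "diff_form A 2 \<omega>" "diff_form A 2 \<Omega>" unfolding \<omega>_def \<Omega>_def by (intro closure diff)+
  have "form_eq A \<alpha> (complex_of_real (1 / k) *\<^sub>F fRe \<alpha>1 + \<i> *\<^sub>F fIm \<alpha>1)"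
    using pos by (simp add: form_eq_def fscale_def fRe_def fIm_def fun_eq_iff complex_eq_iff at)
  moreover have "form_eq A \<omega> (complex_of_real k *\<^sub>F w + complex_of_real (- s) *\<^sub>F fRe Z)"
    unfolding \<omega>_def by (simp add: form_eq_def)
  moreover have "form_eq A \<Omega> (complex_of_real k *\<^sub>F fRe Z - complex_of_real (- s) *\<^sub>F w + \<i> *\<^sub>F fIm Z)"
    unfolding \<Omega>_def by (simp add: form_eq_def fscale_def fun_eq_iff)
  ultimately obtain J g where Jg: "su2_structure A J g \<alpha> \<omega> \<Omega>"
    using su2_structure_squash_rotate[OF M su2(1) _ _ d\<alpha> d, of k "- s" "1 / k"] ks pos by auto
  have rot: "k * (k * p - s * q) + s * (k * q + s * p) = p" "k * (k * q + s * p) - s * (k * p - s * q) = q" for p q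
  proof -
    have "k * (k * p - s * q) + s * (k * q + s * p) = (k\<^sup>2 + s\<^sup>2) * p"
      "k * (k * q + s * p) - s * (k * p - s * q) = (k\<^sup>2 + s\<^sup>2) * q"
      by (simp_all add: power2_eq_square algebra_simps)
    then show "k * (k * p - s * q) + s * (k * q + s * p) = p" "k * (k * q + s * p) - s * (k * p - s * q) = q"
      by (simp_all add: ks)
  qed
  have "R_par c x vs = (ReOmega_par k s \<omega> \<Omega>) c x vs \<and> R_perp c x vs = (ReOmega_perp k s \<omega> \<Omega>) c x vs \<and>
      I c x vs = fIm \<Omega> c x vs" if c: "c \<in> A" "x \<in> cimage c" for c x vs
  proof -
    have "R_par c x vs = of_real (s * Re (w c x vs))" "R_perp c x vs = of_real (k * Re (Z c x vs))"
      "I c x vs = of_real (Im (Z c x vs))"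
      using pos by (simp_all add: complex_eq_iff at[OF c])
    moreover have "\<omega> c x vs = of_real (k * Re (w c x vs) - s * Re (Z c x vs))"
      unfolding \<omega>_def by (simp add: fscale_def fRe_def complex_eq_iff at(8)[OF c])
    moreover have "Re (\<Omega> c x vs) = k * Re (Z c x vs) + s * Re (w c x vs)" "Im (\<Omega> c x vs) = Im (Z c x vs)"
      unfolding \<Omega>_def by (simp_all add: fscale_def fRe_def fIm_def at(8)[OF c])
    ultimately show ?thesis
      unfolding ReOmega_eq[OF k s ks] using rot[where p = "Re (w c x vs)" and q = "Re (Z c x vs)"]
      by (simp add: fscale_def fRe_def fIm_def complex_eq_iff)
  qed
  then have "form_eq A R_par (ReOmega_par k s \<omega> \<Omega>)" "form_eq A R_perp (ReOmega_perp k s \<omega> \<Omega>)" "form_eq A I (fIm \<Omega>)"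
    unfolding form_eq_def by blast+
  then show ?thesis using Jg susy unfolding susy_IIB_solution_def by blast
qed

theorem theorem3p2:
  fixes X :: "'m topology" and A :: "'m chart set"
  assumes "smooth_manifold6 X A"
  shows
    "(\<forall>(k_par::real) (k_perp::real) J g \<alpha> \<omega> \<Omega>.
        k_par \<in> {0<..<1} \<and> k_perp \<in> {0<..<1} \<and> k_par\<^sup>2 + k_perp\<^sup>2 = 1 \<and>
        su2_structure A J g \<alpha> \<omega> \<Omega> \<and>
        susy_IIB_equations A k_par k_perp \<alpha>
          (ReOmega_par k_par k_perp \<omega> \<Omega>) (ReOmega_perp k_par k_perp \<omega> \<Omega>) (fIm \<Omega>) \<longrightarrow>
        (let \<alpha>1 = complex_of_real k_par *\<^sub>F fRe \<alpha> + \<i> *\<^sub>F fIm \<alpha>;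
             \<alpha>2 = complex_of_real k_par *\<^sub>F fIm \<alpha> - \<i> *\<^sub>F fRe \<alpha>;
             \<omega>' = complex_of_real (1 / k_perp) *\<^sub>F ReOmega_par k_par k_perp \<omega> \<Omega>;
             \<Omega>' = complex_of_real (1 / k_par) *\<^sub>F ReOmega_perp k_par k_perp \<omega> \<Omega> + \<i> *\<^sub>F fIm \<Omega>
         in (\<exists>J1 g1. half_flat_su2 A J1 g1 \<alpha>1 \<omega>' \<Omega>') \<and>
            (\<exists>J2 g2. half_flat_su2 A J2 g2 \<alpha>2 \<omega>' \<Omega>') \<and>
            form_eq A (ext_d \<alpha>1) 0 \<and>
            form_eq A \<alpha>2 (hat_alpha2 k_par \<alpha>1)))
     \<and>
     (\<forall>(k_par::real) (k_perp::real) J1 g1 J2 g2 \<alpha>1 \<omega>' \<Omega>' \<alpha> R_par R_perp I.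
        half_flat_su2 A J1 g1 \<alpha>1 \<omega>' \<Omega>' \<and>
        form_eq A (ext_d \<alpha>1) 0 \<and>
        k_par \<in> {0<..<1} \<and>
        half_flat_su2 A J2 g2 (hat_alpha2 k_par \<alpha>1) \<omega>' \<Omega>' \<and>
        k_perp = sqrt (1 - k_par\<^sup>2) \<and>
        diff_form A 1 \<alpha> \<and>
        diff_form A 2 R_par \<and> real_form A R_par \<and>
        diff_form A 2 R_perp \<and> real_form A R_perp \<and>
        diff_form A 2 I \<and> real_form A I \<and>
        form_eq A (complex_of_real (1 / k_perp) *\<^sub>F R_par) \<omega>' \<and>
        form_eq A (complex_of_real (1 / k_par) *\<^sub>F R_perp + \<i> *\<^sub>F I) \<Omega>' \<and>
        form_eq A (complex_of_real k_par *\<^sub>F fRe \<alpha> + \<i> *\<^sub>F fIm \<alpha>) \<alpha>1 \<longrightarrow>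
        susy_IIB_solution A k_par k_perp \<alpha> R_par R_perp I)"
proof (intro conjI allI impI)
  fix k_par k_perp :: real and J g and \<alpha> \<omega> \<Omega> :: "'m dform"
  assume H: "k_par \<in> {0<..<1} \<and> k_perp \<in> {0<..<1} \<and> k_par\<^sup>2 + k_perp\<^sup>2 = 1 \<and>
      su2_structure A J g \<alpha> \<omega> \<Omega> \<and>
      susy_IIB_equations A k_par k_perp \<alpha>
        (ReOmega_par k_par k_perp \<omega> \<Omega>) (ReOmega_perp k_par k_perp \<omega> \<Omega>) (fIm \<Omega>)"
  from H have k: "k_par \<in> {0<..<1}" "k_perp \<in> {0<..<1}" "k_par\<^sup>2 + k_perp\<^sup>2 = 1"
    and su2: "su2_structure A J g \<alpha> \<omega> \<Omega>"
    and susy: "susy_IIB_equations A k_par k_perp \<alpha>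
        (ReOmega_par k_par k_perp \<omega> \<Omega>) (ReOmega_perp k_par k_perp \<omega> \<Omega>) (fIm \<Omega>)"
    by blast+
  show "let \<alpha>1 = complex_of_real k_par *\<^sub>F fRe \<alpha> + \<i> *\<^sub>F fIm \<alpha>;
           \<alpha>2 = complex_of_real k_par *\<^sub>F fIm \<alpha> - \<i> *\<^sub>F fRe \<alpha>;
           \<omega>' = complex_of_real (1 / k_perp) *\<^sub>F ReOmega_par k_par k_perp \<omega> \<Omega>;
           \<Omega>' = complex_of_real (1 / k_par) *\<^sub>F ReOmega_perp k_par k_perp \<omega> \<Omega> + \<i> *\<^sub>F fIm \<Omega>
       in (\<exists>J1 g1. half_flat_su2 A J1 g1 \<alpha>1 \<omega>' \<Omega>') \<and>
          (\<exists>J2 g2. half_flat_su2 A J2 g2 \<alpha>2 \<omega>' \<Omega>') \<and>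
          form_eq A (ext_d \<alpha>1) 0 \<and> form_eq A \<alpha>2 (hat_alpha2 k_par \<alpha>1)"
    unfolding Let_def using susy_gives_half_flat_pair[OF assms k su2 susy] by blast
next
  fix k_par k_perp :: real and J1 g1 J2 g2 and \<alpha>1 \<omega>' \<Omega>' \<alpha> R_par R_perp I :: "'m dform"
  assume "half_flat_su2 A J1 g1 \<alpha>1 \<omega>' \<Omega>' \<and>
      form_eq A (ext_d \<alpha>1) 0 \<and>
      k_par \<in> {0<..<1} \<and>
      half_flat_su2 A J2 g2 (hat_alpha2 k_par \<alpha>1) \<omega>' \<Omega>' \<and>
      k_perp = sqrt (1 - k_par\<^sup>2) \<and>
      diff_form A 1 \<alpha> \<and>
      diff_form A 2 R_par \<and> real_form A R_par \<and>
      diff_form A 2 R_perp \<and> real_form A R_perp \<and>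
      diff_form A 2 I \<and> real_form A I \<and>
      form_eq A (complex_of_real (1 / k_perp) *\<^sub>F R_par) \<omega>' \<and>
      form_eq A (complex_of_real (1 / k_par) *\<^sub>F R_perp + \<i> *\<^sub>F I) \<Omega>' \<and>
      form_eq A (complex_of_real k_par *\<^sub>F fRe \<alpha> + \<i> *\<^sub>F fIm \<alpha>) \<alpha>1"
  then show "susy_IIB_solution A k_par k_perp \<alpha> R_par R_perp I"
    by (elim conjE) (rule half_flat_pair_gives_susy[OF assms])
qed

end
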